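(* Let $\mu>0$, $2\mu+\lambda>0$, $\omega>0$, let $D\subset\mathbb{R}^2$ be a bounded domain of class $C^2$, and let $\boldsymbol u\in [C^2(\mathbb{R}^2\setminus\overline D)\cap C^1(\mathbb{R}^2\setminus D)]^2$ be a radiating solution of the Navier equation outside $D$, i.e. $$\Delta^*\boldsymbol u+\omega^2\boldsymbol u=\boldsymbol 0\ \text{ in } \mathbb{R}^2\setminus\overline D,\qquad \lim_{r\to\infty}\sqrt r\,\Big(\frac{\partial \boldsymbol u_p}{\partial r}-ik_p\boldsymbol u_p\Big)=\boldsymbol 0,\qquad \lim_{r\to\infty}\sqrt r\,\Big(\frac{\partial \boldsymbol u_s}{\partial r}-ik_s\boldsymbol u_s\Big)=\boldsymbol 0,\qquad r=|\boldsymbol x|.$$ Then $\phi:=-\frac{1}{k_p^2}\operatorname{div}\boldsymbol u$ and $\psi:=-\frac{1}{k_s^2}\operatorname{div}^\perp\boldsymbol u$ are radiating solutions of Helmholtz equations: $$\Delta\phi+k_p^2\phi=0\ \text{ in }\mathbb{R}^2\setminus\overline D,\qquad \Delta\psi+k_s^2\psi=0\ \text{ in }\mathbb{R}^2\setminus\overline D,$$ $$\lim_{r\to\infty}\sqrt r\,\Big(\frac{\partial\phi}{\partial r}-ik_p\phi\Big)=0,\qquad \lim_{r\to\infty}\sqrt r\,\Big(\frac{\partial\psi}{\partial r}-ik_s\psi\Big)=0,\qquad r=|\boldsymbol x|.$$ Furthermore, the far field patterns $\phi_\infty$ and $\psi_\infty$ of $\phi$ and $\psi$ satisfy, for all $\hat{\boldsymbol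 x}$ in the unit circle $\mathbb{S}$, $$\phi_\infty(\hat{\boldsymbol x})=\frac{1}{ik_p}u_p^\infty(\hat{\boldsymbol x}),\qquad \psi_\infty(\hat{\boldsymbol x})=\frac{1}{ik_s}u_s^\infty(\hat{\boldsymbol x}),$$ where $(u_p^\infty;u_s^\infty)$ is the far field pattern of $\boldsymbol u$.
   Context: Notation in $\mathbb{R}^2$: $\operatorname{grad}u=(\partial_1u;\partial_2u)$, $\operatorname{div}\boldsymbol u=\partial_1u_1+\partial_2u_2$, $\operatorname{grad}^\perp u=(-\partial_2u;\partial_1u)$, $\operatorname{div}^\perp\boldsymbol u=\partial_1u_2-\partial_2u_1$; $\hat{\boldsymbol x}=\boldsymbol x/|\boldsymbol x|$, and $\hat{\boldsymbol x}^\perp$ is $\hat{\boldsymbol x}$ rotated anticlockwise by $\pi/2$. $\Delta^*\boldsymbol u:=\mu\Delta\boldsymbol u+(\lambda+\mu)\operatorname{grad}\operatorname{div}\boldsymbol u$. The wave numbers are $k_p:=\omega/\sqrt{2\mu+\lambda}$ and $k_s:=\omega/\sqrt{\mu}$. The compressional and shear parts of a solution $\boldsymbol u$ of the Navier equation are $$\boldsymbol u_p:=-\frac{1}{k_p^2}\operatorname{grad}\operatorname{div}\boldsymbol u,\qquad \boldsymbol u_s:=-\frac{1}{k_s^2}\operatorname{grad}^\perp\operatorname{div}^\perp\boldsymbol u,$$ so that $\boldsymbol u=\boldsymbol u_p+\boldsymbol u_s$. Far field pattern of a radiating solution of the Navier equation: it is well known that every such $\boldsymbol u$ has the asymptotic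 behaviour $$\boldsymbol u(\boldsymbol x)=\frac{e^{ik_p|\boldsymbol x|}}{\sqrt{|\boldsymbol x|}}u_p^\infty(\hat{\boldsymbol x})\hat{\boldsymbol x}+\frac{e^{ik_s|\boldsymbol x|}}{\sqrt{|\boldsymbol x|}}u_s^\infty(\hat{\boldsymbol x})\hat{\boldsymbol x}^\perp+O(|\boldsymbol x|^{-3/2}),\quad|\boldsymbol x|\to\infty,$$ uniformly in $\hat{\boldsymbol x}\in\mathbb{S}$, with $u_p^\infty,u_s^\infty$ analytic on $\mathbb{S}$; the far field pattern is $(u_p^\infty;u_s^\infty)$. Far field pattern of a radiating solution $w$ of the Helmholtz equation with wave number $k$: the function $w_\infty$ on $\mathbb{S}$ with $w(\boldsymbol x)=\frac{e^{ik|\boldsymbol x|}}{\sqrt{|\boldsymbol x|}}\{w_\infty(\hat{\boldsymbol x})+O(1/|\boldsymbol x|)\}$ as $|\boldsymbol x|\to\infty$. *)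

theory Defs
  imports "HOL-Analysis.Analysis" "HOL-Library.Landau_Symbols"
begin

section \<open>Smoothness classes and domains\<close>

text \<open>\<open>Ck n f S\<close> is \<open>f \<in> C\<^sup>n(S)\<close>. It is meant for open \<open>S\<close>: differentiability is taken in a full
  neighbourhood of each point.\<close>

primrec Ck ::
  "nat \<Rightarrow> ('a::euclidean_space \<Rightarrow> 'b::real_normed_vector) \<Rightarrow> 'a set \<Rightarrow> bool" where
  "Ck 0 f S \<longleftrightarrow> continuous_on S f"
| "Ck (Suc n) f S \<longleftrightarrow> (\<forall>x\<in>S. f differentiable (at x)) \<and>
     (\<forall>b\<in>Basis. Ck n (\<lambda>x. frechet_derivative f (at x) b) S)"

text \<open>\<open>C\<^sup>1(K)\<close> for the closure \<open>K\<close> of an open set: \<open>f\<close> is \<open>C\<^sup>1\<close> in the interior, and \<open>f\<close> and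
  its first partial derivatives extend continuously to \<open>K\<close> (the extension of \<open>f\<close> being \<open>f\<close> itself).\<close>

definition C1_upto_boundary ::
  "('a::euclidean_space \<Rightarrow> 'b::real_normed_vector) \<Rightarrow> 'a set \<Rightarrow> bool" where
  "C1_upto_boundary f K \<longleftrightarrow> Ck 1 f (interior K) \<and> continuous_on K f \<and>
     (\<forall>b\<in>Basis. \<exists>g. continuous_on K g \<and>
        (\<forall>x\<in>interior K. g x = frechet_derivative f (at x) b))"

text \<open>A domain is a nonempty connected open set. It is of class \<open>C\<^sup>2\<close> if, near each boundary point
  and in suitable Cartesian coordinates, it is the set of points strictly on one side of the graph
  of a \<open>C\<^sup>2\<close> function; \<open>a, b\<close> are the (rotated or reflected) coordinate directions.\<close>

definition C2_domain :: "(real^2) set \<Rightarrow> bool" where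
  "C2_domain D \<longleftrightarrow> open D \<and> connected D \<and> D \<noteq> {} \<and>
     (\<forall>z\<in>frontier D. \<exists>r>0. \<exists>(\<gamma>::real \<Rightarrow> real) a b.
        Ck 2 \<gamma> UNIV \<and> norm a = 1 \<and> norm b = 1 \<and> a \<bullet> b = 0 \<and>
        D \<inter> ball z r = {x \<in> ball z r. x \<bullet> b > \<gamma> (x \<bullet> a)})"

section \<open>Differential operators in the plane\<close>

definition partial :: "2 \<Rightarrow> (real^2 \<Rightarrow> complex) \<Rightarrow> real^2 \<Rightarrow> complex" where
  "partial j f x = frechet_derivative f (at x) (axis j 1)"

definition grad :: "(real^2 \<Rightarrow> complex) \<Rightarrow> real^2 \<Rightarrow> complex^2" where
  "grad f x = vector [partial 1 f x, partial 2 f x]"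

definition grad_perp :: "(real^2 \<Rightarrow> complex) \<Rightarrow> real^2 \<Rightarrow> complex^2" where
  "grad_perp f x = vector [- partial 2 f x, partial 1 f x]"

definition dvg :: "(real^2 \<Rightarrow> complex^2) \<Rightarrow> real^2 \<Rightarrow> complex" where
  "dvg u x = partial 1 (\<lambda>y. u y $ 1) x + partial 2 (\<lambda>y. u y $ 2) x"

definition dvg_perp :: "(real^2 \<Rightarrow> complex^2) \<Rightarrow> real^2 \<Rightarrow> complex" where
  "dvg_perp u x = partial 1 (\<lambda>y. u y $ 2) x - partial 2 (\<lambda>y. u y $ 1) x"

definition laplacian :: "(real^2 \<Rightarrow> complex) \<Rightarrow> real^2 \<Rightarrow> complex" where
  "laplacian f x = partial 1 (partial 1 f) x + partial 2 (partial 2 f) x"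

definition vec_laplacian :: "(real^2 \<Rightarrow> complex^2) \<Rightarrow> real^2 \<Rightarrow> complex^2" where
  "vec_laplacian u x = (\<chi> j. laplacian (\<lambda>y. u y $ j) x)"

text \<open>\<open>sgn x\<close> is the unit vector \<open>x / |x|\<close>.\<close>

definition radial_deriv ::
  "(real^2 \<Rightarrow> 'b::real_normed_vector) \<Rightarrow> real^2 \<Rightarrow> 'b" where
  "radial_deriv f x = frechet_derivative f (at x) (sgn x)"

section \<open>The Helmholtz equation\<close>

text \<open>The filter \<open>at_infinity\<close> on \<open>real^2\<close> makes limits and \<open>O\<close>-terms uniform in the direction
  of \<open>x\<close>, as is customary for the Sommerfeld condition and for far field expansions.\<close>

definition radiating_helmholtz ::
  "real \<Rightarrow> (real^2) set \<Rightarrow> (real^2 \<Rightarrow> complex) \<Rightarrow> bool" where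
  "radiating_helmholtz k D w \<longleftrightarrow>
     Ck 2 w (- closure D) \<and>
     (\<forall>x \<in> - closure D. laplacian w x + (of_real k)\<^sup>2 * w x = 0) \<and>
     ((\<lambda>x. sqrt (norm x) *\<^sub>R (radial_deriv w x - \<i> * of_real k * w x)) \<longlongrightarrow> 0) at_infinity"

text \<open>Far field patterns are functions on the unit circle \<open>sphere 0 1\<close>; their values elsewhere are
  irrelevant.\<close>

definition helmholtz_far_field ::
  "real \<Rightarrow> (real^2 \<Rightarrow> complex) \<Rightarrow> (real^2 \<Rightarrow> complex) \<Rightarrow> bool" where
  "helmholtz_far_field k w winf \<longleftrightarrow>
     (\<exists>\<rho>. \<rho> \<in> O[at_infinity](\<lambda>x. of_real (1 / norm x)) \<and>
        (\<forall>\<^sub>F x in at_infinity.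
           w x = exp (\<i> * of_real (k * norm x)) / of_real (sqrt (norm x)) *
                 (winf (sgn x) + \<rho> x)))"

section \<open>The Navier equation\<close>

definition k_p :: "real \<Rightarrow> real \<Rightarrow> real \<Rightarrow> real" where
  "k_p \<mu> lam \<omega> = \<omega> / sqrt (2 * \<mu> + lam)"

definition k_s :: "real \<Rightarrow> real \<Rightarrow> real" where
  "k_s \<mu> \<omega> = \<omega> / sqrt \<mu>"

definition navier_op ::
  "real \<Rightarrow> real \<Rightarrow> (real^2 \<Rightarrow> complex^2) \<Rightarrow> real^2 \<Rightarrow> complex^2" where
  "navier_op \<mu> lam u x = \<mu> *\<^sub>R vec_laplacian u x + (lam + \<mu>) *\<^sub>R grad (dvg u) x"

definition compressional :: "real \<Rightarrow> (real^2 \<Rightarrow> complex^2) \<Rightarrow> real^2 \<Rightarrow> complex^2" where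
  "compressional kp u x = (- (1 / kp\<^sup>2)) *\<^sub>R grad (dvg u) x"

definition shear :: "real \<Rightarrow> (real^2 \<Rightarrow> complex^2) \<Rightarrow> real^2 \<Rightarrow> complex^2" where
  "shear ks u x = (- (1 / ks\<^sup>2)) *\<^sub>R grad_perp (dvg_perp u) x"

definition kupradze :: "real \<Rightarrow> (real^2 \<Rightarrow> complex^2) \<Rightarrow> bool" where
  "kupradze k v \<longleftrightarrow>
     ((\<lambda>x. sqrt (norm x) *\<^sub>R (radial_deriv v x - (\<i> * of_real k) *s v x)) \<longlongrightarrow> 0) at_infinity"

definition radiating_navier ::
  "real \<Rightarrow> real \<Rightarrow> real \<Rightarrow> (real^2) set \<Rightarrow> (real^2 \<Rightarrow> complex^2) \<Rightarrow> bool" where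
  "radiating_navier \<mu> lam \<omega> D u \<longleftrightarrow>
     Ck 2 u (- closure D) \<and> C1_upto_boundary u (- D) \<and>
     (\<forall>x \<in> - closure D. navier_op \<mu> lam u x + \<omega>\<^sup>2 *\<^sub>R u x = 0) \<and>
     kupradze (k_p \<mu> lam \<omega>) (compressional (k_p \<mu> lam \<omega>) u) \<and>
     kupradze (k_s \<mu> \<omega>) (shear (k_s \<mu> \<omega>) u)"

text \<open>Real analyticity on the unit circle, in the angle.\<close>

definition analytic_on_circle :: "(real^2 \<Rightarrow> complex) \<Rightarrow> bool" where
  "analytic_on_circle f \<longleftrightarrow>
     (\<forall>t0. \<exists>\<epsilon>>0. \<exists>c :: nat \<Rightarrow> complex. \<forall>t. \<bar>t - t0\<bar> < \<epsilon> \<longrightarrow>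
        (\<lambda>n. c n * of_real ((t - t0) ^ n)) sums f (vector [cos t, sin t]))"

definition rot90 :: "real^2 \<Rightarrow> real^2" where
  "rot90 x = vector [- (x $ 2), x $ 1]"

definition cvec :: "real^2 \<Rightarrow> complex^2" where
  "cvec x = (\<chi> j. of_real (x $ j))"

definition navier_far_field ::
  "real \<Rightarrow> real \<Rightarrow> (real^2 \<Rightarrow> complex^2) \<Rightarrow>
   (real^2 \<Rightarrow> complex) \<Rightarrow> (real^2 \<Rightarrow> complex) \<Rightarrow> bool" where
  "navier_far_field kp ks u upinf usinf \<longleftrightarrow>
     analytic_on_circle upinf \<and> analytic_on_circle usinf \<and>
     (\<lambda>x. norm (u x
        - (exp (\<i> * of_real (kp * norm x)) / of_real (sqrt (norm x)) * upinf (sgn x)) *s cvec (sgn x)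
        - (exp (\<i> * of_real (ks * norm x)) / of_real (sqrt (norm x)) * usinf (sgn x)) *s
            cvec (rot90 (sgn x))))
       \<in> O[at_infinity](\<lambda>x. norm x powr (-3/2))"

end

theory Submission
  imports Defs
begin

text \<open>
  Everything rests on one identity. Let \<open>u = grad \<phi> + grad_perp \<psi>\<close> with \<open>div u = - k\<^sup>2 \<phi>\<close>, all of class
  \<open>C\<^sup>1\<close>. The circular mean \<open>M(s)\<close> of \<open>\<phi>\<close> over the circle of radius \<open>s\<close> about \<open>x\<close> and \<open>s\<close> times the outward
  flux \<open>\<Phi>(s)\<close> of \<open>u\<close> satisfy \<open>s M' = s \<Phi>\<close> and \<open>(s \<Phi>)' = - k\<^sup>2 s M\<close>. This linear Volterra system has one
  free parameter, \<open>M(0)\<close>, so comparison with a plane wave shows that the flux of \<open>u\<close> through a circle of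
  small radius \<open>R\<close> is \<open>c(k, R) \<phi>(x)\<close> with a constant \<open>c(k, R) \<noteq> 0\<close>. Thus \<open>\<phi>\<close> is a local average of \<open>u\<close>.

  For a solution \<open>u\<close> of the Navier equation this identity makes \<open>\<phi>\<close> as smooth as \<open>u\<close>, hence a classical
  solution of the Helmholtz equation. Applied to the partial derivatives of \<open>\<phi>\<close>, it replaces interior
  elliptic estimates: the Kupradze condition gives \<open>grad \<phi> = o(r\<^sup>1\<^sup>/\<^sup>2)\<close> along rays, then second derivatives
  are \<open>o(r\<^sup>1\<^sup>/\<^sup>2)\<close> too, and averaging the Kupradze condition over a circle costs only the error
  \<open>O(1/r) o(r\<^sup>1\<^sup>/\<^sup>2)\<close> caused by the varying radial direction. Finally, inserting the far field expansion
  of \<open>u\<close>, which is a plane wave up to \<open>O(r\<^sup>-\<^sup>3\<^sup>/\<^sup>2)\<close> on the circle, yields that of \<open>\<phi>\<close>. The function \<open>\<psi>\<close>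
  is treated by the same argument applied to the rotated field \<open>(u\<^sub>2, - u\<^sub>1)\<close>.
\<close>

section \<open>Calculus with partial derivatives\<close>

text \<open>For \<open>u\<close> of class C^2 the function \<open>\<phi>\<close> is a priori only
  C^1: its Laplacian would be a third derivative of \<open>u\<close>. Hence the identity is set up
  with first derivatives only, and the flux contains \<open>u\<close> itself and no derivative of
  it, so that derivatives with respect to the centre of the circle fall on \<open>u\<close>. The
  potential \<open>\<psi>\<close> enters the flux only through its derivative along the circle,
  which integrates to zero. A shear wave of any other wave number is thereby filtered out, without
  first splitting \<open>u\<close> into its two parts and without an equation for
  \<open>\<psi>\<close>. The restriction k R < 2 on the radius does two things: it makes the
  Volterra system contract, and it keeps k R below the first positive zero of the Bessel function
  J_1, which is c(k, R) up to the factor - 2 pi k.\<close>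

lemma Basis_real2: "(Basis :: (real^2) set) = {axis 1 1, axis 2 1}"
  by (auto simp: Basis_vec_def UNIV_2)

lemma real2_decompose: "(x :: real^2) = x $ 1 *\<^sub>R axis 1 1 + x $ 2 *\<^sub>R axis 2 1"
  by (simp add: vec_eq_iff forall_2 axis_def)

lemmas has_derivative_frechet = frechet_derivative_works[THEN iffD1]

lemma partial_eqI: "(f has_derivative f') (at x) \<Longrightarrow> partial j f x = f' (axis j 1)"
  unfolding partial_def by (metis frechet_derivative_at)

lemma frechet_derivative_partial:
  assumes "f differentiable (at x)"
  shows "frechet_derivative f (at x) h = h $ 1 *\<^sub>R partial 1 f x + h $ 2 *\<^sub>R partial 2 f x"
proof -
  interpret bounded_linear "frechet_derivative f (at x)"
    using assms has_derivative_frechet has_derivative_bounded_linear by blast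
  show ?thesis
    unfolding partial_def by (subst real2_decompose [of h]) (simp only: add scaleR)
qed

lemma has_derivative_partial:
  assumes "f differentiable (at x)"
  shows "(f has_derivative (\<lambda>h. h $ 1 *\<^sub>R partial 1 f x + h $ 2 *\<^sub>R partial 2 f x)) (at x)"
proof -
  have "frechet_derivative f (at x) = (\<lambda>h. h $ 1 *\<^sub>R partial 1 f x + h $ 2 *\<^sub>R partial 2 f x)"
    by (intro ext frechet_derivative_partial[OF assms])
  then show ?thesis
    using has_derivative_frechet[OF assms] by simp
qed

text \<open>\<open>frechet_derivative\<close> is a choice from the set of derivatives, and the two
  functions have the same set at \<open>x\<close>, empty or not.\<close>

lemma frechet_derivative_cong_open:
  assumes "open S" "x \<in> S" "\<And>y. y \<in> S \<Longrightarrow> f y = g y"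
  shows "frechet_derivative f (at x) = frechet_derivative g (at x)"
proof -
  have "(f has_derivative D) (at x) \<longleftrightarrow> (g has_derivative D) (at x)" for D
    using has_derivative_transform_within_open[OF _ assms(1,2), of f D UNIV g]
      has_derivative_transform_within_open[OF _ assms(1,2), of g D UNIV f] assms(3) by auto
  then show ?thesis
    unfolding frechet_derivative_def by simp
qed

lemma partial_cong_open:
  assumes "open S" "x \<in> S" "\<And>y. y \<in> S \<Longrightarrow> f y = g y"
  shows "partial j f x = partial j g x"
  unfolding partial_def using frechet_derivative_cong_open[OF assms] by simp

section \<open>The classes \<open>Ck\<close>: locality, closure properties, Clairaut's
  theorem\<close>

lemma Ck_Suc_partial:
  "Ck (Suc n) f S \<longleftrightarrow> (\<forall>x\<in>S. f differentiable (at x)) \<and> (\<forall>j. Ck n (partial j f) S)"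
  unfolding partial_def[abs_def] by (auto simp: Basis_real2 forall_2)

lemma Ck_SucI:
  "\<lbrakk>\<And>x. x \<in> S \<Longrightarrow> f differentiable (at x); \<And>j. Ck n (partial j f) S\<rbrakk> \<Longrightarrow> Ck (Suc n) f S"
  by (simp only: Ck_Suc_partial) blast

lemma Ck_SucD:
  assumes "Ck (Suc n) f S"
  shows "x \<in> S \<Longrightarrow> f differentiable (at x)" "Ck n (partial j f) S"
  using assms by (simp_all only: Ck_Suc_partial)

text \<open>Openness of \<open>S\<close> lets equality on \<open>S\<close> pass to derivatives; in
  the inductions below a derivative is replaced in this way by the formula computed for it.\<close>

lemma Ck_cong:
  assumes "open S" "\<And>x. x \<in> S \<Longrightarrow> f x = g x" "Ck n f S"
  shows "Ck n g S"
  using assms(2,3)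
proof (induction n arbitrary: f g)
  case 0
  then show ?case by (simp cong: continuous_on_cong)
next
  case (Suc n)
  have "g differentiable (at x)" if "x \<in> S" for x
  proof -
    have "(f has_derivative frechet_derivative f (at x)) (at x)"
      using Suc.prems(2) that by (simp add: has_derivative_frechet)
    from has_derivative_transform_within_open[OF this \<open>open S\<close> that Suc.prems(1)]
    show ?thesis
      unfolding differentiable_def by blast
  qed
  moreover have "Ck n (\<lambda>x. frechet_derivative g (at x) b) S" if "b \<in> Basis" for b
    using Suc.IH[of "\<lambda>x. frechet_derivative f (at x) b" "\<lambda>x. frechet_derivative g (at x) b"]
      frechet_derivative_cong_open[OF \<open>open S\<close> _ Suc.prems(1)] Suc.prems(2) that by simp
  ultimately show ?case by simp
qed

lemma Ck_continuous_on: "Ck n f S \<Longrightarrow> continuous_on S f"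
  by (cases n) (auto intro!: continuous_at_imp_continuous_on differentiable_imp_continuous_within)

lemma Ck_lower: "Ck (Suc n) f S \<Longrightarrow> Ck n f S"
proof (induction n arbitrary: f)
  case 0
  then show ?case using Ck_continuous_on[of "Suc 0" f S] by (simp del: Ck.simps(2))
next
  case (Suc n)
  show ?case
    unfolding Ck.simps(2)[of n]
    using Suc.prems Suc.IH unfolding Ck.simps(2)[of "Suc n"] by blast
qed

text \<open>Meant for gluing: \<open>flux_field_regularity\<close> represents its function only on
  balls whose radius depends on the point.\<close>

lemma Ck_local:
  assumes "\<And>x. x \<in> S \<Longrightarrow> \<exists>T. open T \<and> x \<in> T \<and> Ck n f T"
  shows "Ck n f S"
  using assms
proof (induction n arbitrary: f)
  case 0
  have "continuous (at x) f" if "x \<in> S" for x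
    using 0[OF that] by (auto simp: continuous_on_eq_continuous_at)
  then show ?case
    by (simp add: continuous_at_imp_continuous_on)
next
  case (Suc n)
  have "Ck n (\<lambda>x. frechet_derivative f (at x) b) S" if "b \<in> Basis" for b
  proof (rule Suc.IH)
    fix x assume "x \<in> S"
    with Suc.prems[of x] that
    show "\<exists>T. open T \<and> x \<in> T \<and> Ck n (\<lambda>x. frechet_derivative f (at x) b) T"
      by auto
  qed
  moreover have "f differentiable (at x)" if "x \<in> S" for x
    using Suc.prems[OF that] by auto
  ultimately show ?case by simp
qed

lemma Ck_bounded_linear:
  assumes "bounded_linear L" "open S" "Ck n f S"
  shows "Ck n (\<lambda>x. L (f x)) S"
  using assms(3)
proof (induction n arbitrary: f)
  case 0
  then show ?case
    using assms(1) by (auto intro: bounded_linear.continuous_on)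
next
  case (Suc n)
  have D: "((\<lambda>x. L (f x)) has_derivative (\<lambda>h. L (frechet_derivative f (at x) h))) (at x)"
    if "x \<in> S" for x
    using Suc.prems that assms(1)
    by (auto intro: bounded_linear.has_derivative has_derivative_frechet)
  have "Ck n (\<lambda>x. frechet_derivative (\<lambda>x. L (f x)) (at x) b) S" if "b \<in> Basis" for b
  proof (rule Ck_cong[OF \<open>open S\<close>])
    show "Ck n (\<lambda>x. L (frechet_derivative f (at x) b)) S"
      using Suc.prems that by (intro Suc.IH) simp
    show "L (frechet_derivative f (at x) b) = frechet_derivative (\<lambda>x. L (f x)) (at x) b"
      if "x \<in> S" for x
      by (rule fun_cong[OF frechet_derivative_at[OF D[OF that]]])
  qed
  then show ?case using D by (auto simp: differentiable_def)
qed

lemma Ck_add: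
  assumes "open S" "Ck n f S" "Ck n g S"
  shows "Ck n (\<lambda>x. f x + g x) S"
  using assms(2,3)
proof (induction n arbitrary: f g)
  case 0
  then show ?case by (auto intro: continuous_intros)
next
  case (Suc n)
  have D: "((\<lambda>x. f x + g x) has_derivative
      (\<lambda>h. frechet_derivative f (at x) h + frechet_derivative g (at x) h)) (at x)"
    if "x \<in> S" for x
    using Suc.prems that
    by (intro has_derivative_add has_derivative_frechet) auto
  have "Ck n (\<lambda>x. frechet_derivative (\<lambda>x. f x + g x) (at x) b) S" if "b \<in> Basis" for b
  proof (rule Ck_cong[OF \<open>open S\<close>])
    show "Ck n (\<lambda>x. frechet_derivative f (at x) b + frechet_derivative g (at x) b) S"
      using Suc.prems that by (intro Suc.IH) simp_all
    show "frechet_derivative f (at x) b + frechet_derivative g (at x) b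
        = frechet_derivative (\<lambda>x. f x + g x) (at x) b" if "x \<in> S" for x
      by (rule fun_cong[OF frechet_derivative_at[OF D[OF that]]])
  qed
  then show ?case using D by (auto simp: differentiable_def)
qed

lemma Ck_cmult:
  fixes f :: "'a::euclidean_space \<Rightarrow> complex"
  shows "\<lbrakk>open S; Ck n f S\<rbrakk> \<Longrightarrow> Ck n (\<lambda>x. c * f x) S"
  by (rule Ck_bounded_linear[OF bounded_linear_mult_right])

lemma Ck_uminus:
  "\<lbrakk>open S; Ck n f S\<rbrakk> \<Longrightarrow> Ck n (\<lambda>x. - f x) S"
  by (rule Ck_bounded_linear[OF bounded_linear_minus[OF bounded_linear_ident]])

lemma Ck_diff: "\<lbrakk>open S; Ck n f S; Ck n g S\<rbrakk> \<Longrightarrow> Ck n (\<lambda>x. f x - g x) S"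
  using Ck_add[of S n f "\<lambda>x. - g x"] Ck_uminus[of S n g] by simp

lemma Ck_component:
  "\<lbrakk>open S; Ck n u S\<rbrakk> \<Longrightarrow> Ck n (\<lambda>x. u x $ i) S"
  by (rule Ck_bounded_linear[OF bounded_linear_vec_nth])

lemma partial_add:
  "\<lbrakk>f differentiable (at x); g differentiable (at x)\<rbrakk>
   \<Longrightarrow> partial j (\<lambda>x. f x + g x) x = partial j f x + partial j g x"
  using partial_eqI[OF has_derivative_add[OF has_derivative_frechet has_derivative_frechet]]
  by (simp add: partial_def)

lemma partial_diff:
  "\<lbrakk>f differentiable (at x); g differentiable (at x)\<rbrakk>
   \<Longrightarrow> partial j (\<lambda>x. f x - g x) x = partial j f x - partial j g x"
  using partial_eqI[OF has_derivative_diff[OF has_derivative_frechet has_derivative_frechet]]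
  by (simp add: partial_def)

lemma partial_cmult:
  "f differentiable (at x) \<Longrightarrow> partial j (\<lambda>x. c * f x) x = c * partial j f x"
  using partial_eqI[OF has_derivative_mult_right[OF has_derivative_frechet]]
  by (simp add: partial_def)

lemma partial_uminus:
  "f differentiable (at x) \<Longrightarrow> partial j (\<lambda>x. - f x) x = - partial j f x"
  using partial_eqI[OF has_derivative_minus[OF has_derivative_frechet]]
  by (simp add: partial_def)

lemma partial_zero: "partial j (\<lambda>_. 0) = (\<lambda>_. 0)"
  using partial_eqI[OF has_derivative_const] by (auto simp: fun_eq_iff)

lemma Ck_zero: "Ck n (\<lambda>_. 0) S"
  by (induction n) auto

lemma Ck_2D:
  assumes "Ck 2 f S"
  shows "Ck 1 f S" "Ck 1 (partial j f) S" "x \<in> S \<Longrightarrow> f differentiable (at x)"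
    "x \<in> S \<Longrightarrow> partial j f differentiable (at x)" "continuous_on S (partial i (partial j f))"
proof -
  have *: "Ck (Suc (Suc 0)) f S"
    using assms by (simp only: numeral_2_eq_2)
  then show "Ck 1 f S" "Ck 1 (partial j f) S"
    using Ck_lower Ck_SucD(2) unfolding One_nat_def by blast+
  then have **: "Ck (Suc 0) f S" "Ck (Suc 0) (partial j f) S"
    by simp_all
  show "x \<in> S \<Longrightarrow> f differentiable (at x)" "x \<in> S \<Longrightarrow> partial j f differentiable (at x)"
    using ** Ck_SucD(1) by blast+
  show "continuous_on S (partial i (partial j f))"
    using Ck_SucD(2)[OF **(2)] by (rule Ck_continuous_on)
qed

lemma has_vector_derivative_along:
  fixes f :: "real^2 \<Rightarrow> complex"
  assumes "f differentiable (at (p s))" and "(p has_vector_derivative v) (at s within A)"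
  shows "((\<lambda>s. f (p s)) has_vector_derivative v $ 1 *\<^sub>R partial 1 f (p s) + v $ 2 *\<^sub>R partial 2 f (p s))
    (at s within A)"
  using has_derivative_compose[OF assms(2)[unfolded has_vector_derivative_def]
      has_derivative_partial[OF assms(1)]]
  unfolding has_vector_derivative_def by (simp add: scaleR_add_right)

text \<open>Clairaut's theorem, by differentiating \<open>f(s, t) - f(s, 0) = \<integral>\<^sub>0\<^sup>t \<partial>\<^sub>2 f(s, \<tau>) d\<tau>\<close> in \<open>s\<close>
  under the integral and then in \<open>t\<close>.\<close>

lemma partial_commute:
  fixes f :: "real^2 \<Rightarrow> complex"
  assumes "open S" "Ck 2 f S" "x \<in> S"
  shows "partial 1 (partial 2 f) x = partial 2 (partial 1 f) x"
proof -
  have C2: "Ck (Suc (Suc 0)) f S"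
    using assms(2) by (simp only: numeral_2_eq_2)
  obtain \<delta> where \<delta>: "\<delta> > 0" "ball x \<delta> \<subseteq> S"
    using assms openE by blast
  \<comment> \<open>For \<open>s, t \<le> r\<close> the point \<open>P s t\<close> has distance at
    most \<open>2 * \<delta> / 3\<close> from \<open>x\<close>, so the whole square lies in
    \<open>S\<close>.\<close>
  define r where "r = \<delta> / 3"
  have "r > 0" using \<delta> by (simp add: r_def)
  define P where "P s t = x + s *\<^sub>R axis 1 1 + t *\<^sub>R axis 2 1" for s t :: real
  have P: "P s t \<in> S" if "s \<in> {0..r}" "t \<in> {0..r}" for s t
  proof -
    have "norm (s *\<^sub>R axis 1 1 + t *\<^sub>R axis 2 1 :: real^2) \<le> s + t"
      using that by (intro norm_triangle_le) simp
    also have "\<dots> < \<delta>" using that \<delta> by (simp add: r_def)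
    moreover have "P s t - x = s *\<^sub>R axis 1 1 + t *\<^sub>R axis 2 1"
      by (simp add: P_def)
    ultimately have "P s t \<in> ball x \<delta>"
      by (simp add: mem_ball dist_norm norm_minus_commute[of x])
    then show ?thesis using \<delta> by blast
  qed
  have contP: "continuous_on A (\<lambda>p. P (fst p) (snd p))" for A
    unfolding P_def by (intro continuous_intros)
  have d1: "((\<lambda>s. g (P s t)) has_vector_derivative partial 1 g (P s t)) (at s within A)"
    if "g differentiable (at (P s t))" for g s t A
  proof -
    have "((\<lambda>s. P s t) has_vector_derivative axis 1 1) (at s within A)"
      unfolding P_def by (auto intro!: derivative_eq_intros)
    from has_vector_derivative_along[OF that this] show ?thesis
      by (simp add: axis_def)
  qed
  have d2: "((\<lambda>t. g (P s t)) has_vector_derivative partial 2 g (P s t)) (at t within A)"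
    if "g differentiable (at (P s t))" for g s t A
  proof -
    have "((\<lambda>t. P s t) has_vector_derivative axis 2 1) (at t within A)"
      unfolding P_def by (auto intro!: derivative_eq_intros)
    from has_vector_derivative_along[OF that this] show ?thesis
      by (simp add: axis_def)
  qed
  note diff = Ck_SucD(1)[OF C2] Ck_SucD(1)[OF Ck_SucD(2)[OF C2]]
  have cont: "continuous_on ({0..r} \<times> {0..r}) (\<lambda>(s, t). g (P s t))" if "continuous_on S g" for g :: "real^2 \<Rightarrow> complex"
    unfolding split_beta using P by (intro continuous_on_compose2[OF that] contP) auto
  have cont': "continuous_on {0..r} (\<lambda>t. g (P s t))" if "continuous_on S g" "s \<in> {0..r}"
    for g :: "real^2 \<Rightarrow> complex" and s
    unfolding P_def
    by (rule continuous_on_compose2[OF that(1)]) (use P that in \<open>auto intro!: continuous_intros simp: P_def\<close>)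
  have c2: "continuous_on S (partial 2 f)" and c12: "continuous_on S (partial 1 (partial 2 f))"
    using Ck_continuous_on Ck_SucD(2)[OF C2] Ck_SucD(2)[OF Ck_SucD(2)[OF C2]] by blast+
  \<comment> \<open>Since \<open>x\<close> is the corner of the square, the derivatives at parameter
    0 are one-sided. That is enough: both mixed partials exist, and a one-sided derivative already
    determines their values.\<close>
  have eq: "partial 1 f (P 0 t) - partial 1 f (P 0 0) = integral {0..t} (\<lambda>\<tau>. partial 1 (partial 2 f) (P 0 \<tau>))"
    if t: "t \<in> {0..r}" for t
  proof -
    have int: "integral {0..t} (\<lambda>\<tau>. partial 2 f (P s \<tau>)) = f (P s t) - f (P s 0)" if "s \<in> {0..r}" for s
      by (rule integral_unique, rule fundamental_theorem_of_calculus) (use d2 diff P that t in auto)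
    have "((\<lambda>s. integral (cbox 0 t) (\<lambda>\<tau>. partial 2 f (P s \<tau>))) has_vector_derivative
       integral (cbox 0 t) (\<lambda>\<tau>. partial 1 (partial 2 f) (P 0 \<tau>))) (at 0 within {0..r})"
    proof (rule leibniz_rule_vector_derivative)
      show "((\<lambda>s. partial 2 f (P s \<tau>)) has_vector_derivative partial 1 (partial 2 f) (P s \<tau>)) (at s within {0..r})"
        if "s \<in> {0..r}" "\<tau> \<in> cbox 0 t" for s \<tau>
        using that t by (intro d1 diff(2) P) auto
      show "(\<lambda>\<tau>. partial 2 f (P s \<tau>)) integrable_on cbox 0 t" if "s \<in> {0..r}" for s
        using t that by (auto intro!: integrable_continuous_interval continuous_on_subset[OF cont'[OF c2]])
      show "continuous_on ({0..r} \<times> cbox 0 t) (\<lambda>(s, \<tau>). partial 1 (partial 2 f) (P s \<tau>))"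
        by (rule continuous_on_subset[OF cont[OF c12]]) (use t in auto)
    qed (use \<open>r > 0\<close> in auto)
    then have "((\<lambda>s. f (P s t) - f (P s 0)) has_vector_derivative
       integral {0..t} (\<lambda>\<tau>. partial 1 (partial 2 f) (P 0 \<tau>))) (at 0 within {0..r})"
      using int \<open>r > 0\<close> by (auto elim!: has_vector_derivative_transform[rotated 2])
    moreover have "((\<lambda>s. f (P s t) - f (P s 0)) has_vector_derivative
       partial 1 f (P 0 t) - partial 1 f (P 0 0)) (at 0 within {0..r})"
      using t \<open>r > 0\<close> by (intro has_vector_derivative_diff d1 diff(1) P) auto
    ultimately show ?thesis
      using \<open>r > 0\<close> by (intro vector_derivative_unique_within[of 0 "{0..r}"]) (auto simp: trivial_limit_within islimpt_Icc)
  qed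
  have "((\<lambda>t. integral {0..t} (\<lambda>\<tau>. partial 1 (partial 2 f) (P 0 \<tau>))) has_vector_derivative
      partial 1 (partial 2 f) (P 0 0)) (at 0 within {0..r})"
    using \<open>r > 0\<close> by (intro integral_has_vector_derivative cont' c12) auto
  then have "((\<lambda>t. partial 1 f (P 0 t) - partial 1 f (P 0 0)) has_vector_derivative
      partial 1 (partial 2 f) (P 0 0)) (at 0 within {0..r})"
    using eq \<open>r > 0\<close> by (auto elim!: has_vector_derivative_transform[rotated 2])
  moreover have "((\<lambda>t. partial 1 f (P 0 t) - partial 1 f (P 0 0)) has_vector_derivative
      partial 2 (partial 1 f) (P 0 0) - 0) (at 0 within {0..r})"
    using \<open>r > 0\<close> by (intro has_vector_derivative_diff d2 diff(2) P has_vector_derivative_const) auto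
  ultimately have "partial 1 (partial 2 f) (P 0 0) = partial 2 (partial 1 f) (P 0 0) - 0"
    using \<open>r > 0\<close> by (intro vector_derivative_unique_within[of 0 "{0..r}"]) (auto simp: trivial_limit_within islimpt_Icc)
  then show ?thesis by (simp add: P_def)
qed

section \<open>Integrals over circles\<close>

definition circ :: "real \<Rightarrow> real^2" where
  "circ t = vector [cos t, sin t]"

lemma circ_nth [simp]: "circ t $ 1 = cos t" "circ t $ 2 = sin t"
  by (simp_all add: circ_def)

lemma circ_eq: "circ t = cos t *\<^sub>R axis 1 1 + sin t *\<^sub>R axis 2 1"
  by (simp add: vec_eq_iff forall_2 axis_def)

lemma continuous_on_circ [continuous_intros]:
  fixes f :: "'a::t2_space \<Rightarrow> real"
  shows "continuous_on S f \<Longrightarrow> continuous_on S (\<lambda>x. circ (f x))"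
  unfolding circ_eq by (auto intro!: continuous_intros)

lemma norm_circ [simp]: "norm (circ t) = 1"
  by (simp add: norm_eq_sqrt_inner inner_vec_def sum_2 flip: power2_eq_square)

lemma circle_in_cball: "0 \<le> s \<Longrightarrow> s \<le> R \<Longrightarrow> x + s *\<^sub>R circ t \<in> cball x R"
  by (simp add: dist_norm)

lemma continuous_on_circle_integrand:
  fixes f :: "real^2 \<Rightarrow> complex" and w :: "real \<Rightarrow> complex"
  assumes "continuous_on S f" "continuous_on UNIV w" "\<And>x. x \<in> T \<Longrightarrow> cball x R \<subseteq> S" "0 \<le> R"
  shows "continuous_on (T \<times> A) (\<lambda>(x, t). w t * f (x + R *\<^sub>R circ t))"
proof -
  have "x + R *\<^sub>R circ t \<in> S" if "x \<in> T" for x t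
    using assms(3)[OF that] circle_in_cball[of R R x t] \<open>0 \<le> R\<close> by auto
  then show ?thesis
    unfolding split_beta
    by (intro continuous_intros continuous_on_compose2[OF assms(1)]
        continuous_on_compose2[OF assms(2)]) auto
qed

lemma circle_integrable:
  fixes f :: "real^2 \<Rightarrow> complex" and w :: "real \<Rightarrow> complex"
  assumes "continuous_on S f" "continuous_on UNIV w" "cball x R \<subseteq> S" "0 \<le> R"
  shows "(\<lambda>t. w t * f (x + R *\<^sub>R circ t)) integrable_on {a..b}"
proof -
  have "continuous_on {a..b} (\<lambda>t. w t * f (x + R *\<^sub>R circ t))"
    using circle_in_cball[of R R x] assms
    by (intro continuous_intros continuous_on_compose2[OF assms(1)]
        continuous_on_compose2[OF assms(2)]) auto
  then show ?thesis
    by (rule integrable_continuous_interval)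
qed

lemma circle_integral_has_derivative:
  fixes f :: "real^2 \<Rightarrow> complex" and w :: "real \<Rightarrow> complex"
  assumes "open T" "\<And>x. x \<in> T \<Longrightarrow> cball x R \<subseteq> S" "0 \<le> R"
    and w: "continuous_on UNIV w" and f: "Ck 1 f S" and "x \<in> T"
  shows "((\<lambda>x. integral {0..2*pi} (\<lambda>t. w t * f (x + R *\<^sub>R circ t))) has_derivative
     (\<lambda>h. integral {0..2*pi} (\<lambda>t. w t * frechet_derivative f (at (x + R *\<^sub>R circ t)) h))) (at x)"
proof -
  obtain \<delta> where \<delta>: "\<delta> > 0" "ball x \<delta> \<subseteq> T"
    using \<open>open T\<close> \<open>x \<in> T\<close> openE by blast
  \<comment> \<open>\<open>leibniz_rule\<close> takes the derivative as a continuous family of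
    bounded linear maps. \<open>Blinfun\<close> represents the given map only where it is bounded
    linear, which \<open>der\<close> supplies for \<open>y \<in> T\<close>.\<close>
  define fx where "fx y t = Blinfun (\<lambda>h. w t * frechet_derivative f (at (y + R *\<^sub>R circ t)) h)"
    for y t
  have inS: "y + R *\<^sub>R circ t \<in> S" if "y \<in> T" for y t
    using assms(2)[OF that] circle_in_cball[of R R y t] \<open>0 \<le> R\<close> by auto
  have der: "((\<lambda>y. w t * f (y + R *\<^sub>R circ t)) has_derivative
      (\<lambda>h. w t * frechet_derivative f (at (y + R *\<^sub>R circ t)) h)) (at y)" if "y \<in> T" for y t
  proof -
    have "(f has_derivative frechet_derivative f (at (y + R *\<^sub>R circ t))) (at (y + R *\<^sub>R circ t))"
      using f inS[OF that] by (intro has_derivative_frechet) simp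
    moreover have "((\<lambda>y. y + R *\<^sub>R circ t) has_derivative (\<lambda>h. h)) (at y)"
      by (auto intro!: derivative_eq_intros)
    ultimately have "((\<lambda>y. f (y + R *\<^sub>R circ t)) has_derivative
        (\<lambda>h. frechet_derivative f (at (y + R *\<^sub>R circ t)) h)) (at y)"
      by (auto dest: has_derivative_compose)
    then show ?thesis
      by (rule has_derivative_mult_right)
  qed
  have fx: "blinfun_apply (fx y t) = (\<lambda>h. w t * frechet_derivative f (at (y + R *\<^sub>R circ t)) h)"
    if "y \<in> T" for y t
    unfolding fx_def by (rule bounded_linear_Blinfun_apply[OF has_derivative_bounded_linear[OF der[OF that]]])
  have cont: "continuous_on (ball x \<delta> \<times> cbox 0 (2*pi)) (\<lambda>(y, t). fx y t)"
  proof (rule continuous_on_blinfun_componentwise)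
    fix i :: "real^2" assume "i \<in> Basis"
    then have "continuous_on S (\<lambda>z. frechet_derivative f (at z) i)"
      using f by simp
    then have "continuous_on (ball x \<delta> \<times> cbox 0 (2*pi))
        (\<lambda>(y, t). w t * frechet_derivative f (at (y + R *\<^sub>R circ t)) i)"
    proof (rule continuous_on_circle_integrand[OF _ w _ \<open>0 \<le> R\<close>])
      show "cball y R \<subseteq> S" if "y \<in> ball x \<delta>" for y
        using assms(2) \<delta> that by blast
    qed
    then show "continuous_on (ball x \<delta> \<times> cbox 0 (2*pi)) (\<lambda>p. blinfun_apply (case p of (y, t) \<Rightarrow> fx y t) i)"
      by (rule continuous_on_eq) (use \<delta> fx in auto)
  qed
  have "((\<lambda>x. integral (cbox 0 (2*pi)) (\<lambda>t. w t * f (x + R *\<^sub>R circ t))) has_derivative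
     integral (cbox 0 (2*pi)) (fx x)) (at x within ball x \<delta>)"
  proof (rule leibniz_rule[OF _ _ cont])
    show "((\<lambda>x. w t * f (x + R *\<^sub>R circ t)) has_derivative blinfun_apply (fx y t))
           (at y within ball x \<delta>)" if "y \<in> ball x \<delta>" for y t
    proof -
      have "y \<in> T" using that \<delta> by auto
      from has_derivative_at_withinI[OF der[OF this]] show ?thesis
        unfolding fx[OF \<open>y \<in> T\<close>] .
    qed
    show "(\<lambda>t. w t * f (y + R *\<^sub>R circ t)) integrable_on cbox 0 (2*pi)" if "y \<in> ball x \<delta>" for y
      unfolding cbox_interval
      using assms(2)[of y] \<delta> that by (intro circle_integrable[OF Ck_continuous_on[OF f] w _ \<open>0 \<le> R\<close>]) blast
  qed (use \<delta> in auto)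
  then have "((\<lambda>x. integral {0..2*pi} (\<lambda>t. w t * f (x + R *\<^sub>R circ t))) has_derivative
     integral {0..2*pi} (fx x)) (at x)"
    using \<delta>(1) by (simp add: at_within_open[of x "ball x \<delta>"])
  moreover have "blinfun_apply (integral {0..2*pi} (fx x)) =
      (\<lambda>h. integral {0..2*pi} (\<lambda>t. w t * frechet_derivative f (at (x + R *\<^sub>R circ t)) h))"
  proof
    fix h
    have "continuous_on (cbox 0 (2*pi)) (\<lambda>t. (x, t))"
      by (intro continuous_intros)
    moreover have "Pair x ` cbox 0 (2*pi) \<subseteq> ball x \<delta> \<times> cbox 0 (2*pi)"
      using \<delta>(1) by (intro image_subsetI) simp
    ultimately have "continuous_on (cbox 0 (2*pi)) (fx x)"
      using continuous_on_compose2[OF cont] by fastforce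
    then have "fx x integrable_on {0..2*pi}"
      by (simp add: integrable_continuous_interval)
    then show "blinfun_apply (integral {0..2*pi} (fx x)) h =
      integral {0..2*pi} (\<lambda>t. w t * frechet_derivative f (at (x + R *\<^sub>R circ t)) h)"
      by (simp add: blinfun_apply_integral fx[OF \<open>x \<in> T\<close>])
  qed
  ultimately show ?thesis by simp
qed

lemma circle_integral_partial:
  fixes f :: "real^2 \<Rightarrow> complex" and w :: "real \<Rightarrow> complex"
  assumes "open T" "\<And>x. x \<in> T \<Longrightarrow> cball x R \<subseteq> S" "0 \<le> R"
    and "continuous_on UNIV w" and "Ck 1 f S" and "x \<in> T"
  shows "partial j (\<lambda>x. integral {0..2*pi} (\<lambda>t. w t * f (x + R *\<^sub>R circ t))) x
       = integral {0..2*pi} (\<lambda>t. w t * partial j f (x + R *\<^sub>R circ t))"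
  using partial_eqI[OF circle_integral_has_derivative[OF assms], where j=j] by (simp add: partial_def)

text \<open>Averaging over circles of fixed radius is a convolution: each derivative passes to
  \<open>f\<close> and leaves an integral of the same form.\<close>

lemma Ck_circle_integral:
  fixes f :: "real^2 \<Rightarrow> complex" and w :: "real \<Rightarrow> complex"
  assumes "open T" "\<And>x. x \<in> T \<Longrightarrow> cball x R \<subseteq> S" "0 \<le> R"
    and "continuous_on UNIV w" and "Ck n f S"
  shows "Ck n (\<lambda>x. integral {0..2*pi} (\<lambda>t. w t * f (x + R *\<^sub>R circ t))) T"
  using assms(5)
proof (induction n arbitrary: f)
  case 0
  then have "continuous_on (T \<times> cbox 0 (2*pi)) (\<lambda>(x, t). w t * f (x + R *\<^sub>R circ t))"
    using assms by (intro continuous_on_circle_integrand) auto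
  from integral_continuous_on_param[OF this] show ?case by simp
next
  case (Suc n)
  have C1: "Ck 1 f S"
    using Suc.prems Ck_continuous_on by (auto intro: Ck_continuous_on[of n])
  show ?case
  proof (rule Ck_SucI)
    show "(\<lambda>x. integral {0..2*pi} (\<lambda>t. w t * f (x + R *\<^sub>R circ t))) differentiable at x"
      if "x \<in> T" for x
      using circle_integral_has_derivative[OF assms(1-4) C1 that] unfolding differentiable_def by blast
    show "Ck n (partial j (\<lambda>x. integral {0..2*pi} (\<lambda>t. w t * f (x + R *\<^sub>R circ t)))) T" for j
    proof (rule Ck_cong[OF \<open>open T\<close>])
      show "Ck n (\<lambda>x. integral {0..2*pi} (\<lambda>t. w t * partial j f (x + R *\<^sub>R circ t))) T"
        using Ck_SucD(2)[OF Suc.prems] by (rule Suc.IH)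
    qed (use circle_integral_partial[OF assms(1-4) C1] in simp)
  qed
qed

section \<open>Weighted circle integrals as functions of centre and radius\<close>

definition cint :: "(real \<Rightarrow> complex) \<Rightarrow> (real^2 \<Rightarrow> complex) \<Rightarrow> real^2 \<Rightarrow> real \<Rightarrow> complex" where
  "cint w f x s = integral {0..2*pi} (\<lambda>t. w t * f (x + s *\<^sub>R circ t))"

text \<open>The integration is in the angle, without arc length factor and without division by 2 pi:
  \<open>cint (\<lambda>_. 1) f x s\<close> is 2 pi times the mean of \<open>f\<close>, and
  \<open>of_real s * flux u1 u2 x s\<close> is the outward flux through the circle.\<close>

definition flux :: "(real^2 \<Rightarrow> complex) \<Rightarrow> (real^2 \<Rightarrow> complex) \<Rightarrow> real^2 \<Rightarrow> real \<Rightarrow> complex" where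
  "flux u1 u2 x s = cint (\<lambda>t. of_real (cos t)) u1 x s + cint (\<lambda>t. of_real (sin t)) u2 x s"

lemma cint_radial_derivative:
  assumes "Ck 1 f S" "continuous_on UNIV w" "cball x R \<subseteq> S" "s \<in> {0..R}"
  shows "(cint w f x has_vector_derivative
      integral {0..2*pi} (\<lambda>t. w t * (cos t *\<^sub>R partial 1 f (x + s *\<^sub>R circ t)
        + sin t *\<^sub>R partial 2 f (x + s *\<^sub>R circ t)))) (at s within {0..R})"
proof -
  have C1: "Ck (Suc 0) f S" using assms(1) by simp
  have inS: "x + s *\<^sub>R circ t \<in> S" if "s \<in> {0..R}" for s t
    using assms(3) circle_in_cball[of s R x t] that by auto
  have cont: "continuous_on ({0..R} \<times> A) (\<lambda>p. g (x + fst p *\<^sub>R circ (snd p)))"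
    if "continuous_on S g" for g :: "real^2 \<Rightarrow> complex" and A
    using inS by (intro continuous_on_compose2[OF that] continuous_intros) auto
  have "((\<lambda>s. integral (cbox 0 (2*pi)) (\<lambda>t. w t * f (x + s *\<^sub>R circ t))) has_vector_derivative
      integral (cbox 0 (2*pi)) (\<lambda>t. w t * (cos t *\<^sub>R partial 1 f (x + s *\<^sub>R circ t)
        + sin t *\<^sub>R partial 2 f (x + s *\<^sub>R circ t)))) (at s within {0..R})"
  proof (rule leibniz_rule_vector_derivative)
    show "((\<lambda>s. w t * f (x + s *\<^sub>R circ t)) has_vector_derivative
      w t * (cos t *\<^sub>R partial 1 f (x + s *\<^sub>R circ t) + sin t *\<^sub>R partial 2 f (x + s *\<^sub>R circ t)))
      (at s within {0..R})" if "s \<in> {0..R}" for s t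
    proof -
      have "((\<lambda>s. x + s *\<^sub>R circ t) has_vector_derivative circ t) (at s within {0..R})"
        by (auto intro!: derivative_eq_intros)
      from has_vector_derivative_along[OF Ck_SucD(1)[OF C1 inS[OF that]] this]
      show ?thesis
        by (intro has_vector_derivative_mult_right) simp
    qed
    show "(\<lambda>t. w t * f (x + s *\<^sub>R circ t)) integrable_on cbox 0 (2*pi)" if "s \<in> {0..R}" for s
      unfolding cbox_interval
    proof (rule circle_integrable[OF Ck_continuous_on[OF assms(1)] assms(2)])
      show "cball x s \<subseteq> S" "0 \<le> s" using assms(3) that by auto
    qed
    show "continuous_on ({0..R} \<times> cbox 0 (2*pi)) (\<lambda>(s, t). w t * (cos t *\<^sub>R partial 1 f (x + s *\<^sub>R circ t)
        + sin t *\<^sub>R partial 2 f (x + s *\<^sub>R circ t)))"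
      unfolding split_beta
      by (intro continuous_intros cont continuous_on_compose2[OF assms(2)]
          Ck_continuous_on[OF Ck_SucD(2)[OF C1]]) auto
  qed (use assms in auto)
  then show ?thesis
    unfolding cint_def[abs_def] by simp
qed

text \<open>Integration by parts along the circle: the integrand is the \<open>t\<close>-derivative of
  \<open>w t * f (x + s *\<^sub>R circ t)\<close>.\<close>

lemma cint_tangential:
  assumes "Ck 1 f S" "cball x s \<subseteq> S" "0 \<le> s"
    and w: "\<And>t. (w has_vector_derivative w' t) (at t)" "w (2 * pi) = w 0"
  shows "((\<lambda>t. w' t * f (x + s *\<^sub>R circ t) + w t * (of_real s * (cos t *\<^sub>R partial 2 f (x + s *\<^sub>R circ t)
    - sin t *\<^sub>R partial 1 f (x + s *\<^sub>R circ t)))) has_integral 0) {0..2*pi}"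
proof -
  have C1: "Ck (Suc 0) f S" using assms(1) by simp
  have inS: "x + s *\<^sub>R circ t \<in> S" for t
    using assms(2,3) circle_in_cball[of s s x t] by auto
  have circ': "((\<lambda>t. x + s *\<^sub>R circ t) has_vector_derivative s *\<^sub>R vector [- sin t, cos t]) (at t within A)" for t A
  proof -
    have "((\<lambda>t. x + s *\<^sub>R circ t) has_vector_derivative
        s *\<^sub>R ((- sin t) *\<^sub>R axis 1 1 + cos t *\<^sub>R axis 2 1)) (at t within A)"
      unfolding circ_eq
      by (auto intro!: derivative_eq_intros simp: algebra_simps)
    moreover have "(- sin t) *\<^sub>R axis 1 1 + cos t *\<^sub>R axis 2 1 = (vector [- sin t, cos t] :: real^2)"
      by (simp add: vec_eq_iff forall_2 axis_def)
    ultimately show ?thesis by simp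
  qed
  have "((\<lambda>t. w t * f (x + s *\<^sub>R circ t)) has_vector_derivative
      (w' t * f (x + s *\<^sub>R circ t) + w t * (of_real s * (cos t *\<^sub>R partial 2 f (x + s *\<^sub>R circ t)
    - sin t *\<^sub>R partial 1 f (x + s *\<^sub>R circ t))))) (at t within {0..2*pi})" for t
  proof -
    have "((\<lambda>t. w t * f (x + s *\<^sub>R circ t)) has_vector_derivative
      w t * ((s *\<^sub>R vector [- sin t, cos t] :: real^2) $ 1 *\<^sub>R partial 1 f (x + s *\<^sub>R circ t)
         + (s *\<^sub>R vector [- sin t, cos t] :: real^2) $ 2 *\<^sub>R partial 2 f (x + s *\<^sub>R circ t))
      + w' t * f (x + s *\<^sub>R circ t)) (at t within {0..2*pi})"
      by (rule has_vector_derivative_mult[OF has_vector_derivative_at_within[OF w(1)]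
          has_vector_derivative_along[OF Ck_SucD(1)[OF C1 inS] circ']])
    then show ?thesis
      by (rule has_vector_derivative_eq_rhs) (simp add: scaleR_conv_of_real[where 'a=complex] algebra_simps)
  qed
  then have "((\<lambda>t. w' t * f (x + s *\<^sub>R circ t) + w t * (of_real s * (cos t *\<^sub>R partial 2 f (x + s *\<^sub>R circ t)
    - sin t *\<^sub>R partial 1 f (x + s *\<^sub>R circ t)))) has_integral
     (w (2*pi) * f (x + s *\<^sub>R circ (2*pi)) - w 0 * f (x + s *\<^sub>R circ 0))) {0..2*pi}"
    by (intro fundamental_theorem_of_calculus) auto
  moreover have "circ (2*pi) = circ 0" by (simp add: circ_def)
  ultimately show ?thesis using w(2) by simp
qed

lemma cint_cmult: "cint w (\<lambda>y. c * f y) x s = c * cint w f x s"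
  unfolding cint_def by (simp add: mult.left_commute[of _ c])

lemma cint_differentiable:
  assumes "open T" "\<And>x. x \<in> T \<Longrightarrow> cball x R \<subseteq> S" "0 \<le> R" "continuous_on UNIV w" "Ck 1 f S" "x \<in> T"
  shows "(\<lambda>x. cint w f x R) differentiable (at x)"
  unfolding cint_def differentiable_def
  by (intro exI, rule circle_integral_has_derivative[OF assms])

lemma cint_partial:
  assumes "open T" "\<And>x. x \<in> T \<Longrightarrow> cball x R \<subseteq> S" "0 \<le> R" "continuous_on UNIV w" "Ck 1 f S" "x \<in> T"
  shows "partial j (\<lambda>x. cint w f x R) x = cint w (partial j f) x R"
  unfolding cint_def by (rule circle_integral_partial[OF assms])

lemma cint_lincomb:
  fixes f1 f2 f3 :: "real^2 \<Rightarrow> complex"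
  assumes "continuous_on S f1" "continuous_on S f2" "continuous_on S f3"
    and "continuous_on UNIV w" "cball x R \<subseteq> S" "0 \<le> R"
  shows "cint w (\<lambda>y. a1 * f1 y + a2 * f2 y - a3 * f3 y) x R
    = a1 * cint w f1 x R + a2 * cint w f2 x R - a3 * cint w f3 x R"
proof -
  have i: "((\<lambda>t. w t * f (x + R *\<^sub>R circ t)) has_integral cint w f x R) {0..2*pi}"
    if "continuous_on S f" for f
    unfolding cint_def by (intro integrable_integral circle_integrable[OF that assms(4-)])
  have "((\<lambda>t. a1 * (w t * f1 (x + R *\<^sub>R circ t)) + a2 * (w t * f2 (x + R *\<^sub>R circ t))
      - a3 * (w t * f3 (x + R *\<^sub>R circ t))) has_integral
      a1 * cint w f1 x R + a2 * cint w f2 x R - a3 * cint w f3 x R) {0..2*pi}"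
    by (intro has_integral_add has_integral_diff has_integral_mult_right i assms)
  moreover have "(\<lambda>t. w t * (a1 * f1 (x + R *\<^sub>R circ t) + a2 * f2 (x + R *\<^sub>R circ t) - a3 * f3 (x + R *\<^sub>R circ t)))
     = (\<lambda>t. a1 * (w t * f1 (x + R *\<^sub>R circ t)) + a2 * (w t * f2 (x + R *\<^sub>R circ t))
      - a3 * (w t * f3 (x + R *\<^sub>R circ t)))"
    by (simp add: algebra_simps fun_eq_iff)
  ultimately show ?thesis
    unfolding cint_def by (simp add: integral_unique)
qed

lemma cint_bound:
  assumes "\<And>t. norm (w t) \<le> 1" "\<And>t. norm (f (x + s *\<^sub>R circ t)) \<le> B"
  shows "norm (cint w f x s) \<le> 2 * pi * B"
proof -
  have B: "0 \<le> B" using assms(2) norm_ge_zero order_trans by blast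
  have le: "norm (w t * f (x + s *\<^sub>R circ t)) \<le> B" for t
    using mult_mono[OF assms(1) assms(2), of t t] by (simp add: norm_mult)
  show ?thesis
  proof (cases "(\<lambda>t. w t * f (x + s *\<^sub>R circ t)) integrable_on {0..2*pi}")
    case True
    then have "((\<lambda>t. w t * f (x + s *\<^sub>R circ t)) has_integral cint w f x s) (cbox 0 (2*pi))"
      unfolding cint_def by (simp add: integrable_integral)
    from has_integral_bound[OF B this] le show ?thesis by (simp add: mult_ac)
  next
    \<comment> \<open>Here \<open>cint\<close> is 0, the default value of
      \<open>integral\<close>.\<close>
    case False
    then show ?thesis using B by (simp add: cint_def not_integrable_integral)
  qed
qed

text \<open>The two circles have different centres because the plane wave that approximates
  \<open>f\<close> near \<open>x\<close> is written in the offset from \<open>x\<close>.\<close>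

lemma cint_diff_bound:
  assumes "(\<lambda>t. w t * f (x + R *\<^sub>R circ t)) integrable_on {0..2*pi}"
    and "(\<lambda>t. w t * g (0 + R *\<^sub>R circ t)) integrable_on {0..2*pi}"
    and "\<And>t. norm (w t) \<le> 1" "\<And>t. norm (f (x + R *\<^sub>R circ t) - g (R *\<^sub>R circ t)) \<le> B"
  shows "norm (cint w f x R - cint w g 0 R) \<le> 2 * pi * B"
proof -
  have B: "0 \<le> B" using assms(4) norm_ge_zero order_trans by blast
  have "((\<lambda>t. w t * f (x + R *\<^sub>R circ t) - w t * g (0 + R *\<^sub>R circ t)) has_integral cint w f x R - cint w g 0 R) {0..2*pi}"
    unfolding cint_def by (intro has_integral_diff integrable_integral assms)
  then have int: "((\<lambda>t. w t * (f (x + R *\<^sub>R circ t) - g (R *\<^sub>R circ t))) has_integral cint w f x R - cint w g 0 R) (cbox 0 (2*pi))"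
    by (simp add: right_diff_distrib)
  have le: "norm (w t * (f (x + R *\<^sub>R circ t) - g (R *\<^sub>R circ t))) \<le> B" for t
    using mult_mono[OF assms(3) assms(4), of t t] by (simp add: norm_mult)
  from has_integral_bound[OF B int] le show ?thesis by (simp add: mult_ac)
qed

section \<open>The flux identity\<close>

text \<open>The field is \<open>grad \<phi> + grad_perp \<psi>\<close>; for C^2 potentials the
  divergence condition is the Helmholtz equation for \<open>\<phi>\<close>. This first-order form
  makes sense for C^1 potentials, the class in which those of the Navier equation first arise, and
  it leaves the wave number of \<open>\<psi>\<close> open.\<close>

definition flux_field ::
  "real \<Rightarrow> (real^2) set \<Rightarrow> (real^2 \<Rightarrow> complex) \<Rightarrow> (real^2 \<Rightarrow> complex) \<Rightarrow>
   (real^2 \<Rightarrow> complex) \<Rightarrow> (real^2 \<Rightarrow> complex) \<Rightarrow> bool" where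
  "flux_field k S u1 u2 \<phi> \<psi> \<longleftrightarrow> Ck 1 u1 S \<and> Ck 1 u2 S \<and> Ck 1 \<phi> S \<and> Ck 1 \<psi> S \<and>
     (\<forall>x\<in>S. u1 x = partial 1 \<phi> x - partial 2 \<psi> x \<and> u2 x = partial 2 \<phi> x + partial 1 \<psi> x \<and>
        partial 1 u1 x + partial 2 u2 x = - (of_real k)\<^sup>2 * \<phi> x)"

text \<open>Up to sign and the factor \<open>s\<close>, the outward component of
  \<open>grad_perp \<psi>\<close> is the derivative of \<open>\<psi>\<close> along the circle and
  integrates to zero, so the flux sees only \<open>grad \<phi>\<close>. The tangential identity
  carries the factor \<open>s\<close>, which therefore stays on both sides; at \<open>s = 0\<close>
  the second claim reads 0 = 0.\<close>

lemma circle_mean_derivative: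
  assumes ff: "flux_field k S u1 u2 \<phi> \<psi>" and "cball x R \<subseteq> S" "s \<in> {0..R}"
  obtains m where "(cint (\<lambda>_. 1) \<phi> x has_vector_derivative m) (at s within {0..R})"
    "of_real s * m = of_real s * flux u1 u2 x s"
proof
  have sub: "cball x s \<subseteq> S" "0 \<le> s" using assms(2,3) by auto
  have inS: "x + s *\<^sub>R circ t \<in> S" for t
    using circle_in_cball[of s s x t] sub by auto
  let ?y = "\<lambda>t. x + s *\<^sub>R circ t"
  let ?m = "\<lambda>t. 1 * (cos t *\<^sub>R partial 1 \<phi> (?y t) + sin t *\<^sub>R partial 2 \<phi> (?y t))"
  have C1: "Ck 1 u1 S" "Ck 1 u2 S" "Ck 1 \<phi> S" "Ck 1 \<psi> S"
    and eq: "\<And>t. u1 (?y t) = partial 1 \<phi> (?y t) - partial 2 \<psi> (?y t)"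
      "\<And>t. u2 (?y t) = partial 2 \<phi> (?y t) + partial 1 \<psi> (?y t)"
    using ff inS unfolding flux_field_def by auto
  show "(cint (\<lambda>_. 1) \<phi> x has_vector_derivative integral {0..2*pi} ?m) (at s within {0..R})"
    by (rule cint_radial_derivative[OF C1(3) _ assms(2,3)]) simp
  have "((\<lambda>t. of_real (cos t) * u1 (?y t)) has_integral cint (\<lambda>t. of_real (cos t)) u1 x s) {0..2*pi}"
    "((\<lambda>t. of_real (sin t) * u2 (?y t)) has_integral cint (\<lambda>t. of_real (sin t)) u2 x s) {0..2*pi}"
    unfolding cint_def
    by (intro integrable_integral circle_integrable[OF _ _ sub] Ck_continuous_on[OF C1(1)]
        Ck_continuous_on[OF C1(2)] continuous_intros)+
  from has_integral_add[OF this]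
  have "((\<lambda>t. of_real s * (of_real (cos t) * u1 (?y t) + of_real (sin t) * u2 (?y t)))
      has_integral of_real s * flux u1 u2 x s) {0..2*pi}"
    unfolding flux_def by (rule has_integral_mult_right)
  from has_integral_add[OF this cint_tangential[OF C1(4) sub, where w = "\<lambda>_. 1" and w' = "\<lambda>_. 0"]]
  have "((\<lambda>t. of_real s * ?m t) has_integral of_real s * flux u1 u2 x s) {0..2*pi}"
    unfolding eq by (simp add: scaleR_conv_of_real[where 'a=complex] algebra_simps)
  moreover have "((\<lambda>t. of_real s * ?m t) has_integral of_real s * integral {0..2*pi} ?m) {0..2*pi}"
  proof (intro has_integral_mult_right integrable_integral integrable_continuous_interval)
    have "continuous_on {0..2*pi} (\<lambda>t. g (?y t))" if "continuous_on S g" for g :: "real^2 \<Rightarrow> complex"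
      using inS by (intro continuous_on_compose2[OF that] continuous_intros) auto
    moreover have "continuous_on S (partial j \<phi>)" for j
      using C1(3) Ck_SucD(2)[of 0] by simp
    ultimately show "continuous_on {0..2*pi} ?m"
      by (intro continuous_intros) auto
  qed
  ultimately show "of_real s * integral {0..2*pi} ?m = of_real s * flux u1 u2 x s"
    using has_integral_unique by blast
qed

text \<open>The divergence theorem in differential form: the outward flux grows at the rate
  \<open>s\<close> times the angular integral of the divergence over the circle.\<close>

lemma flux_derivative:
  assumes ff: "flux_field k S u1 u2 \<phi> \<psi>" and "cball x R \<subseteq> S" "s \<in> {0..R}"
  shows "((\<lambda>s. of_real s * flux u1 u2 x s) has_vector_derivative
     - (of_real k)\<^sup>2 * (of_real s * cint (\<lambda>_. 1) \<phi> x s)) (at s within {0..R})"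
proof -
  have sub: "cball x s \<subseteq> S" "0 \<le> s" using assms(2,3) by auto
  have inS: "x + s *\<^sub>R circ t \<in> S" for t
    using circle_in_cball[of s s x t] sub by auto
  let ?y = "\<lambda>t. x + s *\<^sub>R circ t"
  let ?c = "\<lambda>t. complex_of_real (cos t)" and ?s = "\<lambda>t. complex_of_real (sin t)"
  have C1: "Ck 1 u1 S" "Ck 1 u2 S" "Ck 1 \<phi> S"
    and dv: "\<And>t. partial 1 u1 (?y t) = - (of_real k)\<^sup>2 * \<phi> (?y t) - partial 2 u2 (?y t)"
    using ff inS unfolding flux_field_def by (auto simp: eq_diff_eq)
  have cs: "continuous_on UNIV ?c" "continuous_on UNIV ?s"
    by (intro continuous_intros)+
  let ?m1 = "\<lambda>t. ?c t * (cos t *\<^sub>R partial 1 u1 (?y t) + sin t *\<^sub>R partial 2 u1 (?y t))"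
  let ?m2 = "\<lambda>t. ?s t * (cos t *\<^sub>R partial 1 u2 (?y t) + sin t *\<^sub>R partial 2 u2 (?y t))"
  have cy: "continuous_on {0..2*pi} (\<lambda>t. g (?y t))" if "continuous_on S g" for g :: "real^2 \<Rightarrow> complex"
    using inS by (intro continuous_on_compose2[OF that] continuous_intros) auto
  have cp: "continuous_on S (partial j u1)" "continuous_on S (partial j u2)" for j
    using C1 Ck_SucD(2)[of 0] by simp_all
  have m: "(?m1 has_integral integral {0..2*pi} ?m1) {0..2*pi}"
    "(?m2 has_integral integral {0..2*pi} ?m2) {0..2*pi}"
    by (intro integrable_integral integrable_continuous_interval continuous_intros cy cp)+
  have fl: "((\<lambda>t. ?c t * u1 (?y t)) has_integral cint ?c u1 x s) {0..2*pi}"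
    "((\<lambda>t. ?s t * u2 (?y t)) has_integral cint ?s u2 x s) {0..2*pi}"
    unfolding cint_def
    by (intro integrable_integral circle_integrable[OF _ _ sub] Ck_continuous_on[OF C1(1)]
        Ck_continuous_on[OF C1(2)] cs)+
  have t1: "((\<lambda>t. ?c t * u1 (?y t) + ?s t * (of_real s * (cos t *\<^sub>R partial 2 u1 (?y t)
    - sin t *\<^sub>R partial 1 u1 (?y t)))) has_integral 0) {0..2*pi}"
    by (rule cint_tangential[OF C1(1) sub]) (auto intro!: derivative_eq_intros has_vector_derivative_of_real)
  have t2: "((\<lambda>t. - ?s t * u2 (?y t) + ?c t * (of_real s * (cos t *\<^sub>R partial 2 u2 (?y t)
    - sin t *\<^sub>R partial 1 u2 (?y t)))) has_integral 0) {0..2*pi}"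
    by (rule cint_tangential[OF C1(2) sub]) (auto intro!: derivative_eq_intros has_vector_derivative_of_real)
  have sc: "?s t * (?s t * z) = z - ?c t * (?c t * z)" for t z
  proof -
    have "?s t * ?s t = 1 - ?c t * ?c t"
      by (metis (no_types) of_real_1 of_real_diff of_real_mult power2_eq_square sin_squared_eq)
    then have "?s t * ?s t * z = (1 - ?c t * ?c t) * z"
      by (rule arg_cong)
    then show ?thesis by (simp only: mult.assoc left_diff_distrib mult_1_left)
  qed
  \<comment> \<open>Divergence in polar coordinates: the combination of \<open>t1\<close> and
    \<open>t2\<close> adds the \<open>t\<close>-derivative of the tangential component
    \<open>cos t * u2 - sin t * u1\<close>, whose integral is 0. With it the integrand collapses to
    \<open>s\<close> times the divergence.\<close>
  have "((\<lambda>t. of_real s * (?m1 t + ?m2 t) + (?c t * u1 (?y t) + ?s t * u2 (?y t))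
     - (?c t * u1 (?y t) + ?s t * (of_real s * (cos t *\<^sub>R partial 2 u1 (?y t)
    - sin t *\<^sub>R partial 1 u1 (?y t)))) + (- ?s t * u2 (?y t) + ?c t * (of_real s * (cos t *\<^sub>R partial 2 u2 (?y t)
    - sin t *\<^sub>R partial 1 u2 (?y t))))) has_integral
     of_real s * (integral {0..2*pi} ?m1 + integral {0..2*pi} ?m2) + (cint ?c u1 x s + cint ?s u2 x s) - 0 + 0) {0..2*pi}"
    by (intro has_integral_add has_integral_diff has_integral_mult_right m fl t1 t2)
  then have "((\<lambda>t. (- (of_real k)\<^sup>2 * of_real s) * (1 * \<phi> (?y t))) has_integral
     of_real s * (integral {0..2*pi} ?m1 + integral {0..2*pi} ?m2) + flux u1 u2 x s) {0..2*pi}"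
    unfolding flux_def dv by (simp add: scaleR_conv_of_real[where 'a=complex] algebra_simps sc)
  moreover have "((\<lambda>t. (- (of_real k)\<^sup>2 * of_real s) * (1 * \<phi> (?y t))) has_integral
     (- (of_real k)\<^sup>2 * of_real s) * cint (\<lambda>_. 1) \<phi> x s) {0..2*pi}"
    unfolding cint_def
    by (intro has_integral_mult_right integrable_integral circle_integrable[OF _ _ sub]
        Ck_continuous_on[OF C1(3)] continuous_intros)
  ultimately have e: "of_real s * (integral {0..2*pi} ?m1 + integral {0..2*pi} ?m2) + flux u1 u2 x s
      = (- (of_real k)\<^sup>2 * of_real s) * cint (\<lambda>_. 1) \<phi> x s"
    using has_integral_unique by blast
  have "((\<lambda>s. of_real s * flux u1 u2 x s) has_vector_derivative
     of_real s * (integral {0..2*pi} ?m1 + integral {0..2*pi} ?m2) + of_real 1 * flux u1 u2 x s) (at s within {0..R})"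
    unfolding flux_def
    by (intro has_vector_derivative_mult has_vector_derivative_add
       cint_radial_derivative[OF C1(1) cs(1) assms(2,3)] cint_radial_derivative[OF C1(2) cs(2) assms(2,3)]
       has_vector_derivative_of_real DERIV_ident)
  then show ?thesis
    by (rule has_vector_derivative_eq_rhs) (use e in \<open>simp add: algebra_simps\<close>)
qed

text \<open>If \<open>B\<close> is the maximum of \<open>|M|\<close>, integrating twice gives \<open>B \<le> B (k R)\<^sup>2 / 4\<close>.\<close>

lemma volterra_unique:
  fixes M G m :: "real \<Rightarrow> complex"
  assumes "0 < k" "k * R < 2" "0 \<le> R"
    and M: "\<And>s. s \<in> {0..R} \<Longrightarrow> (M has_vector_derivative m s) (at s within {0..R})"
    and G: "\<And>s. s \<in> {0..R} \<Longrightarrow> (G has_vector_derivative - (of_real k)\<^sup>2 * (of_real s * M s)) (at s within {0..R})"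
    and mG: "\<And>s. s \<in> {0..R} \<Longrightarrow> of_real s * m s = G s"
    and "M 0 = 0"
  shows "G R = 0"
proof -
  have contM: "continuous_on {0..R} M" and contG: "continuous_on {0..R} G"
    using M G has_vector_derivative_continuous unfolding continuous_on_eq_continuous_within by blast+
  have "G 0 = 0" using mG[of 0] \<open>0 \<le> R\<close> by simp
  obtain s0 where s0: "s0 \<in> {0..R}" "\<And>s. s \<in> {0..R} \<Longrightarrow> norm (M s) \<le> norm (M s0)"
  proof -
    have "\<exists>s0\<in>{0..R}. \<forall>s\<in>{0..R}. norm (M s) \<le> norm (M s0)"
      using \<open>0 \<le> R\<close> by (intro continuous_attains_sup continuous_on_norm contM) auto
    then show thesis using that by blast
  qed
  define B where "B = norm (M s0)"
  have Gb: "norm (G s) \<le> k\<^sup>2 * B * s\<^sup>2 / 2" if s: "s \<in> {0..R}" for s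
  proof (cases "s = 0")
    case False
    have "norm (G s - G 0) \<le> k\<^sup>2 * B * s\<^sup>2 / 2 - k\<^sup>2 * B * 0\<^sup>2 / 2"
    proof (rule differentiable_bound_general[where \<phi>' = "\<lambda>s. k\<^sup>2 * B * s"])
      show "0 < s" using s False by simp
      show "continuous_on {0..s} G" by (rule continuous_on_subset[OF contG]) (use s in auto)
      show "continuous_on {0..s} (\<lambda>s. k\<^sup>2 * B * s\<^sup>2 / 2)" by (intro continuous_intros) auto
      fix t assume t: "0 < t" "t < s"
      show "(G has_vector_derivative - (of_real k)\<^sup>2 * (of_real t * M t)) (at t)"
        using G[of t] t s by (simp add: at_within_Icc_at)
      show "((\<lambda>s. k\<^sup>2 * B * s\<^sup>2 / 2) has_vector_derivative k\<^sup>2 * B * t) (at t)"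
        by (auto intro!: derivative_eq_intros simp flip: has_real_derivative_iff_has_vector_derivative)
      have "norm (M t) \<le> B" unfolding B_def using s0(2)[of t] t s by auto
      then have "k\<^sup>2 * (t * norm (M t)) \<le> k\<^sup>2 * (t * B)"
        using t by (intro mult_left_mono) auto
      then show "norm (- (of_real k)\<^sup>2 * (of_real t * M t)) \<le> k\<^sup>2 * B * t"
        using t by (simp add: norm_mult norm_power mult_ac)
    qed
    then show ?thesis using \<open>G 0 = 0\<close> by simp
  qed (use \<open>G 0 = 0\<close> in simp)
  have "B \<le> k\<^sup>2 * B * s0\<^sup>2 / 4"
  proof (cases "s0 = 0")
    case False
    have "norm (M s0 - M 0) \<le> k\<^sup>2 * B * s0\<^sup>2 / 4 - k\<^sup>2 * B * 0\<^sup>2 / 4"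
    proof (rule differentiable_bound_general[where \<phi>' = "\<lambda>s. k\<^sup>2 * B * s / 2"])
      show "0 < s0" using s0 False by simp
      show "continuous_on {0..s0} M" by (rule continuous_on_subset[OF contM]) (use s0 in auto)
      show "continuous_on {0..s0} (\<lambda>s. k\<^sup>2 * B * s\<^sup>2 / 4)" by (intro continuous_intros) auto
      fix t assume t: "0 < t" "t < s0"
      show "(M has_vector_derivative m t) (at t)"
        using M[of t] t s0 by (simp add: at_within_Icc_at)
      show "((\<lambda>s. k\<^sup>2 * B * s\<^sup>2 / 4) has_vector_derivative k\<^sup>2 * B * t / 2) (at t)"
        by (auto intro!: derivative_eq_intros simp flip: has_real_derivative_iff_has_vector_derivative)
      \<comment> \<open>Only the product \<open>t * m t\<close> is controlled, so \<open>m\<close>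
        is bounded after division by \<open>t > 0\<close>. Bounds in the open interval suffice here,
        since \<open>M\<close> is continuous up to 0.\<close>
      have "t * norm (m t) = norm (G t)"
        using mG[of t] t s0 by (auto simp: norm_mult simp flip: mG)
      also have "\<dots> \<le> t * (k\<^sup>2 * B * t / 2)"
        using Gb[of t] t s0 by (simp add: power2_eq_square mult_ac)
      finally show "norm (m t) \<le> k\<^sup>2 * B * t / 2"
        using t by simp
    qed
    then show ?thesis using \<open>M 0 = 0\<close> by (simp add: B_def)
  qed (use \<open>M 0 = 0\<close> B_def in simp)
  also have "\<dots> = B * ((k * s0)\<^sup>2 / 4)" by (simp add: power_mult_distrib)
  finally have le: "B \<le> B * ((k * s0)\<^sup>2 / 4)" .
  have "k * s0 \<le> k * R" using s0 \<open>0 < k\<close> by (intro mult_left_mono) auto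
  then have "(k * s0)\<^sup>2 < 2\<^sup>2"
    using s0(1) \<open>0 < k\<close> \<open>k * R < 2\<close> by (intro power_strict_mono) (linarith, auto)
  then have "B = 0"
    using le mult_strict_left_mono[of "(k * s0)\<^sup>2 / 4" 1 B] by (cases "B > 0") (auto simp: B_def)
  then show ?thesis using Gb[of R] \<open>0 \<le> R\<close> by simp
qed

section \<open>Plane waves and the constant in the flux identity\<close>

definition plane_wave :: "real \<Rightarrow> real^2 \<Rightarrow> real^2 \<Rightarrow> complex" where
  "plane_wave k d y = exp (\<i> * of_real (k * (d \<bullet> y)))"

lemma plane_wave_has_derivative:
  "((\<lambda>y. c * plane_wave k d y) has_derivative (\<lambda>h. (c * (\<i> * of_real (k * (d \<bullet> h)))) * plane_wave k d y)) (at y)"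
proof -
  have "((\<lambda>y. \<i> * of_real (k * (d \<bullet> y))) has_derivative (\<lambda>h. \<i> * of_real (k * (d \<bullet> h)))) (at y)"
    by (auto intro!: derivative_eq_intros)
  from has_derivative_compose[OF this DERIV_exp[unfolded has_field_derivative_def]]
  show ?thesis
    unfolding plane_wave_def
    by (auto dest: has_derivative_mult_right[where x = c] simp: mult_ac)
qed

lemma partial_plane_wave:
  "partial j (\<lambda>y. c * plane_wave k d y) = (\<lambda>y. (c * (\<i> * of_real (k * d $ j))) * plane_wave k d y)"
  using partial_eqI[OF plane_wave_has_derivative] by (auto simp: fun_eq_iff inner_axis)

lemma Ck_plane_wave: "Ck n (\<lambda>y. c * plane_wave k d y) UNIV"
proof (induction n arbitrary: c)
  case 0
  then show ?case
    unfolding plane_wave_def by (auto intro!: continuous_intros)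
next
  case (Suc n)
  show ?case
  proof (rule Ck_SucI)
    show "(\<lambda>y. c * plane_wave k d y) differentiable at x" for x
      unfolding differentiable_def by (intro exI, rule plane_wave_has_derivative)
  qed (simp only: partial_plane_wave Suc)
qed

text \<open>In closed form this is - 2 pi k J_1(k R) with the Bessel function J_1. It is the flux
  belonging to the potential \<open>plane_wave k (axis 1 1)\<close>, whose gradient has only a first
  component and whose value at the centre 0 is 1.\<close>

definition flux_const :: "real \<Rightarrow> real \<Rightarrow> complex" where
  "flux_const k R = cint (\<lambda>t. of_real (cos t)) (\<lambda>y. \<i> * of_real k * plane_wave k (axis 1 1) y) 0 R"

lemma flux_eq:
  assumes ff: "flux_field k S u1 u2 \<phi> \<psi>" and "cball x R \<subseteq> S" "0 < k" "0 < R" "k * R < 2"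
  shows "flux u1 u2 x R = \<phi> x * flux_const k R"
proof -
  define v where "v y = \<i> * of_real k * plane_wave k (axis 1 1) y" for y
  let ?w = "plane_wave k (axis 1 1)" and ?z = "\<lambda>_::real^2. 0::complex"
  have w: "plane_wave k d = (\<lambda>y. 1 * plane_wave k d y)" for d
    by simp
  have ii: "\<i> * of_real k * (\<i> * of_real k) = - (complex_of_real k)\<^sup>2"
    by (simp add: power2_eq_square complex_eq_iff)
  have pw: "flux_field k UNIV v ?z ?w ?z"
    unfolding flux_field_def v_def[abs_def]
  proof (intro conjI ballI)
    show "Ck 1 (\<lambda>y. \<i> * of_real k * ?w y) UNIV"
      by (rule Ck_plane_wave)
    show "Ck 1 ?w UNIV"
      by (subst w) (rule Ck_plane_wave)
  qed (simp_all only: partial_zero Ck_zero, simp_all add: partial_plane_wave partial_plane_wave[where c=1, simplified]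
     axis_def ii)
  have fz: "flux v ?z 0 s = cint (\<lambda>t. of_real (cos t)) v 0 s" for s
    by (simp add: flux_def cint_def)
  have "\<exists>m. (cint (\<lambda>_. 1) \<phi> x has_vector_derivative m) (at s within {0..R}) \<and>
    of_real s * m = of_real s * flux u1 u2 x s" if "s \<in> {0..R}" for s
    using circle_mean_derivative[OF ff assms(2) that] by blast
  then obtain m1 where m1: "\<And>s. s \<in> {0..R} \<Longrightarrow> (cint (\<lambda>_. 1) \<phi> x has_vector_derivative m1 s) (at s within {0..R})"
    "\<And>s. s \<in> {0..R} \<Longrightarrow> of_real s * m1 s = of_real s * flux u1 u2 x s"
    by metis
  have "\<exists>m. (cint (\<lambda>_. 1) ?w 0 has_vector_derivative m) (at s within {0..R}) \<and>
    of_real s * m = of_real s * flux v ?z 0 s" if "s \<in> {0..R}" for s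
    using circle_mean_derivative[OF pw _ that, of 0] by blast
  then obtain m2 where m2: "\<And>s. s \<in> {0..R} \<Longrightarrow> (cint (\<lambda>_. 1) ?w 0 has_vector_derivative m2 s) (at s within {0..R})"
    "\<And>s. s \<in> {0..R} \<Longrightarrow> of_real s * m2 s = of_real s * flux v ?z 0 s"
    by metis
  \<comment> \<open>Multiplying the wave by \<open>\<phi> x\<close> matches the initial values: at
    radius 0 the first mean is \<open>2 * pi * \<phi> x\<close> and that of the wave is
    \<open>2 * pi\<close>, so the difference of the two solutions starts from 0.\<close>
  have "of_real R * flux u1 u2 x R - \<phi> x * (of_real R * flux v ?z 0 R) = 0"
  proof (rule volterra_unique[where M = "\<lambda>s. cint (\<lambda>_. 1) \<phi> x s - \<phi> x * cint (\<lambda>_. 1) ?w 0 s" and k = k and R = R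
       and m = "\<lambda>s. m1 s - \<phi> x * m2 s"])
    fix s assume s: "s \<in> {0..R}"
    show "((\<lambda>s. cint (\<lambda>_. 1) \<phi> x s - \<phi> x * cint (\<lambda>_. 1) ?w 0 s) has_vector_derivative m1 s - \<phi> x * m2 s) (at s within {0..R})"
      by (intro has_vector_derivative_diff has_vector_derivative_mult_right m1 m2 s)
    have "((\<lambda>s. of_real s * flux u1 u2 x s - \<phi> x * (of_real s * flux v ?z 0 s)) has_vector_derivative
      - (of_real k)\<^sup>2 * (of_real s * cint (\<lambda>_. 1) \<phi> x s) - \<phi> x * (- (of_real k)\<^sup>2 * (of_real s * cint (\<lambda>_. 1) ?w 0 s))) (at s within {0..R})"
      by (intro has_vector_derivative_diff has_vector_derivative_mult_right flux_derivative[OF ff] flux_derivative[OF pw] assms s) simp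
    then show "((\<lambda>s. of_real s * flux u1 u2 x s - \<phi> x * (of_real s * flux v ?z 0 s)) has_vector_derivative
      - (of_real k)\<^sup>2 * (of_real s * (cint (\<lambda>_. 1) \<phi> x s - \<phi> x * cint (\<lambda>_. 1) ?w 0 s))) (at s within {0..R})"
      by (rule has_vector_derivative_eq_rhs) (simp add: algebra_simps)
    show "of_real s * (m1 s - \<phi> x * m2 s) = of_real s * flux u1 u2 x s - \<phi> x * (of_real s * flux v ?z 0 s)"
      unfolding m1(2)[OF s, symmetric] m2(2)[OF s, symmetric] by (simp add: algebra_simps)
  qed (use assms in \<open>simp_all add: cint_def plane_wave_def scaleR_conv_of_real[where 'a=complex]\<close>)
  moreover have "flux v ?z 0 R = flux_const k R"
    by (subst fz) (simp only: flux_const_def v_def[abs_def])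
  ultimately show ?thesis
    using \<open>0 < R\<close> by (simp add: algebra_simps)
qed

text \<open>The real part of the integrand is - k times \<open>?f\<close>. Since |k R cos t| < 2 <
  pi, the sine has the sign of \<open>cos t\<close>, so \<open>?f\<close> is nonnegative; a zero
  integral would force it to vanish at \<open>t = 0\<close>, where it is
  \<open>sin (k * R) > 0\<close>.\<close>

lemma flux_const_nonzero:
  assumes "0 < k" "0 < R" "k * R < 2"
  shows "flux_const k R \<noteq> 0"
proof
  let ?f = "\<lambda>t. cos t * sin (k * R * cos t)"
  assume z: "flux_const k R = 0"
  have "flux_const k R = integral {0..2*pi} (\<lambda>t. of_real (cos t) * (\<i> * of_real k * exp (\<i> * of_real (k * R * cos t))))"
    unfolding flux_const_def cint_def plane_wave_def by (simp add: inner_axis' mult_ac)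
  moreover have "((\<lambda>t. of_real (cos t) * (\<i> * of_real k * exp (\<i> * of_real (k * R * cos t)))) has_integral
     integral {0..2*pi} (\<lambda>t. of_real (cos t) * (\<i> * of_real k * exp (\<i> * of_real (k * R * cos t))))) {0..2*pi}"
    by (intro integrable_integral integrable_continuous_interval continuous_intros)
  ultimately have "((\<lambda>t. of_real (cos t) * (\<i> * of_real k * exp (\<i> * of_real (k * R * cos t)))) has_integral 0) {0..2*pi}"
    using z by (simp only:)
  from has_integral_Re[OF this]
  have "((\<lambda>t. Re (of_real (cos t) * (\<i> * of_real k * exp (\<i> * of_real (k * R * cos t))))) has_integral 0) {0..2*pi}"
    by simp
  then have "((\<lambda>t. (-k) * ?f t) has_integral 0) {0..2*pi}"
    by (simp add: Re_exp Im_exp mult_ac)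
  then have "((\<lambda>t. (-1/k) * ((-k) * ?f t)) has_integral (-1/k) * 0) {0..2*pi}"
    by (rule has_integral_mult_right)
  then have i0: "integral {0..2*pi} ?f = 0"
    using \<open>0 < k\<close> by (intro integral_unique) simp
  have nn: "?f t \<ge> 0" for t
  proof -
    have b: "k * R < pi" using assms(3) pi_gt3 by simp
    have kR: "k * R > 0" using assms by simp
    have "\<bar>k * R * cos t\<bar> \<le> k * R"
      using kR assms(1,2) mult_left_mono[of "\<bar>cos t\<bar>" 1 "k * R"] by (simp add: abs_mult)
    then have "\<bar>k * R * cos t\<bar> < pi" using b by linarith
    then show ?thesis
    proof (cases "cos t \<ge> 0")
      case True
      then have "sin (k * R * cos t) \<ge> 0"
        using kR \<open>\<bar>k * R * cos t\<bar> < pi\<close> by (intro sin_ge_zero) auto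
      then show ?thesis using True by simp
    next
      case False
      then have "sin (k * R * (- cos t)) \<ge> 0"
        using kR \<open>\<bar>k * R * cos t\<bar> < pi\<close> mult_nonneg_nonneg[of "k * R" "- cos t"]
        by (intro sin_ge_zero) auto
      then show ?thesis using False by (simp add: mult_nonpos_nonpos)
    qed
  qed
  have "continuous_on {0..2*pi} ?f"
    by (intro continuous_intros)
  from integral_eq_0_iff[OF this _ nn] i0 have "\<forall>t\<in>{0..2*pi}. ?f t = 0"
    by (simp del: mult_eq_0_iff)
  from this[rule_format, of 0] have "?f 0 = 0"
    by simp
  moreover have "sin (k * R) > 0"
    using assms pi_gt3 by (intro sin_gt_zero) auto
  ultimately show False by simp
qed

section \<open>Regularity, Helmholtz equation and gradient formulas from the flux identity\<close>

lemma Ck_flux: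
  assumes "open T" "\<And>x. x \<in> T \<Longrightarrow> cball x R \<subseteq> S" "0 \<le> R" "Ck n u1 S" "Ck n u2 S"
  shows "Ck n (\<lambda>x. flux u1 u2 x R) T"
  unfolding flux_def cint_def
  by (intro Ck_add Ck_circle_integral[where S = S] assms continuous_intros)

text \<open>Near a point one radius serves all centres, and there \<open>\<phi>\<close> is a
  constant times the flux of the undifferentiated field. Thus \<open>\<phi>\<close> loses no
  derivative against \<open>u1, u2\<close>, although it is proportional to their divergence.\<close>

lemma flux_field_regularity:
  assumes ff: "flux_field k S u1 u2 \<phi> \<psi>" and "open S" "0 < k" "Ck n u1 S" "Ck n u2 S"
  shows "Ck n \<phi> S"
proof (rule Ck_local)
  fix x assume "x \<in> S"
  then obtain \<delta> where \<delta>: "\<delta> > 0" "ball x \<delta> \<subseteq> S"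
    using \<open>open S\<close> openE by blast
  \<comment> \<open>Half of \<open>\<delta>\<close> goes to moving the centre within
    \<open>ball x R\<close>, half to the circle around it; \<open>1/k\<close> ensures
    \<open>k * R \<le> 1\<close>.\<close>
  define R where "R = min (\<delta>/2) (1/k)"
  have R: "0 < R" "k * R < 2" "2 * R \<le> \<delta>"
    using \<delta> \<open>0 < k\<close> by (auto simp: R_def min_def field_simps)
  have sub: "cball y R \<subseteq> S" if "y \<in> ball x R" for y
  proof -
    have "cball y R \<subseteq> ball x \<delta>"
    proof
      fix z assume "z \<in> cball y R"
      then show "z \<in> ball x \<delta>"
        using that R dist_triangle[of x z y] by simp
    qed
    then show ?thesis using \<delta> by blast
  qed
  have "Ck n (\<lambda>y. inverse (flux_const k R) * flux u1 u2 y R) (ball x R)"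
    using sub R assms by (intro Ck_cmult Ck_flux) auto
  then have "Ck n \<phi> (ball x R)"
  proof (rule Ck_cong[rotated 2])
    show "inverse (flux_const k R) * flux u1 u2 y R = \<phi> y" if "y \<in> ball x R" for y
      using flux_eq[OF ff sub[OF that] \<open>0 < k\<close> R(1,2)] flux_const_nonzero[OF \<open>0 < k\<close> R(1,2)] by simp
  qed simp
  then show "\<exists>T. open T \<and> x \<in> T \<and> Ck n \<phi> T"
    using R by (intro exI[of _ "ball x R"]) auto
qed

text \<open>The divergence of \<open>grad_perp \<psi>\<close> vanishes by
  \<open>partial_commute\<close>, which is why \<open>\<psi>\<close> too has to be C^2.\<close>

lemma flux_field_helmholtz:
  assumes ff: "flux_field k S u1 u2 \<phi> \<psi>" and "open S" "Ck 2 \<phi> S" "Ck 2 \<psi> S" "x \<in> S"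
  shows "laplacian \<phi> x + (of_real k)\<^sup>2 * \<phi> x = 0"
proof -
  have "partial 1 u1 x = partial 1 (\<lambda>y. partial 1 \<phi> y - partial 2 \<psi> y) x"
    "partial 2 u2 x = partial 2 (\<lambda>y. partial 2 \<phi> y + partial 1 \<psi> y) x"
    using ff by (auto intro!: partial_cong_open[OF \<open>open S\<close> \<open>x \<in> S\<close>] simp: flux_field_def)
  moreover have "\<dots> = partial 2 (partial 2 \<phi>) x + partial 2 (partial 1 \<psi>) x"
    using Ck_2D[OF assms(3)] Ck_2D[OF assms(4)] \<open>x \<in> S\<close> by (intro partial_add)
  moreover have "partial 1 (\<lambda>y. partial 1 \<phi> y - partial 2 \<psi> y) x
      = partial 1 (partial 1 \<phi>) x - partial 1 (partial 2 \<psi>) x"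
    using Ck_2D[OF assms(3)] Ck_2D[OF assms(4)] \<open>x \<in> S\<close> by (intro partial_diff)
  moreover have "partial 1 u1 x + partial 2 u2 x = - (of_real k)\<^sup>2 * \<phi> x"
    using ff \<open>x \<in> S\<close> by (simp add: flux_field_def)
  ultimately show ?thesis
    using partial_commute[OF \<open>open S\<close> assms(4) \<open>x \<in> S\<close>] by (simp add: laplacian_def)
qed

text \<open>Through this field the flux identity recovers \<open>\<phi>\<close> from its gradient,
  the only quantity about which the Kupradze condition speaks.\<close>

lemma flux_field_grad:
  assumes "Ck 2 \<phi> S" "\<And>x. x \<in> S \<Longrightarrow> laplacian \<phi> x + (of_real k)\<^sup>2 * \<phi> x = 0"
  shows "flux_field k S (partial 1 \<phi>) (partial 2 \<phi>) \<phi> (\<lambda>_. 0)"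
  unfolding flux_field_def partial_zero
  using assms(2) Ck_2D(1,2)[OF assms(1)] by (auto simp: laplacian_def Ck_zero eq_neg_iff_add_eq_0 simp del: One_nat_def)

text \<open>Both fields below are decompositions of \<open>- k\<^sup>2 \<phi> e\<^sub>j = \<Delta>\<phi> e\<^sub>j\<close>, whose divergence is
  \<open>- k\<^sup>2 \<partial>\<^sub>j \<phi>\<close>; they make the flux identity available for the partial derivatives of \<open>\<phi>\<close>.\<close>

lemma flux_field_partial:
  assumes "open S" "Ck 2 \<phi> S" "\<And>x. x \<in> S \<Longrightarrow> laplacian \<phi> x + (of_real k)\<^sup>2 * \<phi> x = 0"
  shows "flux_field k S (\<lambda>x. - (of_real k)\<^sup>2 * \<phi> x) (\<lambda>_. 0) (partial 1 \<phi>) (\<lambda>x. - partial 2 \<phi> x)"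
    and "flux_field k S (\<lambda>_. 0) (\<lambda>x. - (of_real k)\<^sup>2 * \<phi> x) (partial 2 \<phi>) (partial 1 \<phi>)"
proof -
  note C = Ck_2D[OF assms(2)]
  have lap: "- (of_real k)\<^sup>2 * \<phi> x = partial 1 (partial 1 \<phi>) x + partial 2 (partial 2 \<phi>) x" if "x \<in> S" for x
    using assms(3)[OF that] by (simp add: laplacian_def eq_neg_iff_add_eq_0 add.commute neg_eq_iff_add_eq_0)
  have cm: "partial j (\<lambda>x. - (of_real k)\<^sup>2 * \<phi> x) x = - (of_real k)\<^sup>2 * partial j \<phi> x" if "x \<in> S" for j x
    by (rule partial_cmult[OF C(3)[OF that]])
  have um: "partial j (\<lambda>x. - partial i \<phi> x) x = - partial j (partial i \<phi>) x" if "x \<in> S" for i j x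
    by (rule partial_uminus[OF C(4)[OF that]])
  have com: "partial 1 (partial 2 \<phi>) x = partial 2 (partial 1 \<phi>) x" if "x \<in> S" for x
    by (rule partial_commute[OF assms(1,2) that])
  have Ck: "Ck 1 (\<lambda>x. - (of_real k)\<^sup>2 * \<phi> x) S" "Ck 1 (\<lambda>_. 0 :: complex) S" "Ck 1 (\<lambda>x. - partial i \<phi> x) S" for i
    using Ck_cmult[OF \<open>open S\<close> C(1)] Ck_uminus[OF \<open>open S\<close> C(2)] Ck_zero by blast+
  show "flux_field k S (\<lambda>x. - (of_real k)\<^sup>2 * \<phi> x) (\<lambda>_. 0) (partial 1 \<phi>) (\<lambda>x. - partial 2 \<phi> x)"
    unfolding flux_field_def partial_zero
  proof (intro conjI ballI Ck C(2))
    fix x assume x: "x \<in> S"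
    show "- (of_real k)\<^sup>2 * \<phi> x = partial 1 (partial 1 \<phi>) x - partial 2 (\<lambda>x. - partial 2 \<phi> x) x"
      unfolding lap[OF x] um[OF x] by simp
    show "0 = partial 2 (partial 1 \<phi>) x + partial 1 (\<lambda>x. - partial 2 \<phi> x) x"
      unfolding um[OF x] com[OF x] by simp
    show "partial 1 (\<lambda>x. - (of_real k)\<^sup>2 * \<phi> x) x + 0 = - (of_real k)\<^sup>2 * partial 1 \<phi> x"
      unfolding cm[OF x] by simp
  qed
  show "flux_field k S (\<lambda>_. 0) (\<lambda>x. - (of_real k)\<^sup>2 * \<phi> x) (partial 2 \<phi>) (partial 1 \<phi>)"
    unfolding flux_field_def partial_zero
  proof (intro conjI ballI Ck C(2))
    fix x assume x: "x \<in> S"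
    show "- (of_real k)\<^sup>2 * \<phi> x = partial 2 (partial 2 \<phi>) x + partial 1 (partial 1 \<phi>) x"
      unfolding lap[OF x] by simp
    show "0 = partial 1 (partial 2 \<phi>) x - partial 2 (partial 1 \<phi>) x"
      unfolding com[OF x] by simp
    show "0 + partial 2 (\<lambda>x. - (of_real k)\<^sup>2 * \<phi> x) x = - (of_real k)\<^sup>2 * partial 2 \<phi> x"
      unfolding cm[OF x] by simp
  qed
qed

text \<open>An interior gradient estimate in exact form: the flux of
  \<open>- k\<^sup>2 \<phi> e\<^sub>j\<close> is the integral of \<open>\<phi>\<close> against the
  \<open>j\<close>-th component of the normal, so values of \<open>\<phi>\<close> on one circle
  bound its gradient at the centre.\<close>

lemma partial_circle_formula:
  assumes "open S" "Ck 2 \<phi> S" "\<And>x. x \<in> S \<Longrightarrow> laplacian \<phi> x + (of_real k)\<^sup>2 * \<phi> x = 0"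
    and "cball x R \<subseteq> S" "0 < k" "0 < R" "k * R < 2"
  shows "partial j \<phi> x * flux_const k R = - (of_real k)\<^sup>2 * cint (\<lambda>t. of_real (circ t $ j)) \<phi> x R"
proof -
  have z: "cint w (\<lambda>_. 0) x R = 0" for w by (simp add: cint_def)
  consider "j = 1" | "j = 2" using exhaust_2 by blast
  then show ?thesis
    using flux_eq[OF flux_field_partial(1)[OF assms(1-3)] assms(4-)]
      flux_eq[OF flux_field_partial(2)[OF assms(1-3)] assms(4-)]
    by cases (simp_all only: flux_def cint_cmult z circ_nth add_0_left add_0_right)
qed

section \<open>Radiation conditions\<close>

text \<open>This is the rate 1/r at which the radial direction varies over a circle of fixed
  radius.\<close>

lemma norm_sgn_diff_le:
  fixes x y :: "'a::real_normed_vector"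
  assumes "x \<noteq> 0"
  shows "norm (sgn x - sgn y) \<le> 2 * norm (x - y) / norm x"
proof (cases "y = 0")
  \<comment> \<open>By convention \<open>sgn 0 = 0\<close>, so the left side is 1 and the right side
    2.\<close>
  case True
  then show ?thesis using assms by (simp add: norm_sgn)
next
  case False
  have "sgn x - sgn y = (1 / norm x) *\<^sub>R (x - y) + (1 / norm x - 1 / norm y) *\<^sub>R y"
    by (simp add: sgn_div_norm divide_inverse algebra_simps)
  also have "norm \<dots> \<le> norm (x - y) / norm x + \<bar>1 / norm x - 1 / norm y\<bar> * norm y"
    by (rule order_trans[OF norm_triangle_ineq]) simp
  also have "\<bar>1 / norm x - 1 / norm y\<bar> * norm y = \<bar>norm y - norm x\<bar> / norm x"
  proof -
    have "\<bar>1 / norm x - 1 / norm y\<bar> * norm y = \<bar>(1 / norm x - 1 / norm y) * norm y\<bar>"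
      by (simp add: abs_mult)
    also have "(1 / norm x - 1 / norm y) * norm y = (norm y - norm x) / norm x"
      using assms False by (simp add: field_simps)
    finally show ?thesis by simp
  qed
  also have "\<dots> \<le> norm (x - y) / norm x"
    by (intro divide_right_mono) (use norm_triangle_ineq3[of y x] in \<open>simp_all add: norm_minus_commute\<close>)
  finally show ?thesis by (simp add: field_simps)
qed

text \<open>This is f = o(|x|^a), uniformly in the direction. The form with an explicit radius
  transfers easily to all points of a circle around \<open>x\<close>.\<close>

definition small_at_infinity :: "real \<Rightarrow> (real^2 \<Rightarrow> complex) \<Rightarrow> bool" where
  "small_at_infinity a f \<longleftrightarrow> (\<forall>\<epsilon>>0. \<exists>b. \<forall>x. b \<le> norm x \<longrightarrow> norm (f x) \<le> \<epsilon> * norm x powr a)"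

lemma small_at_infinity_tendsto:
  "((\<lambda>x. sqrt (norm x) *\<^sub>R f x) \<longlongrightarrow> 0) at_infinity \<longleftrightarrow> small_at_infinity (-1/2) f"
proof -
  have eq: "norm (sqrt (norm x) *\<^sub>R f x) \<le> e \<longleftrightarrow> norm (f x) \<le> e * norm x powr (-1/2)"
    if "norm x \<ge> 1" for x :: "real^2" and e :: real
  proof -
    have "0 < sqrt (norm x)" using that by auto
    moreover have "norm x powr (-1/2) = 1 / sqrt (norm x)"
      using powr_minus_divide[of "norm x" "1/2"] by (simp add: powr_half_sqrt)
    ultimately show ?thesis by (simp add: pos_le_divide_eq mult.commute)
  qed
  show ?thesis
  proof
    assume *: "((\<lambda>x. sqrt (norm x) *\<^sub>R f x) \<longlongrightarrow> 0) at_infinity"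
    show "small_at_infinity (-1/2) f"
      unfolding small_at_infinity_def
    proof (intro allI impI)
      fix e :: real assume "e > 0"
      from tendstoD[OF * this] obtain b where "\<And>x. b \<le> norm x \<Longrightarrow> norm (sqrt (norm x) *\<^sub>R f x) < e"
        unfolding eventually_at_infinity by auto
      then show "\<exists>b. \<forall>x. b \<le> norm x \<longrightarrow> norm (f x) \<le> e * norm x powr (-1/2)"
        using eq by (intro exI[of _ "max 1 b"]) (metis less_imp_le max.bounded_iff)
    qed
  next
    assume *: "small_at_infinity (-1/2) f"
    show "((\<lambda>x. sqrt (norm x) *\<^sub>R f x) \<longlongrightarrow> 0) at_infinity"
    proof (rule tendstoI)
      fix e :: real assume "e > 0"
      then obtain b where "\<And>x. b \<le> norm x \<Longrightarrow> norm (f x) \<le> (e/2) * norm x powr (-1/2)"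
        using * unfolding small_at_infinity_def by (meson half_gt_zero)
      then have "norm (sqrt (norm x) *\<^sub>R f x) \<le> e/2" if "max 1 b \<le> norm x" for x
        using eq[of x "e/2"] that by auto
      then have "dist (sqrt (norm x) *\<^sub>R f x) 0 < e" if "max 1 b \<le> norm x" for x
        using that \<open>e > 0\<close> by (simp only: dist_norm diff_0_right) (smt (verit) field_sum_of_halves)
      then show "\<forall>\<^sub>F x in at_infinity. dist (sqrt (norm x) *\<^sub>R f x) 0 < e"
        unfolding eventually_at_infinity by blast
    qed
  qed
qed

text \<open>On the circle the norm stays between half and twice \<open>norm x\<close>; the exponent
  \<open>\<bar>a\<bar>\<close> covers increasing and decreasing powers at once.\<close>

lemma norm_circle_powr:
  assumes "0 \<le> R" "2 * R \<le> norm x" "x \<noteq> 0"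
  shows "norm (x + R *\<^sub>R circ t) powr a \<le> 2 powr \<bar>a\<bar> * norm x powr a"
proof -
  let ?y = "x + R *\<^sub>R circ t"
  have 1: "norm ?y \<le> norm x + R" "norm x \<le> norm ?y + R"
    using norm_triangle_ineq[of x "R *\<^sub>R circ t"] norm_triangle_ineq[of ?y "- (R *\<^sub>R circ t)"] assms(1) by simp_all
  have nx: "norm x > 0" using assms(3) by simp
  then have 2: "norm ?y \<le> 2 * norm x" "norm x \<le> 2 * norm ?y" "norm ?y > 0"
    using 1 assms(1,2) by linarith+
  show ?thesis
  proof (cases "a \<ge> 0")
    case True
    have "norm ?y powr a \<le> (2 * norm x) powr a"
      using 2 True by (intro powr_mono2) auto
    then show ?thesis using True by (simp add: powr_mult)
  next
    case False
    have "norm ?y powr a \<le> (norm x / 2) powr a"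
      using 2 False nx by (intro powr_mono2') auto
    also have "\<dots> = 2 powr \<bar>a\<bar> * norm x powr a"
      using False by (simp add: powr_divide powr_minus field_simps)
    finally show ?thesis .
  qed
qed

lemma small_at_infinityD:
  assumes "small_at_infinity a f" "0 \<le> R" "0 < \<epsilon>"
  obtains b where "\<And>x t. b \<le> norm x \<Longrightarrow> norm (f (x + R *\<^sub>R circ t)) \<le> \<epsilon> * norm x powr a"
proof -
  have "0 < \<epsilon> / 2 powr \<bar>a\<bar>" using assms(3) by simp
  then obtain b where b: "\<And>x. b \<le> norm x \<Longrightarrow> norm (f x) \<le> \<epsilon> / 2 powr \<bar>a\<bar> * norm x powr a"
    using assms(1) unfolding small_at_infinity_def by blast
  show thesis
  proof (rule that)
    \<comment> \<open>The bound \<open>b + R\<close> keeps the whole circle beyond \<open>b\<close>,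
      \<open>2 * R\<close> serves \<open>norm_circle_powr\<close>, and 1 excludes
      \<open>x = 0\<close>.\<close>
    fix x :: "real^2" and t assume x: "max 1 (max (b + R) (2 * R)) \<le> norm x"
    then have x': "x \<noteq> 0" "2 * R \<le> norm x" "b + R \<le> norm x" by auto
    have "norm x \<le> norm (x + R *\<^sub>R circ t) + R"
      using norm_triangle_ineq[of "x + R *\<^sub>R circ t" "- (R *\<^sub>R circ t)"] assms(2) by simp
    then have "norm (f (x + R *\<^sub>R circ t)) \<le> \<epsilon> / 2 powr \<bar>a\<bar> * norm (x + R *\<^sub>R circ t) powr a"
      using b x' by auto
    also have "\<dots> \<le> \<epsilon> / 2 powr \<bar>a\<bar> * (2 powr \<bar>a\<bar> * norm x powr a)"
      using norm_circle_powr[OF assms(2) x'(2,1)] assms(3) by (intro mult_left_mono) auto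
    also have "\<dots> = \<epsilon> * norm x powr a" by simp
    finally show "norm (f (x + R *\<^sub>R circ t)) \<le> \<epsilon> * norm x powr a" .
  qed
qed

text \<open>The function \<open>exp (- \<i> k s) v (s d)\<close> has derivative \<open>o(s\<^sup>-\<^sup>1\<^sup>/\<^sup>2)\<close> along the ray with direction
  \<open>d\<close>.\<close>

lemma small_at_infinity_of_radiating:
  assumes "open S" "\<And>x. r0 < norm x \<Longrightarrow> x \<in> S" and v: "Ck 1 v S"
    and small: "small_at_infinity (-1/2) (\<lambda>x. frechet_derivative v (at x) (sgn x) - \<i> * of_real k * v x)"
  shows "small_at_infinity (1/2) v"
  unfolding small_at_infinity_def
proof (intro allI impI)
  fix \<epsilon> :: real assume "\<epsilon> > 0"
  then have "\<epsilon> / 4 > 0" by simp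
  then obtain b0 where b0: "\<And>x. b0 \<le> norm x \<Longrightarrow>
      norm (frechet_derivative v (at x) (sgn x) - \<i> * of_real k * v x) \<le> \<epsilon> / 4 * norm x powr (-1/2)"
    using small unfolding small_at_infinity_def by blast
  define b where "b = max b0 (\<bar>r0\<bar> + 1)"
  have b: "b > 0" "b \<ge> b0" "b > r0" by (auto simp: b_def)
  have C1: "Ck (Suc 0) v S" using v by simp
  have "compact (v ` sphere 0 b)"
    using assms(2) b by (intro compact_continuous_image continuous_on_subset[OF Ck_continuous_on[OF v]]) auto
  then obtain C where C: "\<And>x. norm x = b \<Longrightarrow> norm (v x) \<le> C"
    using compact_imp_bounded[of "v ` sphere 0 b"] unfolding bounded_iff by (metis imageI mem_sphere_0)
  show "\<exists>b. \<forall>x. b \<le> norm x \<longrightarrow> norm (v x) \<le> \<epsilon> * norm x powr (1/2)"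
  proof (intro exI allI impI)
    \<comment> \<open>Integrating \<open>\<epsilon> / 4 * s powr (-1/2)\<close> along the ray yields
      at most \<open>\<epsilon> / 2 * sqrt r\<close>. The other half of \<open>\<epsilon>\<close>
      absorbs the initial value, bounded by \<open>C\<close>, as soon as \<open>r\<close> exceeds
      \<open>(2 * C / \<epsilon>)\<^sup>2\<close>.\<close>
    fix x :: "real^2" assume x: "max b ((2 * C / \<epsilon>)\<^sup>2) \<le> norm x"
    define d where "d = sgn x"
    define r where "r = norm x"
    have r: "b \<le> r" "(2 * C / \<epsilon>)\<^sup>2 \<le> r" using x by (auto simp: r_def)
    have x0: "x \<noteq> 0" using x b by auto
    have nd: "norm d = 1" and xr: "x = r *\<^sub>R d"
      using x0 by (simp_all add: d_def r_def norm_sgn sgn_div_norm)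
    define g where "g s = exp (- (\<i> * of_real (k * s))) * v (s *\<^sub>R d)" for s
    define g' where "g' s = exp (- (\<i> * of_real (k * s))) *
        (frechet_derivative v (at (s *\<^sub>R d)) (sgn (s *\<^sub>R d)) - \<i> * of_real k * v (s *\<^sub>R d))" for s
    have norm_exp: "norm (exp (- (\<i> * of_real y))) = 1" for y
      by (simp add: norm_exp_eq_Re)
    have sd: "s *\<^sub>R d \<in> S" "sgn (s *\<^sub>R d) = d" "norm (s *\<^sub>R d) = s" if "b \<le> s" for s
      using that b nd assms(2)[of "s *\<^sub>R d"] by (auto simp: sgn_div_norm)
    have der: "(g has_vector_derivative g' s) (at s)" if s: "b \<le> s" for s
    proof -
      have "((\<lambda>s. s *\<^sub>R d) has_vector_derivative d) (at s)"
        by (auto intro!: derivative_eq_intros)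
      from has_vector_derivative_along[OF Ck_SucD(1)[OF C1 sd(1)[OF s]] this]
      have 1: "((\<lambda>s. v (s *\<^sub>R d)) has_vector_derivative frechet_derivative v (at (s *\<^sub>R d)) d) (at s)"
        by (simp add: frechet_derivative_partial[OF Ck_SucD(1)[OF C1 sd(1)[OF s]]])
      have "((\<lambda>s. - (\<i> * of_real (k * s))) has_vector_derivative - (\<i> * of_real k)) (at s)"
        by (auto intro!: derivative_eq_intros has_vector_derivative_of_real simp: has_real_derivative_iff_has_vector_derivative[symmetric])
      from field_vector_diff_chain_at[OF this DERIV_exp]
      have 2: "((\<lambda>s. exp (- (\<i> * of_real (k * s)))) has_vector_derivative
          - (\<i> * of_real k) * exp (- (\<i> * of_real (k * s)))) (at s)"
        by (simp add: o_def)
      show ?thesis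
        unfolding g_def[abs_def] g'_def sd(2)[OF s]
        by (rule has_vector_derivative_eq_rhs[OF has_vector_derivative_mult[OF 2 1]]) (simp add: algebra_simps)
    qed
    have "norm (g r) \<le> C + \<epsilon> / 2 * sqrt r"
    proof (cases "b < r")
      case True
      have "norm (g r - g b) \<le> \<epsilon> / 2 * sqrt r - \<epsilon> / 2 * sqrt b"
      proof (rule differentiable_bound_general[OF True, where f' = g' and \<phi>' = "\<lambda>s. \<epsilon> / 2 * (inverse (sqrt s) / 2)"])
        show "continuous_on {b..r} g"
          using der has_vector_derivative_continuous by (intro continuous_at_imp_continuous_on) fastforce
        show "continuous_on {b..r} (\<lambda>s. \<epsilon> / 2 * sqrt s)" by (intro continuous_intros)
        fix s assume s: "b < s" "s < r"
        show "(g has_vector_derivative g' s) (at s)" using der s by simp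
        show "((\<lambda>s. \<epsilon> / 2 * sqrt s) has_vector_derivative \<epsilon> / 2 * (inverse (sqrt s) / 2)) (at s)"
          unfolding has_real_derivative_iff_has_vector_derivative[symmetric]
          using s b by (intro DERIV_cmult DERIV_real_sqrt) simp
        have "norm (g' s) \<le> \<epsilon> / 4 * s powr (-1/2)"
          using b0[of "s *\<^sub>R d"] sd(3)[of s] s b by (simp add: g'_def norm_mult norm_exp)
        also have "s powr (-1/2) = inverse (sqrt s)"
          using powr_minus[of s "1/2"] s b by (simp add: powr_half_sqrt)
        finally show "norm (g' s) \<le> \<epsilon> / 2 * (inverse (sqrt s) / 2)" by simp
      qed
      moreover have "norm (g b) \<le> C"
        using C[of "b *\<^sub>R d"] nd b by (simp add: g_def norm_mult norm_exp)
      moreover have "\<epsilon> / 2 * sqrt b \<ge> 0" using b \<open>\<epsilon> > 0\<close> by simp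
      ultimately show ?thesis using norm_triangle_sub[of "g r" "g b"] by linarith
    next
      case False
      then have "r = b" using r by simp
      then have "norm (g r) \<le> C"
        using C[of "b *\<^sub>R d"] nd b by (simp add: g_def norm_mult norm_exp)
      moreover have "\<epsilon> / 2 * sqrt r \<ge> 0" using r b \<open>\<epsilon> > 0\<close> by simp
      ultimately show ?thesis by linarith
    qed
    moreover have "2 * C / \<epsilon> \<le> sqrt r"
      using r(2) by (rule real_le_rsqrt)
    then have "C \<le> \<epsilon> / 2 * sqrt r" using \<open>\<epsilon> > 0\<close> by (simp add: field_simps)
    ultimately have "norm (g r) \<le> \<epsilon> * sqrt r" by linarith
    then show "norm (v x) \<le> \<epsilon> * norm x powr (1/2)"
      using r b by (simp add: g_def norm_mult norm_exp powr_half_sqrt flip: xr r_def)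
  qed
qed

text \<open>With the direction frozen at \<open>sgn x\<close>, the operator in the Sommerfeld
  condition has constant coefficients and commutes with circle integrals. Since
  \<open>\<phi>\<close> is such an integral of its gradient, its condition at \<open>x\<close>
  reduces to that of the gradient on the circle, up to the change of direction multiplied by second
  derivatives.\<close>

lemma sommerfeld_of_gradient:
  assumes "open S" "\<And>x. r0 < norm x \<Longrightarrow> x \<in> S" and "0 < k" and \<phi>: "Ck 2 \<phi> S"
    and helm: "\<And>x. x \<in> S \<Longrightarrow> laplacian \<phi> x + (of_real k)\<^sup>2 * \<phi> x = 0"
    and som: "\<And>j. small_at_infinity (-1/2)
       (\<lambda>x. frechet_derivative (partial j \<phi>) (at x) (sgn x) - \<i> * of_real k * partial j \<phi> x)"
  shows "small_at_infinity (-1/2) (\<lambda>x. frechet_derivative \<phi> (at x) (sgn x) - \<i> * of_real k * \<phi> x)"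
proof -
  define R where "R = 1 / k"
  have R: "0 < R" "k * R < 2" using \<open>0 < k\<close> by (simp_all add: R_def)
  define c where "c = flux_const k R"
  have "c \<noteq> 0" unfolding c_def by (rule flux_const_nonzero[OF \<open>0 < k\<close> R])
  define T where "T = {x :: real^2. r0 + R < norm x}"
  have "open T" unfolding T_def by (intro open_Collect_less continuous_intros)
  have TS: "cball x R \<subseteq> S" if "x \<in> T" for x
  proof
    fix y assume "y \<in> cball x R"
    then have "norm (x - y) \<le> R" by (simp add: dist_norm)
    then show "y \<in> S"
      using that norm_triangle_ineq2[of x y] by (intro assms(2)) (simp add: T_def)
  qed
  have T: "x \<in> T" if "\<bar>r0\<bar> + R + 1 \<le> norm x" for x
    using that by (simp add: T_def)
  note C = Ck_2D[OF \<phi>]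
  have wcont: "continuous_on UNIV (\<lambda>t. complex_of_real (circ t $ j))" for j
    using exhaust_2[of j] by (auto intro!: continuous_intros)
  have wle: "norm (complex_of_real (circ t $ j)) \<le> 1" for t j
    using component_le_norm_cart[of "circ t" j] by simp
  have grad: "partial j \<phi> x * c = - (of_real k)\<^sup>2 * cint (\<lambda>t. of_real (circ t $ j)) \<phi> x R" if "x \<in> T" for x j
    unfolding c_def by (rule partial_circle_formula[OF \<open>open S\<close> \<phi> helm TS[OF that] \<open>0 < k\<close> R])
  \<comment> \<open>Differentiating the gradient formula in its centre bounds second derivatives at
    \<open>x\<close> by first derivatives on the circle.\<close>
  have hess: "partial i (partial j \<phi>) x * c = - (of_real k)\<^sup>2 * cint (\<lambda>t. of_real (circ t $ j)) (partial i \<phi>) x R"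
    if "x \<in> T" for x i j
  proof -
    have xS: "x \<in> S" using TS[OF that] R by auto
    have "partial i (partial j \<phi>) x * c = partial i (\<lambda>x. c * partial j \<phi> x) x"
      using C(4)[OF xS] by (simp add: partial_cmult)
    also have "\<dots> = partial i (\<lambda>x. - (of_real k)\<^sup>2 * cint (\<lambda>t. of_real (circ t $ j)) \<phi> x R) x"
      by (rule partial_cong_open[OF \<open>open T\<close> that]) (metis grad mult.commute)
    also have "\<dots> = - (of_real k)\<^sup>2 * partial i (\<lambda>x. cint (\<lambda>t. of_real (circ t $ j)) \<phi> x R) x"
      by (intro partial_cmult cint_differentiable[OF \<open>open T\<close> TS _ wcont C(1) that] less_imp_le[OF R(1)])
    also have "partial i (\<lambda>x. cint (\<lambda>t. of_real (circ t $ j)) \<phi> x R) x = cint (\<lambda>t. of_real (circ t $ j)) (partial i \<phi>) x R"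
      by (rule cint_partial[OF \<open>open T\<close> TS less_imp_le[OF R(1)] wcont C(1) that])
    finally show ?thesis .
  qed
  let ?w = "\<lambda>j t. complex_of_real (circ t $ j)"
  have val: "\<phi> x * c = cint (?w 1) (partial 1 \<phi>) x R + cint (?w 2) (partial 2 \<phi>) x R" if "x \<in> T" for x
    using flux_eq[OF flux_field_grad[OF \<phi> helm] TS[OF that] \<open>0 < k\<close> R] unfolding flux_def c_def circ_nth by simp
  have deriv: "partial i \<phi> x * c = cint (?w 1) (partial i (partial 1 \<phi>)) x R + cint (?w 2) (partial i (partial 2 \<phi>)) x R"
    if "x \<in> T" for x i
  proof -
    have xS: "x \<in> S" using TS[OF that] R by auto
    note R0 = less_imp_le[OF R(1)]
    have "partial i \<phi> x * c = partial i (\<lambda>x. c * \<phi> x) x"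
      using C(3)[OF xS] by (simp add: partial_cmult)
    also have "\<dots> = partial i (\<lambda>x. cint (?w 1) (partial 1 \<phi>) x R + cint (?w 2) (partial 2 \<phi>) x R) x"
      by (rule partial_cong_open[OF \<open>open T\<close> that]) (metis val mult.commute)
    also have "\<dots> = partial i (\<lambda>x. cint (?w 1) (partial 1 \<phi>) x R) x + partial i (\<lambda>x. cint (?w 2) (partial 2 \<phi>) x R) x"
      by (intro partial_add cint_differentiable[OF \<open>open T\<close> TS R0 wcont C(2) that])
    also have "\<dots> = cint (?w 1) (partial i (partial 1 \<phi>)) x R + cint (?w 2) (partial i (partial 2 \<phi>)) x R"
      by (simp only: cint_partial[OF \<open>open T\<close> TS R0 wcont C(2) that])
    finally show ?thesis .
  qed
  have small_grad: "small_at_infinity (1/2) (partial j \<phi>)" for j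
    by (rule small_at_infinity_of_radiating[OF assms(1,2) C(2) som])
  have small_hess: "small_at_infinity (1/2) (partial i (partial j \<phi>))" for i j
    unfolding small_at_infinity_def
  proof (intro allI impI)
    fix \<epsilon> :: real assume "\<epsilon> > 0"
    \<comment> \<open>Solves \<open>k\<^sup>2 * (2 * pi * \<delta>) = \<epsilon> * norm c\<close>,
      the loss in passing from the circle integral to the second derivative.\<close>
    define \<delta> where "\<delta> = \<epsilon> * norm c / (k\<^sup>2 * (2 * pi))"
    have "\<delta> > 0" using \<open>\<epsilon> > 0\<close> \<open>c \<noteq> 0\<close> \<open>0 < k\<close> by (simp add: \<delta>_def)
    from small_at_infinityD[OF small_grad less_imp_le[OF R(1)] this]
    obtain b where b: "\<And>x t. b \<le> norm x \<Longrightarrow> norm (partial i \<phi> (x + R *\<^sub>R circ t)) \<le> \<delta> * norm x powr (1/2)"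
      by blast
    show "\<exists>b. \<forall>x. b \<le> norm x \<longrightarrow> norm (partial i (partial j \<phi>) x) \<le> \<epsilon> * norm x powr (1/2)"
    proof (intro exI allI impI)
      fix x :: "real^2" assume x: "max b (\<bar>r0\<bar> + R + 1) \<le> norm x"
      have "norm (cint (\<lambda>t. of_real (circ t $ j)) (partial i \<phi>) x R) \<le> 2 * pi * (\<delta> * norm x powr (1/2))"
        using b x wle by (intro cint_bound) auto
      then have "k\<^sup>2 * norm (cint (\<lambda>t. of_real (circ t $ j)) (partial i \<phi>) x R)
          \<le> k\<^sup>2 * (2 * pi * (\<delta> * norm x powr (1/2)))"
        by (rule mult_left_mono) simp
      moreover have "norm (partial i (partial j \<phi>) x) * norm c
          = k\<^sup>2 * norm (cint (\<lambda>t. of_real (circ t $ j)) (partial i \<phi>) x R)"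
        using arg_cong[OF hess[OF T, of x i j], of norm] x by (simp add: norm_mult norm_power)
      moreover have "k\<^sup>2 * (2 * pi * (\<delta> * norm x powr (1/2))) = \<epsilon> * norm x powr (1/2) * norm c"
        using \<open>0 < k\<close> by (simp add: \<delta>_def)
      ultimately show "norm (partial i (partial j \<phi>) x) \<le> \<epsilon> * norm x powr (1/2)"
        using \<open>c \<noteq> 0\<close> by (smt (verit) mult_right_le_imp_le zero_less_norm_iff)
    qed
  qed
  show ?thesis
    unfolding small_at_infinity_def
  proof (intro allI impI)
    fix \<epsilon> :: real assume "\<epsilon> > 0"
    \<comment> \<open>There are two circle integrals, each with factor \<open>2 * pi\<close>, of
      integrands bounded by \<open>\<delta> * (1 + 4 * R)\<close>: 1 from the radiation condition on
      the circle, \<open>2 * R\<close> from the change of direction in each of the two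
      coordinates.\<close>
    define \<delta> where "\<delta> = \<epsilon> * norm c / (4 * pi * (1 + 4 * R))"
    have d: "\<delta> > 0" "4 * pi * (\<delta> * (1 + 4 * R)) = \<epsilon> * norm c"
      using \<open>\<epsilon> > 0\<close> \<open>c \<noteq> 0\<close> R by (simp_all add: \<delta>_def add_pos_pos)
    note sm = small_at_infinityD[OF _ less_imp_le[OF R(1)] d(1)]
    have "\<exists>b. \<forall>x t. b \<le> norm x \<longrightarrow> norm (partial i (partial j \<phi>) (x + R *\<^sub>R circ t)) \<le> \<delta> * norm x powr (1/2)" for i j
      by (rule sm[OF small_hess[of i j]]) blast
    then obtain b1 where b1: "\<And>i j x t. b1 i j \<le> norm x \<Longrightarrow> norm (partial i (partial j \<phi>) (x + R *\<^sub>R circ t)) \<le> \<delta> * norm x powr (1/2)"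
      by metis
    have "\<exists>b. \<forall>x t. b \<le> norm x \<longrightarrow> norm (frechet_derivative (partial j \<phi>) (at (x + R *\<^sub>R circ t)) (sgn (x + R *\<^sub>R circ t))
      - \<i> * of_real k * partial j \<phi> (x + R *\<^sub>R circ t)) \<le> \<delta> * norm x powr (-1/2)" for j
      by (rule sm[OF som[of j]]) blast
    then obtain b2 where b2: "\<And>j x t. b2 j \<le> norm x \<Longrightarrow> norm (frechet_derivative (partial j \<phi>) (at (x + R *\<^sub>R circ t)) (sgn (x + R *\<^sub>R circ t))
      - \<i> * of_real k * partial j \<phi> (x + R *\<^sub>R circ t)) \<le> \<delta> * norm x powr (-1/2)"
      by metis
    define b where "b = Max (insert (\<bar>r0\<bar> + R + 1) (range (\<lambda>(i, j). b1 i j) \<union> range b2))"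
    have b: "\<bar>r0\<bar> + R + 1 \<le> b" "b1 i j \<le> b" "b2 j \<le> b" for i j
      unfolding b_def by (rule Max_ge; force)+
    show "\<exists>b. \<forall>x. b \<le> norm x \<longrightarrow> norm (frechet_derivative \<phi> (at x) (sgn x) - \<i> * of_real k * \<phi> x) \<le> \<epsilon> * norm x powr (-1/2)"
    proof (intro exI allI impI)
      fix x :: "real^2" assume x: "b \<le> norm x"
      have xT: "x \<in> T" using T b(1) x by force
      have x0: "x \<noteq> 0" using x b(1) R by auto
      have xS: "x \<in> S" using TS[OF xT] R by auto
      let ?y = "\<lambda>t. x + R *\<^sub>R circ t"
      let ?p = "norm x powr (-1/2)"
      have yS: "?y t \<in> S" for t using TS[OF xT] circle_in_cball[of R R x t] R by auto
      \<comment> \<open>The Sommerfeld operator with the direction of the centre \<open>x\<close>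
        instead of that of \<open>y\<close>, applied to \<open>partial j \<phi>\<close>.\<close>
      define Q where "Q j y = sgn x $ 1 * partial 1 (partial j \<phi>) y + sgn x $ 2 * partial 2 (partial j \<phi>) y
        - \<i> * of_real k * partial j \<phi> y" for j y
      have Qb: "norm (Q j (?y t)) \<le> \<delta> * (1 + 4 * R) * ?p" for j t
      proof -
        let ?h = "sgn x - sgn (?y t)"
        have hb: "norm (complex_of_real (?h $ i) * partial i (partial j \<phi>) (?y t)) \<le> 2 * R * \<delta> * ?p" for i
        proof -
          have "\<bar>?h $ i\<bar> \<le> 2 * R / norm x"
            using component_le_norm_cart[of ?h i] norm_sgn_diff_le[OF x0, of "?y t"] R by simp
          moreover have "norm (partial i (partial j \<phi>) (?y t)) \<le> \<delta> * norm x powr (1/2)"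
            using b1 b(2)[of i j] x by auto
          ultimately have "norm (complex_of_real (?h $ i) * partial i (partial j \<phi>) (?y t))
              \<le> 2 * R / norm x * (\<delta> * norm x powr (1/2))"
            unfolding norm_mult norm_of_real using R by (intro mult_mono) auto
          also have "\<dots> = 2 * R * \<delta> * (norm x powr (1/2) / norm x powr 1)"
            using x0 by simp
          \<comment> \<open>The orders match exactly: the factor 1/r from the change of direction
            turns the crude growth bound o(r^(1/2)) into the o(r^(-1/2)) that the condition asks
            for.\<close>
          also have "norm x powr (1/2) / norm x powr 1 = ?p"
            unfolding powr_diff[symmetric] by simp
          finally show ?thesis .
        qed
        have "Q j (?y t) = (frechet_derivative (partial j \<phi>) (at (?y t)) (sgn (?y t)) - \<i> * of_real k * partial j \<phi> (?y t))
           + ?h $ 1 * partial 1 (partial j \<phi>) (?y t) + ?h $ 2 * partial 2 (partial j \<phi>) (?y t)"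
          by (simp add: Q_def frechet_derivative_partial[OF C(4)[OF yS]] scaleR_conv_of_real[where 'a=complex] algebra_simps)
        also have "norm \<dots> \<le> \<delta> * ?p + norm (complex_of_real (?h $ 1) * partial 1 (partial j \<phi>) (?y t))
            + norm (complex_of_real (?h $ 2) * partial 2 (partial j \<phi>) (?y t))"
          using b2[of j x t] b(3)[of j] x by (intro order_trans[OF norm_triangle_ineq] add_right_mono) auto
        finally have "norm (Q j (?y t)) \<le> \<delta> * ?p + norm (complex_of_real (?h $ 1) * partial 1 (partial j \<phi>) (?y t))
            + norm (complex_of_real (?h $ 2) * partial 2 (partial j \<phi>) (?y t))" .
        then have "norm (Q j (?y t)) \<le> \<delta> * ?p + 2 * R * \<delta> * ?p + 2 * R * \<delta> * ?p"
          using hb[of 1] hb[of 2] by linarith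
        then show ?thesis by (simp add: algebra_simps)
      qed
      have cQ: "cint (?w j) (Q j) x R = sgn x $ 1 * cint (?w j) (partial 1 (partial j \<phi>)) x R
          + sgn x $ 2 * cint (?w j) (partial 2 (partial j \<phi>)) x R - \<i> * of_real k * cint (?w j) (partial j \<phi>) x R" for j
        unfolding Q_def[abs_def]
        by (intro cint_lincomb[OF C(5) C(5) Ck_continuous_on[OF C(2)] wcont TS[OF xT] less_imp_le[OF R(1)]])
      have "(frechet_derivative \<phi> (at x) (sgn x) - \<i> * of_real k * \<phi> x) * c
          = sgn x $ 1 * (partial 1 \<phi> x * c) + sgn x $ 2 * (partial 2 \<phi> x * c) - \<i> * of_real k * (\<phi> x * c)"
        by (simp add: frechet_derivative_partial[OF C(3)[OF xS]] scaleR_conv_of_real[where 'a=complex] algebra_simps)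
      also have "\<dots> = cint (?w 1) (Q 1) x R + cint (?w 2) (Q 2) x R"
        unfolding cQ deriv[OF xT] val[OF xT] by (simp add: algebra_simps)
      finally have "norm (frechet_derivative \<phi> (at x) (sgn x) - \<i> * of_real k * \<phi> x) * norm c
          = norm (cint (?w 1) (Q 1) x R + cint (?w 2) (Q 2) x R)"
        by (metis norm_mult)
      also have "\<dots> \<le> 2 * pi * (\<delta> * (1 + 4 * R) * ?p) + 2 * pi * (\<delta> * (1 + 4 * R) * ?p)"
        using Qb wle by (intro norm_triangle_le add_mono cint_bound)
      also have "\<dots> = 4 * pi * (\<delta> * (1 + 4 * R)) * ?p" by (simp add: algebra_simps)
      also have "\<dots> = \<epsilon> * ?p * norm c" unfolding d(2) by simp
      finally show "norm (frechet_derivative \<phi> (at x) (sgn x) - \<i> * of_real k * \<phi> x) \<le> \<epsilon> * ?p"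
        using \<open>c \<noteq> 0\<close> by simp
    qed
  qed
qed

section \<open>Far field patterns\<close>

lemma norm_real2: "(norm (x :: real^2))\<^sup>2 = (x $ 1)\<^sup>2 + (x $ 2)\<^sup>2"
  unfolding power2_norm_eq_inner by (simp add: inner_vec_def sum_2 power2_eq_square)

text \<open>A weak form of Jordan's inequality: for |y| \<le> 2 the cubic remainder |y|^3 / 6 is at
  most 2 |y| / 3, which leaves one third of |y|.\<close>

lemma abs_sin_ge_third:
  fixes y :: real
  assumes "\<bar>y\<bar> \<le> pi / 2"
  shows "\<bar>y\<bar> / 3 \<le> \<bar>sin y\<bar>"
proof -
  have "\<bar>sin y - (\<Sum>m<3. sin_coeff m * y ^ m)\<bar> \<le> inverse (fact 3) * \<bar>y\<bar> ^ 3"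
    by (rule Maclaurin_sin_bound)
  moreover have "(\<Sum>m<3. sin_coeff m * y ^ m) = y"
    by (simp add: numeral_3_eq_3 sin_coeff_def)
  moreover have "inverse (fact 3) = (1 / 6 :: real)"
    by (simp add: eval_nat_numeral)
  ultimately have 1: "\<bar>sin y - y\<bar> \<le> \<bar>y\<bar> ^ 3 / 6"
    by simp
  have "\<bar>y\<bar> \<le> 2" using assms pi_less_4 by linarith
  then have "\<bar>y\<bar>\<^sup>2 \<le> 2\<^sup>2" by (intro power_mono) auto
  then have "\<bar>y\<bar>\<^sup>2 \<le> 4" by simp
  from mult_right_mono[OF this, of "\<bar>y\<bar>"] have "\<bar>y\<bar> ^ 3 \<le> 4 * \<bar>y\<bar>"
    by (simp only: power3_eq_cube power2_eq_square abs_ge_zero)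
  then show ?thesis using 1 by linarith
qed

text \<open>The chord has length 2 |sin((\<alpha> - \<beta>) / 2)|. The bound turns Lipschitz
  continuity in the angle into Lipschitz continuity in the chord.\<close>

lemma circ_chord:
  assumes "\<bar>\<alpha> - \<beta>\<bar> \<le> pi"
  shows "\<bar>\<alpha> - \<beta>\<bar> \<le> 3 * norm (circ \<alpha> - circ \<beta>)"
proof -
  let ?y = "(\<alpha> - \<beta>) / 2"
  have "(norm (circ \<alpha> - circ \<beta>))\<^sup>2 = 2 - 2 * cos (2 * ?y)"
  proof -
    have "(norm (circ \<alpha> - circ \<beta>))\<^sup>2 = (cos \<alpha> - cos \<beta>)\<^sup>2 + (sin \<alpha> - sin \<beta>)\<^sup>2"
      by (simp add: norm_real2)
    also have "\<dots> = ((cos \<alpha>)\<^sup>2 + (sin \<alpha>)\<^sup>2) + ((cos \<beta>)\<^sup>2 + (sin \<beta>)\<^sup>2) - 2 * (cos \<alpha> * cos \<beta> + sin \<alpha> * sin \<beta>)"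
      by (simp add: power2_diff algebra_simps)
    also have "\<dots> = 2 - 2 * cos (\<alpha> - \<beta>)" unfolding cos_diff by simp
    also have "\<alpha> - \<beta> = 2 * ?y" by simp
    finally show ?thesis .
  qed
  also have "\<dots> = (2 * sin ?y)\<^sup>2"
    unfolding cos_double_sin by (simp add: power_mult_distrib)
  finally have "sqrt ((norm (circ \<alpha> - circ \<beta>))\<^sup>2) = sqrt ((2 * sin ?y)\<^sup>2)"
    by (rule arg_cong)
  then have "norm (circ \<alpha> - circ \<beta>) = \<bar>2 * sin ?y\<bar>"
    by (simp only: real_sqrt_abs abs_norm_cancel)
  moreover have "\<bar>?y\<bar> / 3 \<le> \<bar>sin ?y\<bar>"
    using assms by (intro abs_sin_ge_third) simp
  ultimately show ?thesis by (simp add: abs_mult)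
qed

text \<open>Distance is measured by the chord, to fit the bound of \<open>norm_sgn_diff_le\<close>
  for two values of \<open>sgn\<close>.\<close>

definition circle_lipschitz :: "real \<Rightarrow> (real^2 \<Rightarrow> complex) \<Rightarrow> bool" where
  "circle_lipschitz L f \<longleftrightarrow> (\<forall>a b. norm a = 1 \<longrightarrow> norm b = 1 \<longrightarrow> norm (f a - f b) \<le> L * norm (a - b))"

lemma analytic_on_circle_C1:
  assumes "analytic_on_circle f"
  shows "\<exists>F'. continuous_on UNIV F' \<and> (\<forall>t. ((\<lambda>t. f (circ t)) has_vector_derivative F' t) (at t))"
proof -
  let ?F = "\<lambda>t. f (circ t)"
  have loc: "\<exists>\<delta>>0. \<exists>G. isCont G t0 \<and> (\<forall>t. \<bar>t - t0\<bar> < \<delta> \<longrightarrow> (?F has_vector_derivative G t) (at t))" for t0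
  proof -
    obtain \<epsilon> c where \<epsilon>: "\<epsilon> > 0"
      and sums: "\<And>t. \<bar>t - t0\<bar> < \<epsilon> \<Longrightarrow> (\<lambda>n. c n * of_real ((t - t0) ^ n)) sums ?F t"
      using assms unfolding analytic_on_circle_def circ_def[symmetric] by blast
    \<comment> \<open>Convergence at the real point \<open>K < \<epsilon>\<close> gives convergence
      in the complex disc of radius \<open>K\<close>, where the series can be differentiated term by
      term.\<close>
    define K where "K = \<epsilon> / 2"
    have K: "0 < K" "K < \<epsilon>" using \<epsilon> by (simp_all add: K_def)
    have "summable (\<lambda>n. c n * of_real K ^ n)"
      using sums[of "t0 + K"] K by (auto simp: sums_iff)
    then have summ: "summable (\<lambda>n. c n * z ^ n)" if "norm z < K" for z
      by (rule powser_inside) (use that K in simp)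
    define g where "g z = (\<Sum>n. c n * z ^ n)" for z
    define g' where "g' z = (\<Sum>n. diffs c n * z ^ n)" for z
    have Fg: "?F t = g (of_real (t - t0))" if "\<bar>t - t0\<bar> < \<epsilon>" for t
      using sums[OF that] by (simp add: g_def sums_iff)
    have der: "(g has_field_derivative g' z) (at z)" if "norm z < K" for z
      unfolding g_def[abs_def] g'_def by (rule termdiffs_strong'[OF summ that])
    have cont: "isCont g' 0"
    proof -
      have "summable (\<lambda>n. diffs c n * (of_real (K / 2)) ^ n)"
        using summ K by (intro termdiff_converges[where K = K]) auto
      then show ?thesis
        unfolding g'_def[abs_def] by (rule isCont_powser) (use K in auto)
    qed
    have "(?F has_vector_derivative g' (of_real (t - t0))) (at t)" if t: "\<bar>t - t0\<bar> < K" for t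
    proof -
      have "((\<lambda>t. complex_of_real (t - t0)) has_vector_derivative of_real 1) (at t)"
        by (rule has_vector_derivative_of_real) (auto intro!: derivative_eq_intros)
      moreover have "norm (complex_of_real (t - t0)) < K"
        using t by (simp only: norm_of_real)
      ultimately have "(g \<circ> (\<lambda>t. complex_of_real (t - t0)) has_vector_derivative of_real 1 * g' (of_real (t - t0))) (at t)"
        by (rule field_vector_diff_chain_at[OF _ der])
      then have "((\<lambda>t. g (of_real (t - t0))) has_vector_derivative g' (of_real (t - t0))) (at t)"
        by (simp only: o_def of_real_1 mult_1_left)
      then show ?thesis
      proof (rule has_vector_derivative_transform_within_open)
        show "t \<in> ball t0 K" using t by (simp add: dist_real_def)
        show "g (of_real (s - t0)) = ?F s" if "s \<in> ball t0 K" for s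
          using that K Fg[of s] by (simp add: dist_real_def)
      qed simp
    qed
    moreover have "isCont (\<lambda>t. g' (of_real (t - t0))) t0"
    proof (rule isCont_o2[where g = g' and f = "\<lambda>t. complex_of_real (t - t0)"])
      show "isCont (\<lambda>t. complex_of_real (t - t0)) t0" by (intro continuous_intros)
    qed (use cont in simp)
    ultimately show ?thesis using K by blast
  qed
  \<comment> \<open>A global name for the local derivatives; by uniqueness it agrees near each
    \<open>t0\<close> with the sum of the differentiated series there.\<close>
  define F' where "F' t = vector_derivative ?F (at t)" for t
  have F'_eq: "F' t = G" if "(?F has_vector_derivative G) (at t)" for t G
    unfolding F'_def using that by (rule vector_derivative_at)
  have "isCont F' t0" for t0
  proof -
    obtain \<delta> G where G: "\<delta> > 0" "isCont G t0" "\<And>t. \<bar>t - t0\<bar> < \<delta> \<Longrightarrow> (?F has_vector_derivative G t) (at t)"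
      using loc by blast
    have "\<forall>\<^sub>F t in nhds t0. F' t = G t"
      using G(1,3) F'_eq by (auto simp: eventually_nhds_metric dist_real_def)
    then show ?thesis using isCont_cong G(2) by blast
  qed
  moreover have "(?F has_vector_derivative F' t) (at t)" for t
  proof -
    obtain \<delta> G where "\<delta> > 0" "\<And>s. \<bar>s - t\<bar> < \<delta> \<Longrightarrow> (?F has_vector_derivative G s) (at s)"
      using loc by blast
    then have "(?F has_vector_derivative G t) (at t)" by simp
    then show ?thesis using F'_eq by simp
  qed
  ultimately show ?thesis
    by (intro exI[of _ F']) (simp add: continuous_at_imp_continuous_on)
qed

lemma unit_circ:
  fixes a :: "real^2"
  assumes "norm a = 1"
  obtains t where "0 \<le> t" "t < 2 * pi" "a = circ t"
proof -
  have "(a $ 1)\<^sup>2 + (a $ 2)\<^sup>2 = 1" using norm_real2[of a] assms by simp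
  then obtain t where "0 \<le> t" "t < 2 * pi" "a $ 1 = cos t" "a $ 2 = sin t"
    using sincos_total_2pi by blast
  then show thesis by (intro that[of t]) (simp_all add: vec_eq_iff forall_2)
qed

lemma analytic_on_circle_lipschitz:
  assumes "analytic_on_circle f"
  obtains L where "0 \<le> L" "circle_lipschitz L f"
proof -
  obtain F' where F': "continuous_on UNIV F'"
    "\<And>t. ((\<lambda>t. f (circ t)) has_vector_derivative F' t) (at t)"
    using analytic_on_circle_C1[OF assms] by blast
  have "compact (F' ` {-4*pi..4*pi})"
    by (intro compact_continuous_image continuous_on_subset[OF F'(1)]) auto
  then obtain B where B: "\<And>t. t \<in> {-4*pi..4*pi} \<Longrightarrow> norm (F' t) \<le> B"
    using compact_imp_bounded[of "F' ` {-4*pi..4*pi}"] unfolding bounded_iff by (metis imageI)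
  have lip1: "norm (f (circ t) - f (circ s)) \<le> B * t - B * s"
    if "s < t" "s \<in> {-4*pi..4*pi}" "t \<in> {-4*pi..4*pi}" for s t
  proof (rule differentiable_bound_general[OF that(1), where f' = F' and \<phi>' = "\<lambda>_. B"])
    show "continuous_on {s..t} (\<lambda>t. f (circ t))"
      using F'(2) has_vector_derivative_continuous by (intro continuous_at_imp_continuous_on) blast
    show "((\<lambda>t. B * t) has_vector_derivative B) (at x)" for x
      unfolding has_real_derivative_iff_has_vector_derivative[symmetric]
      by (auto intro!: derivative_eq_intros)
    show "norm (F' x) \<le> B" if "s < x" "x < t" for x
      using that \<open>s \<in> _\<close> \<open>t \<in> _\<close> by (intro B) auto
  qed (use F' in \<open>auto intro!: continuous_intros\<close>)
  have lip: "norm (f (circ s) - f (circ t)) \<le> B * \<bar>s - t\<bar>"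
    if "s \<in> {-4*pi..4*pi}" "t \<in> {-4*pi..4*pi}" for s t
    using lip1[of s t] lip1[of t s] that
    by (cases s t rule: linorder_cases) (auto simp: norm_minus_commute algebra_simps)
  have B0: "0 \<le> B" using B[of 0] norm_ge_zero[of "F' 0"] by (simp del: norm_ge_zero)
  have "circle_lipschitz (3 * B) f"
    unfolding circle_lipschitz_def
  proof (intro allI impI)
    fix a b :: "real^2" assume "norm a = 1" "norm b = 1"
    then obtain s t where s: "0 \<le> s" "s < 2*pi" "a = circ s" and t: "0 \<le> t" "t < 2*pi" "b = circ t"
      by (metis unit_circ)
    \<comment> \<open>Angles in [0, 2 pi) may be far apart although the points are close. A shift of
      \<open>t\<close> by 2 pi brings them within pi, where \<open>circ_chord\<close> applies; the
      shifted angle stays in the interval on which \<open>F'\<close> is bounded by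
      \<open>B\<close>.\<close>
    obtain t' where t': "\<bar>s - t'\<bar> \<le> pi" "t' \<in> {-4*pi..4*pi}" "b = circ t'"
    proof -
      have per: "circ (t + 2*pi) = circ t" "circ (t - 2*pi) = circ t"
        by (simp_all add: circ_def cos_diff sin_diff)
      consider "\<bar>s - t\<bar> \<le> pi" | "s - t > pi" | "t - s > pi" by linarith
      then show thesis
      proof cases
        case 1 then show ?thesis using that[of t] t by auto
      next
        case 2 then show ?thesis using that[of "t + 2*pi"] t s per by auto
      next
        case 3 then show ?thesis using that[of "t - 2*pi"] t s per by auto
      qed
    qed
    have "norm (f a - f b) \<le> B * \<bar>s - t'\<bar>"
      using lip[of s t'] s t' by simp
    also have "\<dots> \<le> B * (3 * norm (a - b))"
      using circ_chord[OF t'(1)] s t' B0 by (intro mult_left_mono) auto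
    finally show "norm (f a - f b) \<le> 3 * B * norm (a - b)" by simp
  qed
  then show thesis using that[of "3 * B"] B0 by simp
qed

lemma circle_lipschitz_bounded:
  assumes "circle_lipschitz L f" "0 \<le> L"
  obtains M where "0 \<le> M" "\<And>a. norm a = 1 \<Longrightarrow> norm (f a) \<le> M"
proof
  show "0 \<le> norm (f (circ 0)) + L * 2" using assms(2) by simp
  show "norm (f a) \<le> norm (f (circ 0)) + L * 2" if "norm a = 1" for a
  proof -
    have "norm (f a - f (circ 0)) \<le> L * norm (a - circ 0)"
      using assms(1) that unfolding circle_lipschitz_def by simp
    also have "\<dots> \<le> L * 2"
      using norm_triangle_ineq4[of a "circ 0"] that assms(2) by (intro mult_left_mono) auto
    finally show ?thesis using norm_triangle_sub[of "f a" "f (circ 0)"] by linarith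
  qed
qed

lemma circle_lipschitz_component:
  assumes "circle_lipschitz L f" "0 \<le> L"
  obtains L' where "0 \<le> L'" "circle_lipschitz L' (\<lambda>d. f d * of_real (d $ i))"
proof -
  obtain M where M: "0 \<le> M" "\<And>a. norm a = 1 \<Longrightarrow> norm (f a) \<le> M"
    using circle_lipschitz_bounded[OF assms] by blast
  have "circle_lipschitz (L + M) (\<lambda>d. f d * of_real (d $ i))"
    unfolding circle_lipschitz_def
  proof (intro allI impI)
    fix a b :: "real^2" assume ab: "norm a = 1" "norm b = 1"
    have "f a * of_real (a $ i) - f b * of_real (b $ i)
        = (f a - f b) * of_real (a $ i) + f b * of_real ((a - b) $ i)"
      by (simp add: algebra_simps)
    also have "norm \<dots> \<le> norm (f a - f b) * \<bar>a $ i\<bar> + norm (f b) * \<bar>(a - b) $ i\<bar>"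
      by (rule order_trans[OF norm_triangle_ineq]) (simp only: norm_mult norm_of_real)
    also have "\<dots> \<le> L * norm (a - b) * 1 + M * norm (a - b)"
      using component_le_norm_cart[of a i] component_le_norm_cart[of "a - b" i] M(1) M(2)[OF ab(2)] ab assms
      unfolding circle_lipschitz_def by (intro add_mono mult_mono) auto
    finally show "norm (f a * of_real (a $ i) - f b * of_real (b $ i)) \<le> (L + M) * norm (a - b)"
      by (simp add: algebra_simps)
  qed
  then show thesis using that[of "L + M"] M assms by simp
qed

section \<open>Expansion of an outgoing wave on a circle of fixed radius\<close>

definition outgoing_factor :: "real \<Rightarrow> real^2 \<Rightarrow> complex" where
  "outgoing_factor k x = exp (\<i> * of_real (k * norm x)) / of_real (sqrt (norm x))"

text \<open>The squares of the two quantities differ by R^2 (1 - a^2), where a is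
  \<open>sgn x \<bullet> n\<close>, while their sum is at least \<open>norm x\<close>.\<close>

lemma norm_circle_expansion:
  fixes x n :: "'a::real_inner"
  assumes "norm n = 1" "0 \<le> R" "2 * R \<le> norm x" "x \<noteq> 0"
  shows "\<bar>norm (x + R *\<^sub>R n) - (norm x + R * (sgn x \<bullet> n))\<bar> \<le> R\<^sup>2 / norm x"
proof -
  let ?y = "norm (x + R *\<^sub>R n)" and ?a = "sgn x \<bullet> n"
  have nx: "norm x > 0" using assms by simp
  have a: "\<bar>?a\<bar> \<le> 1"
    using Cauchy_Schwarz_ineq2[of "sgn x" n] assms nx by (simp add: norm_sgn)
  have xn: "x \<bullet> n = norm x * ?a"
    using nx by (simp add: sgn_div_norm)
  have aR: "\<bar>R * ?a\<bar> \<le> R"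
    using mult_left_mono[OF a assms(2)] assms(2) by (simp add: abs_mult)
  then have pos: "0 \<le> norm x + R * ?a"
    using assms by linarith
  have sq: "?y\<^sup>2 = (norm x)\<^sup>2 + 2 * R * (x \<bullet> n) + R\<^sup>2"
    using assms(1) unfolding power2_norm_eq_inner norm_eq_1
    by (simp add: inner_add_left inner_add_right inner_commute[of n x] power2_eq_square algebra_simps)
  have "(?y - (norm x + R * ?a)) * (?y + (norm x + R * ?a)) = ?y\<^sup>2 - (norm x + R * ?a)\<^sup>2"
    by (simp add: power2_eq_square algebra_simps)
  also have "\<dots> = R\<^sup>2 * (1 - ?a\<^sup>2)"
    unfolding sq xn by (simp add: power2_eq_square algebra_simps)
  finally have *: "(?y - (norm x + R * ?a)) * (?y + (norm x + R * ?a)) = R\<^sup>2 * (1 - ?a\<^sup>2)" .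
  have e: "\<bar>?y - (norm x + R * ?a)\<bar> * (?y + (norm x + R * ?a)) = R\<^sup>2 * (1 - ?a\<^sup>2)"
  proof -
    have "?a\<^sup>2 \<le> 1" using a by (simp add: abs_square_le_1)
    then have "0 \<le> R\<^sup>2 * (1 - ?a\<^sup>2)" by simp
    then have "R\<^sup>2 * (1 - ?a\<^sup>2) = \<bar>(?y - (norm x + R * ?a)) * (?y + (norm x + R * ?a))\<bar>"
      using * by simp
    then show ?thesis using pos by (simp add: abs_mult)
  qed
  have ny: "norm x \<le> ?y + (norm x + R * ?a)"
    using norm_triangle_ineq[of "x + R *\<^sub>R n" "- (R *\<^sub>R n)"] aR assms by simp
  have "\<bar>?y - (norm x + R * ?a)\<bar> * norm x \<le> R\<^sup>2 * (1 - ?a\<^sup>2)"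
    unfolding e[symmetric] by (intro mult_left_mono ny) simp
  also have "\<dots> \<le> R\<^sup>2" by (simp add: mult_left_le)
  finally show ?thesis using nx by (simp add: pos_le_divide_eq)
qed

lemma norm_exp_ii [simp]: "norm (exp (\<i> * complex_of_real a)) = 1"
  by (simp add: norm_exp_eq_Re)

lemma norm_exp_ii_diff: "norm (exp (\<i> * complex_of_real a) - exp (\<i> * complex_of_real b)) \<le> \<bar>a - b\<bar>"
proof -
  have "exp (\<i> * complex_of_real a) - exp (\<i> * complex_of_real b)
      = exp (\<i> * complex_of_real b) * (exp (\<i> * complex_of_real (a - b)) - 1)"
    by (simp add: algebra_simps flip: exp_add)
  then have "norm (exp (\<i> * complex_of_real a) - exp (\<i> * complex_of_real b)) = 2 * \<bar>sin ((a - b) / 2)\<bar>"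
    by (simp only: norm_mult norm_exp_ii mult_1_left dist_exp_i_1)
  then show ?thesis
    using abs_sin_x_le_abs_x[of "(a - b) / 2"] by simp
qed

lemma norm_outgoing_factor: "norm (outgoing_factor k x) = 1 / sqrt (norm x)"
  by (simp add: outgoing_factor_def norm_divide)

text \<open>Over the circle the amplitude changes by the relative order R / |x|, and the linear
  phase misses the true one by at most k R^2 / |x|. With the amplitude |x|^(-1/2) both errors have
  order |x|^(-3/2).\<close>

lemma outgoing_factor_expansion:
  assumes "0 \<le> R" "2 * R \<le> norm x" "x \<noteq> 0" "0 \<le> k"
  shows "norm (outgoing_factor k (x + R *\<^sub>R circ t) - outgoing_factor k x * plane_wave k (sgn x) (R *\<^sub>R circ t))
     \<le> (2 * R + k * R\<^sup>2) / (norm x * sqrt (norm x))"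
proof -
  let ?y = "x + R *\<^sub>R circ t"
  define p q where "p = norm x" and "q = norm ?y"
  define E where "E = exp (\<i> * of_real (k * q))"
  define E' where "E' = exp (\<i> * of_real (k * (p + R * (sgn x \<bullet> circ t))))"
  have p: "p > 0" "2 * R \<le> p" using assms by (simp_all add: p_def)
  have "\<bar>q - p\<bar> \<le> R"
    using norm_triangle_ineq3[of ?y x] assms(1) by (simp add: p_def q_def)
  then have q: "p \<le> 2 * q" "q > 0" "\<bar>q - p\<bar> \<le> R" using p by linarith+
  have "outgoing_factor k ?y - outgoing_factor k x * plane_wave k (sgn x) (R *\<^sub>R circ t)
      = E / of_real (sqrt q) - E' / of_real (sqrt p)"
    by (simp add: outgoing_factor_def plane_wave_def E_def E'_def p_def q_def exp_add[symmetric] algebra_simps)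
  also have "\<dots> = E * of_real (1 / sqrt q - 1 / sqrt p) + (E - E') / of_real (sqrt p)"
    by (simp add: algebra_simps diff_divide_distrib)
  also have "norm \<dots> \<le> \<bar>1 / sqrt q - 1 / sqrt p\<bar> + norm (E - E') / sqrt p"
    using p by (intro order_trans[OF norm_triangle_ineq]) (simp add: norm_mult norm_divide E_def del: of_real_diff of_real_divide)
  also have "\<dots> \<le> 2 * R / (p * sqrt p) + k * R\<^sup>2 / (p * sqrt p)"
  proof (rule add_mono)
    have sq: "sqrt p > 0" "sqrt q > 0" "sqrt p * sqrt p = p" "sqrt q * sqrt q = q" using p q by auto
    have "(sqrt p - sqrt q) * (sqrt p + sqrt q) = p - q"
      using sq by (simp add: algebra_simps)
    then have "\<bar>sqrt p - sqrt q\<bar> * (sqrt p + sqrt q) = \<bar>p - q\<bar>"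
      using sq by (metis abs_mult abs_of_pos add_pos_pos)
    moreover have "\<bar>sqrt p - sqrt q\<bar> * sqrt p \<le> \<bar>sqrt p - sqrt q\<bar> * (sqrt p + sqrt q)"
      using sq by (intro mult_left_mono) auto
    ultimately have 1: "\<bar>sqrt p - sqrt q\<bar> * sqrt p \<le> R" using q by linarith
    have 2: "sqrt p \<le> 2 * sqrt q"
    proof -
      have "sqrt p \<le> sqrt (4 * q)" using q by simp
      then show ?thesis by (simp add: real_sqrt_mult)
    qed
    have "\<bar>1 / sqrt q - 1 / sqrt p\<bar> * (p * sqrt p) = \<bar>sqrt p - sqrt q\<bar> * sqrt p * (sqrt p / sqrt q)"
    proof -
      have "1 / sqrt q - 1 / sqrt p = (sqrt p - sqrt q) / (sqrt p * sqrt q)"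
        using sq by (simp add: field_simps)
      then have "\<bar>1 / sqrt q - 1 / sqrt p\<bar> = \<bar>sqrt p - sqrt q\<bar> / (sqrt p * sqrt q)"
        using sq by (simp add: abs_divide abs_mult)
      moreover have "p * sqrt p = sqrt p * sqrt p * sqrt p" using sq by simp
      ultimately show ?thesis using sq(1,2) by (simp del: real_sqrt_mult_self)
    qed
    also have "\<dots> \<le> R * 2"
      using 1 2 sq(1,2) assms(1) by (intro mult_mono) (auto simp: divide_le_eq)
    finally show "\<bar>1 / sqrt q - 1 / sqrt p\<bar> \<le> 2 * R / (p * sqrt p)"
      using p by (simp add: pos_le_divide_eq)
    have "norm (E - E') \<le> \<bar>k * q - k * (p + R * (sgn x \<bullet> circ t))\<bar>"
      unfolding E_def E'_def by (rule norm_exp_ii_diff)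
    also have "\<dots> = k * \<bar>q - (p + R * (sgn x \<bullet> circ t))\<bar>"
      using assms(4) by (simp add: abs_mult flip: right_diff_distrib)
    also have "\<dots> \<le> k * (R\<^sup>2 / p)"
      unfolding p_def q_def using assms by (intro mult_left_mono norm_circle_expansion) auto
    finally have "norm (E - E') / sqrt p \<le> k * (R\<^sup>2 / p) / sqrt p"
      using p by (intro divide_right_mono) auto
    then show "norm (E - E') / sqrt p \<le> k * R\<^sup>2 / (p * sqrt p)" by simp
  qed
  also have "\<dots> = (2 * R + k * R\<^sup>2) / (p * sqrt p)" by (simp add: add_divide_distrib)
  finally show ?thesis by (simp add: p_def)
qed

text \<open>The pattern \<open>F\<close> may be frozen in the direction of the centre: by the
  Lipschitz bound it varies by O(1/|x|) over the circle, an error of the same order as that of the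
  outgoing factor.\<close>

lemma outgoing_wave_local:
  assumes "0 \<le> R" "0 \<le> k" "circle_lipschitz L F" "0 \<le> L"
  obtains C where "0 \<le> C" "\<And>x t. 2 * R \<le> norm x \<Longrightarrow> x \<noteq> 0 \<Longrightarrow>
     norm (outgoing_factor k (x + R *\<^sub>R circ t) * F (sgn (x + R *\<^sub>R circ t))
       - outgoing_factor k x * F (sgn x) * plane_wave k (sgn x) (R *\<^sub>R circ t)) \<le> C / (norm x * sqrt (norm x))"
proof -
  obtain M where M: "0 \<le> M" "\<And>a. norm a = 1 \<Longrightarrow> norm (F a) \<le> M"
    using circle_lipschitz_bounded[OF assms(3,4)] by blast
  define C where "C = (2 * R + k * R\<^sup>2) * M + L * (2 * R)"
  show thesis
  proof (rule that)
    show "0 \<le> C" unfolding C_def using assms M by simp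
    fix x :: "real^2" and t assume x: "2 * R \<le> norm x" "x \<noteq> 0"
    let ?y = "x + R *\<^sub>R circ t" and ?w = "plane_wave k (sgn x) (R *\<^sub>R circ t)"
    let ?q = "norm x * sqrt (norm x)"
    have q: "0 < ?q" using x by simp
    have "norm ?y > 0"
    proof -
      have "R < norm x" using x assms(1) zero_less_norm_iff[of x] by linarith
      moreover have "norm x \<le> norm ?y + R"
        using norm_triangle_ineq[of ?y "- (R *\<^sub>R circ t)"] assms(1) by simp
      ultimately show ?thesis by linarith
    qed
    then have u: "norm (sgn x) = 1" "norm (sgn ?y) = 1" using x by (simp_all add: norm_sgn)
    have nw: "norm ?w = 1" unfolding plane_wave_def by (rule norm_exp_ii)
    have "outgoing_factor k ?y * F (sgn ?y) - outgoing_factor k x * F (sgn x) * ?w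
       = (outgoing_factor k ?y - outgoing_factor k x * ?w) * F (sgn ?y)
         + outgoing_factor k x * ?w * (F (sgn ?y) - F (sgn x))"
      by (simp add: algebra_simps)
    also have "norm \<dots> \<le> norm (outgoing_factor k ?y - outgoing_factor k x * ?w) * norm (F (sgn ?y))
         + 1 / sqrt (norm x) * norm (F (sgn ?y) - F (sgn x))"
      by (rule order_trans[OF norm_triangle_ineq]) (simp add: norm_mult nw norm_outgoing_factor)
    also have "\<dots> \<le> (2 * R + k * R\<^sup>2) / ?q * M + 1 / sqrt (norm x) * (L * (2 * R / norm x))"
    proof (intro add_mono mult_mono)
      show "norm (outgoing_factor k ?y - outgoing_factor k x * ?w) \<le> (2 * R + k * R\<^sup>2) / ?q"
        by (rule outgoing_factor_expansion[OF assms(1) x assms(2)])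
      have "norm (F (sgn ?y) - F (sgn x)) \<le> L * norm (sgn x - sgn ?y)"
        using assms(3) u unfolding circle_lipschitz_def by (metis norm_minus_commute)
      also have "\<dots> \<le> L * (2 * R / norm x)"
        using norm_sgn_diff_le[OF x(2), of ?y] assms by (intro mult_left_mono) simp_all
      finally show "norm (F (sgn ?y) - F (sgn x)) \<le> L * (2 * R / norm x)" .
    qed (use assms M u x in auto)
    also have "\<dots> = C / ?q"
    proof -
      have "1 / sqrt (norm x) * (L * (2 * R / norm x)) = L * (2 * R) / ?q"
        by (simp add: mult.commute)
      moreover have "(2 * R + k * R\<^sup>2) / ?q * M = (2 * R + k * R\<^sup>2) * M / ?q"
        by simp
      ultimately show ?thesis
        by (simp only: C_def add_divide_distrib[of "(2 * R + k * R\<^sup>2) * M"])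
    qed
    finally show "norm (outgoing_factor k ?y * F (sgn ?y) - outgoing_factor k x * F (sgn x) * ?w) \<le> C / ?q" .
  qed
qed

lemma powr_minus_three_halves: "0 < n \<Longrightarrow> n powr - (3/2) = 1 / (n * sqrt n)"
proof -
  assume "0 < n"
  then have "n powr (3/2) = n powr 1 * n powr (1/2)"
    unfolding powr_add[symmetric] by simp
  then show ?thesis
    using \<open>0 < n\<close> powr_minus_divide[of n "3/2"] by (simp add: powr_half_sqrt)
qed

text \<open>Here the factor 1/(ik) of the theorem arises: the longitudinal wave a d exp(i k d.y) is
  the gradient of a/(ik) times the plane wave. The flux identity replaces any integration; it yields
  the same constant for every direction \<open>d\<close>, and the transverse wave disappears into
  the potential \<open>\<psi>\<close>.\<close>

lemma flux_plane_waves: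
  assumes "norm d = 1" "0 < k" "0 < l" "0 < R" "k * R < 2"
  shows "flux (\<lambda>y. a * of_real (d $ 1) * plane_wave k d y - b * of_real (d $ 2) * plane_wave l d y)
      (\<lambda>y. a * of_real (d $ 2) * plane_wave k d y + b * of_real (d $ 1) * plane_wave l d y) 0 R
    = a / (\<i> * of_real k) * flux_const k R"
proof -
  let ?v1 = "\<lambda>y. a * of_real (d $ 1) * plane_wave k d y - b * of_real (d $ 2) * plane_wave l d y"
  let ?v2 = "\<lambda>y. a * of_real (d $ 2) * plane_wave k d y + b * of_real (d $ 1) * plane_wave l d y"
  have diff: "(\<lambda>y. c * plane_wave m d y) differentiable (at x)" for c m x
    unfolding differentiable_def by (intro exI, rule plane_wave_has_derivative)
  have d2: "complex_of_real (d $ 2) * of_real (d $ 2) = 1 - of_real (d $ 1) * of_real (d $ 1)"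
    using norm_real2[of d] assms(1) by (simp add: power2_eq_square eq_diff_eq flip: of_real_mult of_real_add)
  have "flux_field k UNIV ?v1 ?v2 (\<lambda>y. a / (\<i> * of_real k) * plane_wave k d y) (\<lambda>y. b / (\<i> * of_real l) * plane_wave l d y)"
    unfolding flux_field_def
  proof (intro conjI ballI)
    show "Ck 1 ?v1 UNIV" "Ck 1 ?v2 UNIV" 
      by (intro Ck_diff Ck_add Ck_plane_wave open_UNIV)+
    show "Ck 1 (\<lambda>y. a / (\<i> * of_real k) * plane_wave k d y) UNIV" "Ck 1 (\<lambda>y. b / (\<i> * of_real l) * plane_wave l d y) UNIV"
      by (rule Ck_plane_wave)+
    fix x
    show "?v1 x = partial 1 (\<lambda>y. a / (\<i> * of_real k) * plane_wave k d y) x - partial 2 (\<lambda>y. b / (\<i> * of_real l) * plane_wave l d y) x"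
      "?v2 x = partial 2 (\<lambda>y. a / (\<i> * of_real k) * plane_wave k d y) x + partial 1 (\<lambda>y. b / (\<i> * of_real l) * plane_wave l d y) x"
      unfolding partial_plane_wave using assms(2,3) by simp_all
    have p: "partial 1 ?v1 x + partial 2 ?v2 x = a * \<i> * of_real k * plane_wave k d x * (of_real (d $ 1) * of_real (d $ 1) + of_real (d $ 2) * of_real (d $ 2))"
      unfolding partial_diff[OF diff diff] partial_add[OF diff diff] partial_plane_wave by (simp add: algebra_simps)
    show "partial 1 ?v1 x + partial 2 ?v2 x = - (of_real k)\<^sup>2 * (a / (\<i> * of_real k) * plane_wave k d x)"
      unfolding p d2 using assms(2) by (simp add: power2_eq_square field_simps)
  qed
  from flux_eq[OF this _ assms(2,4,5), of 0] show ?thesis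
    by (simp add: plane_wave_def)
qed

text \<open>On the circle around \<open>x\<close> the field is a sum of plane waves in direction
  \<open>sgn x\<close>, up to O(|x|^(-3/2)). Comparing the two fluxes at fixed radius and dividing
  by \<open>c\<close> keeps the order of the error.\<close>

lemma flux_field_far_field:
  fixes f g :: "real^2 \<Rightarrow> complex"
  assumes S: "\<And>x. r0 < norm x \<Longrightarrow> x \<in> S" and ff: "flux_field k S u1 u2 \<phi> \<psi>" and kl: "0 < k" "0 < l"
    and f: "circle_lipschitz L f" "0 \<le> L" and g: "circle_lipschitz L' g" "0 \<le> L'"
    and u1: "\<And>x. b \<le> norm x \<Longrightarrow> norm (u1 x - (outgoing_factor k x * f (sgn x) * of_real (sgn x $ 1)
         - outgoing_factor l x * g (sgn x) * of_real (sgn x $ 2))) \<le> K * norm x powr (-3/2)"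
    and u2: "\<And>x. b \<le> norm x \<Longrightarrow> norm (u2 x - (outgoing_factor k x * f (sgn x) * of_real (sgn x $ 2)
         + outgoing_factor l x * g (sgn x) * of_real (sgn x $ 1))) \<le> K * norm x powr (-3/2)"
    and "0 \<le> K"
  shows "\<exists>C b. \<forall>x. b \<le> norm x \<longrightarrow>
     norm (\<phi> x - outgoing_factor k x * (f (sgn x) / (\<i> * of_real k))) \<le> C * norm x powr (-3/2)"
proof -
  define R where "R = 1 / k"
  have R: "0 < R" "k * R < 2" using \<open>0 < k\<close> by (simp_all add: R_def)
  note R0 = less_imp_le[OF R(1)]
  define c where "c = flux_const k R"
  have "c \<noteq> 0" unfolding c_def by (rule flux_const_nonzero[OF \<open>0 < k\<close> R])
  have loc: "\<exists>C. 0 \<le> C \<and> (\<forall>x t. 2 * R \<le> norm x \<longrightarrow> x \<noteq> 0 \<longrightarrow>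
     norm (outgoing_factor m (x + R *\<^sub>R circ t) * (F (sgn (x + R *\<^sub>R circ t)) * of_real (sgn (x + R *\<^sub>R circ t) $ i))
       - outgoing_factor m x * (F (sgn x) * of_real (sgn x $ i)) * plane_wave m (sgn x) (R *\<^sub>R circ t)) \<le> C * norm x powr (-3/2))"
    if "circle_lipschitz \<Lambda> F" "0 \<le> \<Lambda>" "0 < m" for \<Lambda> F m i
  proof -
    note F = that
    obtain M where M: "0 \<le> M" "circle_lipschitz M (\<lambda>d. F d * of_real (d $ i))"
      using circle_lipschitz_component[OF F(1,2)] by blast
    show ?thesis
      by (rule outgoing_wave_local[OF R0 less_imp_le[OF F(3)] M(2,1)]) (auto simp: powr_minus_three_halves)
  qed
  have "\<forall>i. \<exists>C. 0 \<le> C \<and> (\<forall>x t. 2 * R \<le> norm x \<longrightarrow> x \<noteq> 0 \<longrightarrow>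
     norm (outgoing_factor k (x + R *\<^sub>R circ t) * (f (sgn (x + R *\<^sub>R circ t)) * of_real (sgn (x + R *\<^sub>R circ t) $ i))
       - outgoing_factor k x * (f (sgn x) * of_real (sgn x $ i)) * plane_wave k (sgn x) (R *\<^sub>R circ t)) \<le> C * norm x powr (-3/2))"
    using loc[OF f kl(1)] by blast
  then obtain Cf where Cf: "\<And>i. 0 \<le> Cf i" "\<And>i x t. 2 * R \<le> norm x \<Longrightarrow> x \<noteq> 0 \<Longrightarrow>
     norm (outgoing_factor k (x + R *\<^sub>R circ t) * (f (sgn (x + R *\<^sub>R circ t)) * of_real (sgn (x + R *\<^sub>R circ t) $ i))
       - outgoing_factor k x * (f (sgn x) * of_real (sgn x $ i)) * plane_wave k (sgn x) (R *\<^sub>R circ t)) \<le> Cf i * norm x powr (-3/2)"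
    by metis
  have "\<forall>i. \<exists>C. 0 \<le> C \<and> (\<forall>x t. 2 * R \<le> norm x \<longrightarrow> x \<noteq> 0 \<longrightarrow>
     norm (outgoing_factor l (x + R *\<^sub>R circ t) * (g (sgn (x + R *\<^sub>R circ t)) * of_real (sgn (x + R *\<^sub>R circ t) $ i))
       - outgoing_factor l x * (g (sgn x) * of_real (sgn x $ i)) * plane_wave l (sgn x) (R *\<^sub>R circ t)) \<le> C * norm x powr (-3/2))"
    using loc[OF g kl(2)] by blast
  then obtain Cg where Cg: "\<And>i. 0 \<le> Cg i" "\<And>i x t. 2 * R \<le> norm x \<Longrightarrow> x \<noteq> 0 \<Longrightarrow>
     norm (outgoing_factor l (x + R *\<^sub>R circ t) * (g (sgn (x + R *\<^sub>R circ t)) * of_real (sgn (x + R *\<^sub>R circ t) $ i))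
       - outgoing_factor l x * (g (sgn x) * of_real (sgn x $ i)) * plane_wave l (sgn x) (R *\<^sub>R circ t)) \<le> Cg i * norm x powr (-3/2)"
    by metis
  \<comment> \<open>The factor \<open>2 powr (3/2)\<close> pays for evaluating the remainder on the
    circle instead of at \<open>x\<close>. Each component of the field uses one constant from
    \<open>Cf\<close> and one from \<open>Cg\<close>; the sum serves both.\<close>
  define M where "M = K * 2 powr (3/2) + Cf 1 + Cf 2 + Cg 1 + Cg 2"
  define C where "C = 4 * pi * M / norm c"
  show ?thesis
  proof (intro exI allI impI)
    \<comment> \<open>Far enough for the circle to lie where \<open>u1\<close> and \<open>u2\<close>
      are estimated, for its disc to lie in \<open>S\<close>, and for the expansion with
      \<open>2 * R \<le> norm x\<close>.\<close>
    fix x :: "real^2" assume x: "\<bar>b\<bar> + \<bar>r0\<bar> + 2 * R \<le> norm x"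
    have x2: "2 * R \<le> norm x" "x \<noteq> 0" using x R by auto
    let ?d = "sgn x" and ?p = "norm x powr (-3/2)" and ?y = "\<lambda>t. x + R *\<^sub>R circ t"
    have d: "norm ?d = 1" using x2 by (simp add: norm_sgn)
    have sub: "cball x R \<subseteq> S"
    proof
      fix y assume "y \<in> cball x R"
      then have "norm (x - y) \<le> R" by (simp add: dist_norm)
      then show "y \<in> S"
        using x R norm_triangle_ineq2[of x y] by (intro S) linarith
    qed
    have yb: "b \<le> norm (?y t)" for t
    proof -
      have "norm x \<le> norm (?y t) + R"
        using norm_triangle_ineq[of "?y t" "- (R *\<^sub>R circ t)"] R0 by simp
      then show ?thesis using x R by linarith
    qed
    have rem: "K * norm (?y t) powr (-3/2) \<le> K * 2 powr (3/2) * ?p" for t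
      using mult_left_mono[OF norm_circle_powr[OF R0 x2, of t "-3/2"] \<open>0 \<le> K\<close>] by (simp add: mult.assoc)
    define a where "a = outgoing_factor k x * f ?d"
    define b' where "b' = outgoing_factor l x * g ?d"
    define v1 where "v1 y = a * of_real (?d $ 1) * plane_wave k ?d y - b' * of_real (?d $ 2) * plane_wave l ?d y" for y
    define v2 where "v2 y = a * of_real (?d $ 2) * plane_wave k ?d y + b' * of_real (?d $ 1) * plane_wave l ?d y" for y
    have bound: "norm (z - (P - Q)) \<le> B1 + B2 + B3"
      if "norm (z - (P' - Q')) \<le> B1" "norm (P' - P) \<le> B2" "norm (Q' - Q) \<le> B3" for z P Q P' Q' :: complex and B1 B2 B3
    proof -
      have "z - (P - Q) = (z - (P' - Q')) + (P' - P) - (Q' - Q)" by simp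
      also have "norm \<dots> \<le> B1 + B2 + B3"
        using that norm_triangle_ineq4[of "(z - (P' - Q')) + (P' - P)" "Q' - Q"]
          norm_triangle_ineq[of "z - (P' - Q')" "P' - P"] by linarith
      finally show ?thesis .
    qed
    have b1: "norm (u1 (?y t) - v1 (R *\<^sub>R circ t)) \<le> M * ?p" for t
    proof -
      have "norm (u1 (?y t) - (a * of_real (?d $ 1) * plane_wave k ?d (R *\<^sub>R circ t) - b' * of_real (?d $ 2) * plane_wave l ?d (R *\<^sub>R circ t)))
         \<le> K * 2 powr (3/2) * ?p + Cf 1 * ?p + Cg 2 * ?p"
      proof (rule bound)
        show "norm (u1 (?y t) - (outgoing_factor k (?y t) * f (sgn (?y t)) * of_real (sgn (?y t) $ 1)
          - outgoing_factor l (?y t) * g (sgn (?y t)) * of_real (sgn (?y t) $ 2))) \<le> K * 2 powr (3/2) * ?p"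
          using u1[OF yb, of t] rem[of t] by (rule order_trans)
      qed (use Cf(2)[OF x2, of t 1] Cg(2)[OF x2, of t 2] in \<open>simp_all add: a_def b'_def mult.assoc\<close>)
      also have "\<dots> \<le> M * ?p"
        using mult_nonneg_nonneg[OF Cf(1), of ?p 2] mult_nonneg_nonneg[OF Cg(1), of ?p 1] by (simp add: M_def algebra_simps)
      finally show ?thesis by (simp add: v1_def)
    qed
    have b2: "norm (u2 (?y t) - v2 (R *\<^sub>R circ t)) \<le> M * ?p" for t
    proof -
      \<comment> \<open>The double minus fits the sum into the difference form of
        \<open>bound\<close>.\<close>
      have "norm (u2 (?y t) - (a * of_real (?d $ 2) * plane_wave k ?d (R *\<^sub>R circ t) - - (b' * of_real (?d $ 1) * plane_wave l ?d (R *\<^sub>R circ t))))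
         \<le> K * 2 powr (3/2) * ?p + Cf 2 * ?p + Cg 1 * ?p"
      proof (rule bound)
        show "norm (u2 (?y t) - (outgoing_factor k (?y t) * f (sgn (?y t)) * of_real (sgn (?y t) $ 2)
          - - (outgoing_factor l (?y t) * g (sgn (?y t)) * of_real (sgn (?y t) $ 1)))) \<le> K * 2 powr (3/2) * ?p"
          using order_trans[OF u2[OF yb, of t] rem[of t]] by simp
      qed (use Cf(2)[OF x2, of t 2] Cg(2)[OF x2, of t 1] in \<open>simp_all add: a_def b'_def mult.assoc norm_minus_commute\<close>)
      also have "\<dots> \<le> M * ?p"
        using mult_nonneg_nonneg[OF Cf(1), of ?p 1] mult_nonneg_nonneg[OF Cg(1), of ?p 2] by (simp add: M_def algebra_simps)
      finally show ?thesis by (simp add: v2_def)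
    qed
    have C1: "Ck 1 u1 S" "Ck 1 u2 S" using ff by (auto simp: flux_field_def)
    have vcont: "continuous_on UNIV v1" "continuous_on UNIV v2"
      unfolding v1_def[abs_def] v2_def[abs_def]
      by (intro continuous_intros Ck_continuous_on[OF Ck_plane_wave[of 0]])+
    have cs: "continuous_on UNIV (\<lambda>t. complex_of_real (cos t))" "continuous_on UNIV (\<lambda>t. complex_of_real (sin t))"
      by (intro continuous_intros)+
    have "norm (flux u1 u2 x R - flux v1 v2 0 R) \<le> 2 * pi * (M * ?p) + 2 * pi * (M * ?p)"
    proof -
      have "norm (cint (\<lambda>t. of_real (cos t)) u1 x R - cint (\<lambda>t. of_real (cos t)) v1 0 R) \<le> 2 * pi * (M * ?p)"
        by (intro cint_diff_bound b1 circle_integrable[OF Ck_continuous_on[OF C1(1)] cs(1) sub R0]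
           circle_integrable[OF vcont(1) cs(1) _ R0]) auto
      moreover have "norm (cint (\<lambda>t. of_real (sin t)) u2 x R - cint (\<lambda>t. of_real (sin t)) v2 0 R) \<le> 2 * pi * (M * ?p)"
        by (intro cint_diff_bound b2 circle_integrable[OF Ck_continuous_on[OF C1(2)] cs(2) sub R0]
           circle_integrable[OF vcont(2) cs(2) _ R0]) auto
      ultimately show ?thesis
        unfolding flux_def add_diff_add by (rule norm_add_rule_thm)
    qed
    moreover have fu: "flux u1 u2 x R = \<phi> x * c"
      unfolding c_def by (rule flux_eq[OF ff sub \<open>0 < k\<close> R])
    moreover have fv: "flux v1 v2 0 R = a / (\<i> * of_real k) * c"
      unfolding c_def v1_def[abs_def] v2_def[abs_def] by (rule flux_plane_waves[OF d kl R])
    ultimately have "norm ((\<phi> x - a / (\<i> * of_real k)) * c) \<le> 4 * pi * M * ?p"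
      unfolding left_diff_distrib fu fv by linarith
    then have "norm (\<phi> x - a / (\<i> * of_real k)) * norm c \<le> C * ?p * norm c"
      using \<open>c \<noteq> 0\<close> by (simp add: norm_mult C_def)
    then show "norm (\<phi> x - outgoing_factor k x * (f ?d / (\<i> * of_real k))) \<le> C * ?p"
      using \<open>c \<noteq> 0\<close> by (simp add: a_def)
  qed
qed

section \<open>Existence criterion and uniqueness for Helmholtz far field patterns\<close>

lemma helmholtz_far_fieldI:
  assumes "\<exists>C b. \<forall>x. b \<le> norm x \<longrightarrow> norm (w x - outgoing_factor k x * W (sgn x)) \<le> C * norm x powr (-3/2)"
  shows "helmholtz_far_field k w W"
  unfolding helmholtz_far_field_def outgoing_factor_def[symmetric]
proof (intro exI conjI)
  obtain C b where Cb: "\<And>x. b \<le> norm x \<Longrightarrow> norm (w x - outgoing_factor k x * W (sgn x)) \<le> C * norm x powr (-3/2)"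
    using assms by blast
  \<comment> \<open>The definition of the pattern fixes the remainder. Division by the outgoing
    factor costs \<open>sqrt (norm x)\<close>, turning |x|^(-3/2) into 1/|x|.\<close>
  let ?\<rho> = "\<lambda>x. w x / outgoing_factor k x - W (sgn x)"
  have nz: "outgoing_factor k x \<noteq> 0" if "x \<noteq> 0" for x
    using that by (simp add: outgoing_factor_def)
  show "?\<rho> \<in> O[at_infinity](\<lambda>x. of_real (1 / norm x))"
  proof (rule bigoI)
    show "\<forall>\<^sub>F x in at_infinity. norm (?\<rho> x) \<le> C * norm (complex_of_real (1 / norm x))"
      unfolding eventually_at_infinity
    proof (intro exI allI impI)
      fix x :: "real^2" assume x: "max 1 b \<le> norm x"
      then have x0: "x \<noteq> 0" by auto
      have "?\<rho> x = (w x - outgoing_factor k x * W (sgn x)) / outgoing_factor k x"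
        using nz[OF x0] by (simp add: diff_divide_distrib)
      then have "norm (?\<rho> x) = norm (w x - outgoing_factor k x * W (sgn x)) * sqrt (norm x)"
        by (simp add: norm_divide norm_outgoing_factor)
      also have "\<dots> \<le> C * norm x powr (-3/2) * sqrt (norm x)"
        using Cb[of x] x by (intro mult_right_mono) auto
      also have "\<dots> = C * norm (complex_of_real (1 / norm x))"
        using x0 by (simp add: powr_minus_three_halves norm_divide)
      finally show "norm (?\<rho> x) \<le> C * norm (complex_of_real (1 / norm x))" .
    qed
  qed
  show "\<forall>\<^sub>F x in at_infinity. w x = outgoing_factor k x * (W (sgn x) + ?\<rho> x)"
    unfolding eventually_at_infinity
  proof (intro exI allI impI)
    fix x :: "real^2" assume "1 \<le> norm x"
    then have "x \<noteq> 0" by auto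
    then show "w x = outgoing_factor k x * (W (sgn x) + ?\<rho> x)"
      using nz by simp
  qed
qed

text \<open>Along the ray in direction \<open>d\<close> the outgoing factor cancels and both
  remainders tend to 0. Uniqueness carries the formula for one pattern over to every pattern, as the
  theorem requires.\<close>

lemma helmholtz_far_field_unique:
  assumes "helmholtz_far_field k w W1" "helmholtz_far_field k w W2" "norm d = 1"
  shows "W1 d = W2 d"
proof (rule ccontr)
  assume ne: "W1 d \<noteq> W2 d"
  have ex: "\<exists>\<rho> c b. \<forall>x. b \<le> norm x \<longrightarrow> norm (\<rho> x) \<le> c / norm x \<and> w x = outgoing_factor k x * (W (sgn x) + \<rho> x)"
    if "helmholtz_far_field k w W" for W
  proof -
    note W = that
    obtain \<rho> where \<rho>: "\<rho> \<in> O[at_infinity](\<lambda>x. complex_of_real (1 / norm x))"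
      "\<forall>\<^sub>F x in at_infinity. w x = outgoing_factor k x * (W (sgn x) + \<rho> x)"
      using W unfolding helmholtz_far_field_def outgoing_factor_def[symmetric] by blast
    from \<rho>(1) obtain c where "\<forall>\<^sub>F x in at_infinity. norm (\<rho> x) \<le> c * norm (complex_of_real (1 / norm x))"
      by (rule landau_o.bigE)
    with \<rho>(2) have "\<forall>\<^sub>F x in at_infinity. norm (\<rho> x) \<le> c / norm x \<and> w x = outgoing_factor k x * (W (sgn x) + \<rho> x)"
      by eventually_elim (simp add: norm_divide)
    then show ?thesis unfolding eventually_at_infinity by blast
  qed
  obtain \<rho>1 c1 b1 where 1: "\<And>x. b1 \<le> norm x \<Longrightarrow> norm (\<rho>1 x) \<le> c1 / norm x \<and> w x = outgoing_factor k x * (W1 (sgn x) + \<rho>1 x)"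
    using ex[OF assms(1)] by blast
  obtain \<rho>2 c2 b2 where 2: "\<And>x. b2 \<le> norm x \<Longrightarrow> norm (\<rho>2 x) \<le> c2 / norm x \<and> w x = outgoing_factor k x * (W2 (sgn x) + \<rho>2 x)"
    using ex[OF assms(2)] by blast
  define e where "e = norm (W1 d - W2 d)"
  have e: "e > 0" using ne by (simp add: e_def)
  \<comment> \<open>Beyond \<open>(c1 + c2) / e\<close> the two remainders together are smaller than
    the supposed gap \<open>e\<close>.\<close>
  define r where "r = max 1 (max b1 (max b2 ((c1 + c2) / e + 1)))"
  have r: "r > 0" "b1 \<le> r" "b2 \<le> r" "(c1 + c2) / e < r" by (auto simp: r_def)
  define x where "x = r *\<^sub>R d"
  have x: "norm x = r" "sgn x = d" using r assms(3) by (simp_all add: x_def sgn_div_norm)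
  have nz: "outgoing_factor k x \<noteq> 0"
    using r x by (auto simp: outgoing_factor_def)
  have "W1 d + \<rho>1 x = W2 d + \<rho>2 x"
    using 1[of x] 2[of x] r x nz by simp
  then have "W1 d - W2 d = \<rho>2 x - \<rho>1 x" by (simp add: algebra_simps)
  then have "e \<le> norm (\<rho>2 x) + norm (\<rho>1 x)"
    unfolding e_def by (metis norm_triangle_ineq4)
  also have "\<dots> \<le> c2 / r + c1 / r"
    using 1[of x] 2[of x] r x by (intro add_mono) auto
  finally have "e * r \<le> c1 + c2" using r by (simp add: field_simps)
  moreover have "c1 + c2 < e * r" using r(4) e by (simp add: field_simps)
  ultimately show False by simp
qed

lemma frechet_derivative_component:
  fixes v :: "real^2 \<Rightarrow> complex^2"
  assumes "\<And>j. (\<lambda>x. v x $ j) differentiable (at x)"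
  shows "frechet_derivative v (at x) h $ j = frechet_derivative (\<lambda>x. v x $ j) (at x) h"
proof -
  have "(v has_derivative (\<lambda>h. \<chi> j. frechet_derivative (\<lambda>x. v x $ j) (at x) h)) (at x)"
  proof (subst has_derivative_componentwise_within, rule ballI)
    fix i :: "complex^2" assume "i \<in> Basis"
    then obtain j b where i: "i = axis j b" by (auto simp: Basis_vec_def)
    show "((\<lambda>x. v x \<bullet> i) has_derivative (\<lambda>h. (\<chi> j. frechet_derivative (\<lambda>x. v x $ j) (at x) h) \<bullet> i)) (at x)"
      unfolding i inner_axis using has_derivative_inner_left[OF has_derivative_frechet[OF assms[of j]], of b]
      by simp
  qed
  from frechet_derivative_at[OF this, symmetric] show ?thesis
    by simp
qed

text \<open>The components of the compressional and shear parts are partial derivatives of the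
  potentials up to sign; \<open>c\<close> carries the sign that \<open>grad_perp\<close>
  introduces.\<close>

lemma kupradze_component:
  assumes "open S" "\<And>x. r0 < norm x \<Longrightarrow> x \<in> S" and k: "kupradze k v"
    and v: "\<And>j x. x \<in> S \<Longrightarrow> v x $ j = c j * g j x"
    and g: "\<And>j x. x \<in> S \<Longrightarrow> g j differentiable (at x)" and c: "\<And>j. norm (c j) = 1"
  shows "small_at_infinity (-1/2) (\<lambda>x. frechet_derivative (g j) (at x) (sgn x) - \<i> * of_real k * g j x)"
proof -
  have vd: "((\<lambda>x. v x $ j) has_derivative (\<lambda>h. c j * frechet_derivative (g j) (at x) h)) (at x)" if "x \<in> S" for x j
    by (rule has_derivative_transform_within_open[OF has_derivative_mult_right[OF has_derivative_frechet[OF g[OF that]]]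
        \<open>open S\<close> that]) (simp add: v)
  have "((\<lambda>x. (sqrt (norm x) *\<^sub>R (radial_deriv v x - (\<i> * of_real k) *s v x)) $ j) \<longlongrightarrow> 0 $ j) at_infinity"
    using k unfolding kupradze_def by (rule tendsto_vec_nth)
  then have lim: "((\<lambda>x. sqrt (norm x) *\<^sub>R (radial_deriv v x $ j - \<i> * of_real k * v x $ j)) \<longlongrightarrow> 0) at_infinity"
    by simp
  have eq: "radial_deriv v x $ j - \<i> * of_real k * v x $ j
     = c j * (frechet_derivative (g j) (at x) (sgn x) - \<i> * of_real k * g j x)" if "x \<in> S" for x
  proof -
    have "radial_deriv v x $ j = frechet_derivative (\<lambda>x. v x $ j) (at x) (sgn x)"
      unfolding radial_deriv_def using vd[OF that] by (intro frechet_derivative_component) (auto simp: differentiable_def)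
    also have "\<dots> = c j * frechet_derivative (g j) (at x) (sgn x)"
      by (rule fun_cong[OF frechet_derivative_at[OF vd[OF that], symmetric]])
    finally show ?thesis using v[OF that] by (simp add: algebra_simps)
  qed
  show ?thesis
    unfolding small_at_infinity_def
  proof (intro allI impI)
    fix \<epsilon> :: real assume "\<epsilon> > 0"
    with lim obtain b where b: "\<And>x. b \<le> norm x \<Longrightarrow> norm (radial_deriv v x $ j - \<i> * of_real k * v x $ j) \<le> \<epsilon> * norm x powr (-1/2)"
      unfolding small_at_infinity_tendsto small_at_infinity_def by blast
    show "\<exists>b. \<forall>x. b \<le> norm x \<longrightarrow>
       norm (frechet_derivative (g j) (at x) (sgn x) - \<i> * of_real k * g j x) \<le> \<epsilon> * norm x powr (-1/2)"
    proof (intro exI allI impI)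
      fix x :: "real^2" assume x: "max b (r0 + 1) \<le> norm x"
      then have "x \<in> S" by (intro assms(2)) auto
      from b[of x] x show "norm (frechet_derivative (g j) (at x) (sgn x) - \<i> * of_real k * g j x) \<le> \<epsilon> * norm x powr (-1/2)"
        unfolding eq[OF \<open>x \<in> S\<close>] by (simp add: norm_mult c)
    qed
  qed
qed

section \<open>The Navier equation\<close>

lemma grad_nth: "grad f x $ j = partial j f x"
  using exhaust_2[of j] by (auto simp: grad_def)

text \<open>Equality of mixed partials turns the Navier operator into (2 \<mu> + lam) grad div +
  \<mu> grad_perp div_perp. Division of the equation by \<omega>^2 then gives
  \<open>u = grad \<phi> + grad_perp \<psi>\<close>. A clockwise quarter turn maps \<open>u\<close>
  to \<open>grad \<psi> + grad_perp (- \<phi>)\<close>, whose divergence is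
  \<open>dvg_perp u\<close>; hence the second field.\<close>

lemma flux_fields_of_navier:
  fixes u :: "real^2 \<Rightarrow> complex^2"
  assumes "\<mu> > 0" "2 * \<mu> + lam > 0" "\<omega> > 0" "open S" and u: "Ck 2 u S"
    and nav: "\<And>x. x \<in> S \<Longrightarrow> navier_op \<mu> lam u x + \<omega>\<^sup>2 *\<^sub>R u x = 0"
    and kp: "kp = k_p \<mu> lam \<omega>" and ks: "ks = k_s \<mu> \<omega>"
    and phi: "\<phi> = (\<lambda>x. - (1 / (of_real kp)\<^sup>2) * dvg u x)"
    and psi: "\<psi> = (\<lambda>x. - (1 / (of_real ks)\<^sup>2) * dvg_perp u x)"
  shows "flux_field kp S (\<lambda>x. u x $ 1) (\<lambda>x. u x $ 2) \<phi> \<psi>"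
    and "flux_field ks S (\<lambda>x. u x $ 2) (\<lambda>x. - u x $ 1) \<psi> (\<lambda>x. - \<phi> x)"
proof -
  define u1 u2 where "u1 x = u x $ 1" and "u2 x = u x $ 2" for x
  have C2: "Ck 2 u1 S" "Ck 2 u2 S"
    unfolding u1_def[abs_def] u2_def[abs_def] using Ck_component[OF \<open>open S\<close> u] by auto
  note C1 = Ck_2D[OF C2(1)] and C2' = Ck_2D[OF C2(2)]
  have dvg: "dvg u = (\<lambda>x. partial 1 u1 x + partial 2 u2 x)"
    and dvgp: "dvg_perp u = (\<lambda>x. partial 1 u2 x - partial 2 u1 x)"
    by (simp_all add: dvg_def[abs_def] dvg_perp_def[abs_def] u1_def[abs_def] u2_def[abs_def])
  have dd: "dvg u differentiable (at x)" "dvg_perp u differentiable (at x)" if "x \<in> S" for x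
    unfolding dvg dvgp using C1(4) C2'(4) that by (auto intro!: differentiable_add differentiable_diff)
  have kk: "(complex_of_real kp)\<^sup>2 = of_real (\<omega>\<^sup>2 / (2 * \<mu> + lam))" "(complex_of_real ks)\<^sup>2 = of_real (\<omega>\<^sup>2 / \<mu>)"
    unfolding of_real_power[symmetric] kp ks k_p_def k_s_def using assms(1,2) by (simp_all add: power_divide)
  have Cphi: "Ck 1 \<phi> S" and Cpsi: "Ck 1 \<psi> S"
    unfolding phi psi dvg dvgp
    by (intro Ck_cmult Ck_add Ck_diff \<open>open S\<close> C1(2) C2'(2))+
  have pd: "partial j (dvg u) x = partial j (partial 1 u1) x + partial j (partial 2 u2) x"
    "partial j (dvg_perp u) x = partial j (partial 1 u2) x - partial j (partial 2 u1) x" if "x \<in> S" for j x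
    unfolding dvg dvgp using C1(4) C2'(4) that by (simp_all add: partial_add partial_diff)
  have pphi: "partial j \<phi> x = - (of_real ((2 * \<mu> + lam) / \<omega>\<^sup>2)) * (partial j (partial 1 u1) x + partial j (partial 2 u2) x)"
    and ppsi: "partial j \<psi> x = - (of_real (\<mu> / \<omega>\<^sup>2)) * (partial j (partial 1 u2) x - partial j (partial 2 u1) x)"
    if "x \<in> S" for j x
    unfolding phi psi partial_cmult[OF dd(1)[OF that]] partial_cmult[OF dd(2)[OF that]] pd[OF that] kk by simp_all
  have com: "partial 1 (partial 2 u1) x = partial 2 (partial 1 u1) x"
    "partial 1 (partial 2 u2) x = partial 2 (partial 1 u2) x" if "x \<in> S" for x
    using partial_commute[OF \<open>open S\<close> _ that] C2 by auto
  have navj: "of_real \<mu> * (partial 1 (partial 1 (\<lambda>x. u x $ j)) x + partial 2 (partial 2 (\<lambda>x. u x $ j)) x)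
      + of_real (lam + \<mu>) * (partial j (partial 1 u1) x + partial j (partial 2 u2) x) + of_real (\<omega>\<^sup>2) * u x $ j = 0"
    if "x \<in> S" for x j
  proof -
    have "(navier_op \<mu> lam u x + \<omega>\<^sup>2 *\<^sub>R u x) $ j = 0"
      using nav[OF that] by simp
    then show ?thesis
      unfolding navier_op_def vec_laplacian_def laplacian_def
      by (simp add: grad_nth pd[OF that] scaleR_conv_of_real[where 'a=complex])
  qed
  have om: "complex_of_real (\<omega>\<^sup>2) \<noteq> 0" using \<open>\<omega> > 0\<close> by simp
  have e1: "u1 x = partial 1 \<phi> x - partial 2 \<psi> x" if "x \<in> S" for x
  proof -
    have "of_real (\<omega>\<^sup>2) * (partial 1 \<phi> x - partial 2 \<psi> x)
       = - of_real (2 * \<mu> + lam) * (partial 1 (partial 1 u1) x + partial 1 (partial 2 u2) x)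
         + of_real \<mu> * (partial 2 (partial 1 u2) x - partial 2 (partial 2 u1) x)"
      unfolding pphi[OF that] ppsi[OF that] using \<open>\<omega> > 0\<close> by (simp add: field_simps)
    also have "\<dots> = of_real (\<omega>\<^sup>2) * u1 x"
      using navj[OF that, of 1] unfolding u1_def[symmetric] com(2)[OF that]
      by (simp add: algebra_simps add_eq_0_iff)
    finally show ?thesis using om by simp
  qed
  have e2: "u2 x = partial 2 \<phi> x + partial 1 \<psi> x" if "x \<in> S" for x
  proof -
    have "of_real (\<omega>\<^sup>2) * (partial 2 \<phi> x + partial 1 \<psi> x)
       = - of_real (2 * \<mu> + lam) * (partial 2 (partial 1 u1) x + partial 2 (partial 2 u2) x)
         - of_real \<mu> * (partial 1 (partial 1 u2) x - partial 1 (partial 2 u1) x)"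
      unfolding pphi[OF that] ppsi[OF that] using \<open>\<omega> > 0\<close> by (simp add: field_simps)
    also have "\<dots> = of_real (\<omega>\<^sup>2) * u2 x
       - (of_real \<mu> * (partial 1 (partial 1 u2) x + partial 2 (partial 2 u2) x)
          + of_real (lam + \<mu>) * (partial 2 (partial 1 u1) x + partial 2 (partial 2 u2) x) + of_real (\<omega>\<^sup>2) * u2 x)"
      unfolding com(1)[OF that] by (simp add: algebra_simps)
    also have "\<dots> = of_real (\<omega>\<^sup>2) * u2 x"
      using navj[OF that, of 2] unfolding u2_def[symmetric] by simp
    finally show ?thesis using om by simp
  qed
  have k0: "complex_of_real kp \<noteq> 0" "complex_of_real ks \<noteq> 0"
    using assms(1-3) by (auto simp: kp ks k_p_def k_s_def)
  have Cu: "Ck 1 u1 S" "Ck 1 u2 S" using C1 C2' by auto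
  have um: "partial j (\<lambda>x. - u1 x) x = - partial j u1 x" "partial j (\<lambda>x. - \<phi> x) x = - partial j \<phi> x"
    if "x \<in> S" for j x
    using C1(3)[OF that] Cphi that by (auto intro!: partial_uminus)
  have "flux_field kp S u1 u2 \<phi> \<psi>"
    unfolding flux_field_def
  proof (intro conjI ballI Cu Cphi Cpsi e1 e2)
    show "partial 1 u1 x + partial 2 u2 x = - (of_real kp)\<^sup>2 * \<phi> x" for x
      using k0 by (simp add: phi dvg)
  qed
  then show "flux_field kp S (\<lambda>x. u x $ 1) (\<lambda>x. u x $ 2) \<phi> \<psi>"
    by (simp only: u1_def[abs_def] u2_def[abs_def])
  have "flux_field ks S u2 (\<lambda>x. - u1 x) \<psi> (\<lambda>x. - \<phi> x)"
    unfolding flux_field_def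
  proof (intro conjI ballI Cu Ck_uminus[OF \<open>open S\<close>] Cphi Cpsi)
    fix x assume x: "x \<in> S"
    show "u2 x = partial 1 \<psi> x - partial 2 (\<lambda>x. - \<phi> x) x"
      unfolding um[OF x] e2[OF x] by simp
    show "- u1 x = partial 2 \<psi> x + partial 1 (\<lambda>x. - \<phi> x) x"
      unfolding um[OF x] e1[OF x] by simp
    show "partial 1 u2 x + partial 2 (\<lambda>x. - u1 x) x = - (of_real ks)\<^sup>2 * \<psi> x"
      unfolding um[OF x] using k0 by (simp add: psi dvgp)
  qed
  then show "flux_field ks S (\<lambda>x. u x $ 2) (\<lambda>x. - u x $ 1) \<psi> (\<lambda>x. - \<phi> x)"
    by (simp only: u1_def[abs_def] u2_def[abs_def])
qed

lemma radiating_helmholtzI: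
  assumes "bounded D" "0 < k" and phi: "Ck 2 \<phi> (- closure D)"
    and "\<And>x. x \<in> - closure D \<Longrightarrow> laplacian \<phi> x + (of_real k)\<^sup>2 * \<phi> x = 0"
    and "\<And>j. small_at_infinity (-1/2)
       (\<lambda>x. frechet_derivative (partial j \<phi>) (at x) (sgn x) - \<i> * of_real k * partial j \<phi> x)"
  shows "radiating_helmholtz k D \<phi>"
proof -
  obtain r0 where "\<And>x. x \<in> closure D \<Longrightarrow> norm x \<le> r0"
    using bounded_closure[OF \<open>bounded D\<close>] unfolding bounded_iff by blast
  then have r0: "\<And>x. r0 < norm x \<Longrightarrow> x \<in> - closure D"
    by fastforce
  have "open (- closure D)" by auto
  from sommerfeld_of_gradient[OF this r0 assms(2-5)] show ?thesis
    using assms unfolding radiating_helmholtz_def radial_deriv_def small_at_infinity_tendsto by blast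
qed

theorem theorem3p1:
  fixes \<mu> lam \<omega> kp ks :: real
    and D :: "(real^2) set"
    and u :: "real^2 \<Rightarrow> complex^2"
    and \<phi> \<psi> :: "real^2 \<Rightarrow> complex"
  assumes "\<mu> > 0" and "2 * \<mu> + lam > 0" and "\<omega> > 0"
    and "bounded D" and "C2_domain D"
    and "radiating_navier \<mu> lam \<omega> D u"
    and "kp = k_p \<mu> lam \<omega>" and "ks = k_s \<mu> \<omega>"
    and "\<phi> = (\<lambda>x. - (1 / (of_real kp)\<^sup>2) * dvg u x)"
    and "\<psi> = (\<lambda>x. - (1 / (of_real ks)\<^sup>2) * dvg_perp u x)"
  shows "radiating_helmholtz kp D \<phi> \<and> radiating_helmholtz ks D \<psi> \<and>
    (\<forall>upinf usinf. navier_far_field kp ks u upinf usinf \<longrightarrow>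
       (\<exists>\<phi>inf. helmholtz_far_field kp \<phi> \<phi>inf) \<and>
       (\<exists>\<psi>inf. helmholtz_far_field ks \<psi> \<psi>inf) \<and>
       (\<forall>\<phi>inf. helmholtz_far_field kp \<phi> \<phi>inf \<longrightarrow>
          (\<forall>x\<in>sphere 0 1. \<phi>inf x = 1 / (\<i> * of_real kp) * upinf x)) \<and>
       (\<forall>\<psi>inf. helmholtz_far_field ks \<psi> \<psi>inf \<longrightarrow>
          (\<forall>x\<in>sphere 0 1. \<psi>inf x = 1 / (\<i> * of_real ks) * usinf x)))"
proof -
  define S where "S = - closure D"
  have "open S" unfolding S_def by auto
  obtain r0 where "\<And>x. x \<in> closure D \<Longrightarrow> norm x \<le> r0"
    using bounded_closure[OF \<open>bounded D\<close>] unfolding bounded_iff by blast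
  then have r0: "\<And>x. r0 < norm x \<Longrightarrow> x \<in> S"
    unfolding S_def by fastforce
  have k: "0 < kp" "0 < ks" using assms(1-3) by (simp_all add: assms(7,8) k_p_def k_s_def)
  have u: "Ck 2 u S" "\<And>x. x \<in> S \<Longrightarrow> navier_op \<mu> lam u x + \<omega>\<^sup>2 *\<^sub>R u x = 0"
    and kup: "kupradze kp (compressional kp u)" "kupradze ks (shear ks u)"
    using assms(6) unfolding radiating_navier_def S_def assms(7,8) by auto
  have Cu: "Ck 2 (\<lambda>x. u x $ 1) S" "Ck 2 (\<lambda>x. u x $ 2) S" "Ck 2 (\<lambda>x. - u x $ 1) S"
    using Ck_component[OF \<open>open S\<close> u(1)] Ck_uminus[OF \<open>open S\<close>] by auto
  note ff = flux_fields_of_navier[OF assms(1-3) \<open>open S\<close> u assms(7-10)]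
  have C: "Ck 2 \<phi> S" "Ck 2 \<psi> S"
    using flux_field_regularity[OF ff(1) \<open>open S\<close> k(1) Cu(1,2)]
      flux_field_regularity[OF ff(2) \<open>open S\<close> k(2) Cu(2,3)] by auto
  \<comment> \<open>Each potential plays the role of \<open>\<psi>\<close> in the field of the
    other, so both have to be C^2 before either equation can be derived.\<close>
  have H: "laplacian \<phi> x + (of_real kp)\<^sup>2 * \<phi> x = 0" "laplacian \<psi> x + (of_real ks)\<^sup>2 * \<psi> x = 0" if "x \<in> S" for x
    using flux_field_helmholtz[OF ff(1) \<open>open S\<close> C(1) C(2) that]
      flux_field_helmholtz[OF ff(2) \<open>open S\<close> C(2) Ck_uminus[OF \<open>open S\<close> C(1)] that] by auto
  have "Ck 1 (dvg u) S" "Ck 1 (dvg_perp u) S"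
    unfolding dvg_def[abs_def] dvg_perp_def[abs_def]
    by (intro Ck_add Ck_diff \<open>open S\<close> Ck_2D(2)[OF Cu(1)] Ck_2D(2)[OF Cu(2)])+
  then have dd: "dvg u differentiable (at x)" "dvg_perp u differentiable (at x)" if "x \<in> S" for x
    using that by auto
  have pphi: "partial j \<phi> x = - (1 / (of_real kp)\<^sup>2) * partial j (dvg u) x"
    and ppsi: "partial j \<psi> x = - (1 / (of_real ks)\<^sup>2) * partial j (dvg_perp u) x" if "x \<in> S" for j x
    unfolding assms(9,10) using dd[OF that] by (simp_all only: partial_cmult)
  have "small_at_infinity (-1/2) (\<lambda>x. frechet_derivative (partial j \<phi>) (at x) (sgn x) - \<i> * of_real kp * partial j \<phi> x)" for j
  proof (rule kupradze_component[where c = "\<lambda>_. 1" and g = "\<lambda>j. partial j \<phi>", OF \<open>open S\<close> r0 kup(1)])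
    show "compressional kp u x $ j = 1 * partial j \<phi> x" if "x \<in> S" for j x
      by (simp add: compressional_def grad_nth pphi[OF that] scaleR_conv_of_real[where 'a=complex])
  qed (use Ck_2D(4)[OF C(1)] in auto)
  then have R1: "radiating_helmholtz kp D \<phi>"
    using radiating_helmholtzI[OF assms(4) k(1)] C H unfolding S_def by blast
  \<comment> \<open>The components of \<open>grad_perp\<close> are - \<partial>_2 and \<partial>_1:
    the substitution \<open>3 - j\<close> exchanges the indices, and the first one carries the sign.
    Applying it twice returns \<open>j\<close>, which undoes the exchange below.\<close>
  have s: "small_at_infinity (-1/2) (\<lambda>x. frechet_derivative (partial (3 - j) \<psi>) (at x) (sgn x) - \<i> * of_real ks * partial (3 - j) \<psi> x)" for j
  proof (rule kupradze_component[where c = "\<lambda>j. if j = 1 then - 1 else 1" and g = "\<lambda>j. partial (3 - j) \<psi>", OF \<open>open S\<close> r0 kup(2)])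
    show "shear ks u x $ j = (if j = 1 then - 1 else 1) * partial (3 - j) \<psi> x" if "x \<in> S" for j x
      using exhaust_2[of j]
      by (auto simp: shear_def grad_perp_def ppsi[OF that] scaleR_conv_of_real[where 'a=complex])
  qed (use Ck_2D(4)[OF C(2)] in auto)
  have "small_at_infinity (-1/2) (\<lambda>x. frechet_derivative (partial j \<psi>) (at x) (sgn x) - \<i> * of_real ks * partial j \<psi> x)" for j
    using s[of "3 - j"] by simp
  then have R2: "radiating_helmholtz ks D \<psi>"
    using radiating_helmholtzI[OF assms(4) k(2)] C H unfolding S_def by blast
  have F: "helmholtz_far_field kp \<phi> (\<lambda>d. f d / (\<i> * of_real kp)) \<and> helmholtz_far_field ks \<psi> (\<lambda>d. g d / (\<i> * of_real ks))"
    if nf: "navier_far_field kp ks u f g" for f g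
  proof -
    obtain Lf where Lf: "0 \<le> Lf" "circle_lipschitz Lf f"
      using nf analytic_on_circle_lipschitz unfolding navier_far_field_def by blast
    obtain Lg where Lg: "0 \<le> Lg" "circle_lipschitz Lg g"
      using nf analytic_on_circle_lipschitz unfolding navier_far_field_def by blast
    \<comment> \<open>The clockwise quarter turn sends the transverse direction to the radial one
      and the radial direction to minus the transverse one. In the rotated field \<open>g\<close> is
      therefore the longitudinal pattern and \<open>- f\<close> the transverse one.\<close>
    have Lf': "circle_lipschitz Lf (\<lambda>d. - f d)"
      using Lf(2) by (simp add: circle_lipschitz_def norm_minus_commute)
    define V where "V x = u x - (outgoing_factor kp x * f (sgn x)) *s cvec (sgn x)
        - (outgoing_factor ks x * g (sgn x)) *s cvec (rot90 (sgn x))" for x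
    have "(\<lambda>x. norm (V x)) \<in> O[at_infinity](\<lambda>x. norm x powr (-3/2))"
      using nf unfolding navier_far_field_def V_def outgoing_factor_def by blast
    then obtain K where K: "K > 0" "\<forall>\<^sub>F x in at_infinity. norm (norm (V x)) \<le> K * norm (norm x powr (-3/2))"
      by (rule landau_o.bigE)
    then obtain b where b: "\<And>x. b \<le> norm x \<Longrightarrow> norm (V x) \<le> K * norm x powr (-3/2)"
      unfolding eventually_at_infinity by auto
    have V1: "V x $ 1 = u x $ 1 - (outgoing_factor kp x * f (sgn x) * of_real (sgn x $ 1) - outgoing_factor ks x * g (sgn x) * of_real (sgn x $ 2))"
      and V2: "V x $ 2 = u x $ 2 - (outgoing_factor kp x * f (sgn x) * of_real (sgn x $ 2) + outgoing_factor ks x * g (sgn x) * of_real (sgn x $ 1))" for x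
      by (simp_all add: V_def cvec_def rot90_def)
    have b': "norm (V x $ j) \<le> K * norm x powr (-3/2)" if "b \<le> norm x" for x j
      using b[OF that] Finite_Cartesian_Product.norm_nth_le[of "V x" j] by linarith
    have "\<exists>C b. \<forall>x. b \<le> norm x \<longrightarrow>
     norm (\<phi> x - outgoing_factor kp x * (f (sgn x) / (\<i> * of_real kp))) \<le> C * norm x powr (-3/2)"
    proof (rule flux_field_far_field[OF r0 ff(1) k Lf(2,1) Lg(2,1)])
      show "norm (u x $ 1 - (outgoing_factor kp x * f (sgn x) * of_real (sgn x $ 1) - outgoing_factor ks x * g (sgn x) * of_real (sgn x $ 2))) \<le> K * norm x powr (-3/2)"
        if "b \<le> norm x" for x using b'[OF that, of 1] unfolding V1 .
      show "norm (u x $ 2 - (outgoing_factor kp x * f (sgn x) * of_real (sgn x $ 2) + outgoing_factor ks x * g (sgn x) * of_real (sgn x $ 1))) \<le> K * norm x powr (-3/2)"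
        if "b \<le> norm x" for x using b'[OF that, of 2] unfolding V2 .
    qed (use K in auto)
    then have 1: "helmholtz_far_field kp \<phi> (\<lambda>d. f d / (\<i> * of_real kp))"
      by (rule helmholtz_far_fieldI)
    have "\<exists>C b. \<forall>x. b \<le> norm x \<longrightarrow>
     norm (\<psi> x - outgoing_factor ks x * (g (sgn x) / (\<i> * of_real ks))) \<le> C * norm x powr (-3/2)"
    proof (rule flux_field_far_field[OF r0 ff(2) k(2,1) Lg(2,1) Lf' Lf(1)])
      show "norm (u x $ 2 - (outgoing_factor ks x * g (sgn x) * of_real (sgn x $ 1) - outgoing_factor kp x * - f (sgn x) * of_real (sgn x $ 2))) \<le> K * norm x powr (-3/2)"
        if "b \<le> norm x" for x using b'[OF that, of 2] unfolding V2 by (simp add: add.commute)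
      show "norm (- u x $ 1 - (outgoing_factor ks x * g (sgn x) * of_real (sgn x $ 2) + outgoing_factor kp x * - f (sgn x) * of_real (sgn x $ 1))) \<le> K * norm x powr (-3/2)"
        if "b \<le> norm x" for x
      proof -
        have "- u x $ 1 - (outgoing_factor ks x * g (sgn x) * of_real (sgn x $ 2) + outgoing_factor kp x * - f (sgn x) * of_real (sgn x $ 1)) = - (V x $ 1)"
          unfolding V1 by simp
        then show ?thesis using b'[OF that, of 1] by (simp only: norm_minus_cancel)
      qed
    qed (use K in auto)
    then have 2: "helmholtz_far_field ks \<psi> (\<lambda>d. g d / (\<i> * of_real ks))"
      by (rule helmholtz_far_fieldI)
    show ?thesis using 1 2 ..
  qed
  show ?thesis
  proof (intro conjI R1 R2 allI impI ballI)
    fix f g assume nf: "navier_far_field kp ks u f g"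
    note Ff = F[OF nf, THEN conjunct1] and Fg = F[OF nf, THEN conjunct2]
    show "\<exists>\<phi>inf. helmholtz_far_field kp \<phi> \<phi>inf" using Ff by blast
    show "\<exists>\<psi>inf. helmholtz_far_field ks \<psi> \<psi>inf" using Fg by blast
    show "\<phi>inf x = 1 / (\<i> * of_real kp) * f x"
      if "helmholtz_far_field kp \<phi> \<phi>inf" "x \<in> sphere 0 1" for \<phi>inf x
      using helmholtz_far_field_unique[OF that(1) Ff, of x] that(2) by simp
    show "\<psi>inf x = 1 / (\<i> * of_real ks) * g x"
      if "helmholtz_far_field ks \<psi> \<psi>inf" "x \<in> sphere 0 1" for \<psi>inf x
      using helmholtz_far_field_unique[OF that(1) Fg, of x] that(2) by simp
  qed
qed

end
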